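(* Let $\mathcal{H}$ be a real Hilbert space, $T>0$, $I=[0,T]$, let $m\ge 1$ and let $f_i: I\times\mathcal{H}\to\mathbb{R}$, $i\in\{1,\dots,m\}$, be functions such that for each $t\in I$ the set $$C(t):=\{x\in\mathcal{H}\mid f_i(t,x)\le 0,\ i\in\{1,\dots,m\}\}$$ is nonempty. Suppose there is an extended real number $\rho\in(0,+\infty]$ such that the following four assumptions hold: (A1) There is $L_1>0$ such that for every $x\in\mathcal{H}$ and every $i\in\{1,\dots,m\}$, the function $f_i(\cdot,x)$ is Lipschitz continuous with modulus $L_1$ on $[0,T]$. (A2) For each $t\in[0,T]$ and each $i\in\{1,\dots,m\}$, the function $f_i(t,\cdot)$ is locally Lipschitz continuous on $U_\rho(C(t))$. (A3) There is $\gamma>0$ such that for all $t\in[0,T]$, all $i\in\{1,\dots,m\}$, all $x_1,x_2\in U_\rho(C(t))$ and all $\xi_j\in\partial^C f_i(t,\cdot)(x_j)$, $j=1,2$, $$\langle \xi_1-\xi_2,x_1-x_2\rangle\ge-\gamma\|x_1-x_2\|^2.$$ (A4) There is $\mu>0$ such that for all $t\in[0,T]$ and $x\in C(t)$ there exists $\overline v=v(t,x)\in\mathcal{H}$ with $\|\overline v\|=1$ such that for all $i\in\{1,\dots,m\}$ and all $\xi\in\partial^C f_i(t,\cdot)(x)$ one has $\langle\xi,\overline v\rangle\le-\mu$. Let $g: I\times\mathcal{H}\to\mathcal{H}$ be a (single-valued) map such that: (a) for every $x\in\mathcal{H}$, the map $g(\cdot,x)$ is measurable on $I$; (b) for every $t\in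 I$, the map $g(t,\cdot)$ is scalarly upper semicontinuous on $\mathcal{H}$; (c) there exist a compact subset $K$ of the closed unit ball $\mathbb{B}$ of $\mathcal{H}$ and a non-negative function $\beta(\cdot)\in L^1(I,\mathbb{R})$ such that $g(t,x)\in\beta(t)(1+\|x\|)K$ for all $(t,x)\in I\times\mathcal{H}$. Then, for any $x_0\in C(0)$, the sweeping process $$\begin{cases}-\dot x(t)\in\mathcal{N}_{C(t)}(x(t))+g(t,x(t))\quad\text{for a.e. } t\in I,\\ x(0)=x_0\end{cases}$$ has at least one absolutely continuous solution $x(\cdot):I\to\mathcal{H}$.
   Context: Notation. $\langle\cdot,\cdot\rangle$ and $\|\cdot\|$ are the scalar product and norm of $\mathcal{H}$. For $\Omega\subset\mathcal{H}$, $d(x,\Omega)=\inf_{y\in\Omega}\|x-y\|$, and for $r\in(0,\infty]$ the $r$-enlargement is $U_r(\Omega)=\{x\in\mathcal{H}\mid d(x,\Omega)<r\}$. Clarke subdifferential. For a function $f$ locally Lipschitz near $x$, $\partial^C f(x)=\{\xi\in\mathcal{H}\mid\langle\xi,v\rangle\le f^\circ(x;v)\ \forall v\in\mathcal{H}\}$, where $f^\circ(x;v)=\limsup_{y\to x,\,t\to0^+}\frac{f(y+tv)-f(y)}{t}$. The notation $\partial^C f_i(t,\cdot)(x)$ means the Clarke subdifferential at $x$ of the function $f_i(t,\cdot)$ with $t$ fixed. Clarke normal cone. For a closed set $\Omega\subset\mathcal{H}$ and $x\in\Omega$, the Clarke tangent cone $\mathcal{T}_\Omega(x)$ is the set of all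 $v\in\mathcal{H}$ such that $\lim_{t\to0^+,\,y\to x,\,y\in\Omega}\frac{d(y+tv,\Omega)}{t}=0$, and the Clarke normal cone is $\mathcal{N}_\Omega(x)=\{x^*\in\mathcal{H}\mid\langle x^*,v\rangle\le0\ \text{for all } v\in\mathcal{T}_\Omega(x)\}$. For $x\notin\Omega$, $\mathcal{N}_\Omega(x)=\emptyset$, so the inclusion in the sweeping process entails $x(t)\in C(t)$. Solution. A solution of the sweeping process is an absolutely continuous function $x(\cdot):[0,T]\to\mathcal{H}$ (such a function is Fréchet differentiable almost everywhere with respect to the Lebesgue measure) that satisfies the inclusion for almost every $t\in I$ and the initial condition. Scalar upper semicontinuity. A set-valued map $F:\mathcal{H}\rightrightarrows\mathcal{H}$ is scalarly upper semicontinuous if for every $\zeta\in\mathcal{H}$ the function $x\mapsto\sup_{z\in F(x)}\langle\zeta,z\rangle$ is upper semicontinuous; a single-valued map $h$ is identified with $x\mapsto\{h(x)\}$, so the condition says that $x\mapsto\langle\zeta,h(x)\rangle$ is upper semicontinuous for every $\zeta\in\mathcal{H}$. *)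

theory Defs
  imports "HOL-Analysis.Analysis"
begin

text \<open>
  A real Hilbert space is a type of sort \<open>{real_inner, complete_space}\<close>, of arbitrary
  (possibly infinite) dimension and not assumed separable.
\<close>

text \<open>
  The distance to a set is \<^const>\<open>infdist\<close>. It has the junk value 0 for the empty set, so the
  definitions below agree with the usual ones for nonempty sets only.
\<close>

definition enlargement :: "ereal \<Rightarrow> 'a::metric_space set \<Rightarrow> 'a set" where
  "enlargement r \<Omega> = {x. ereal (infdist x \<Omega>) < r}"

text \<open>
  The upper limit is taken in the extended reals, and \<open>y = x\<close> is allowed as \<open>y\<close> tends to \<open>x\<close>
  (hence \<^const>\<open>nhds\<close>, not a punctured neighbourhood filter). The notion is meant for
  functions that are Lipschitz near \<open>x\<close>, for which the upper limit is finite.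
\<close>

definition clarke_dderiv :: "('a::real_normed_vector \<Rightarrow> real) \<Rightarrow> 'a \<Rightarrow> 'a \<Rightarrow> ereal" where
  "clarke_dderiv f x v =
     Limsup (nhds x \<times>\<^sub>F at_right 0) (\<lambda>(y, t). ereal ((f (y + t *\<^sub>R v) - f y) / t))"

definition clarke_subdiff :: "('a::real_inner \<Rightarrow> real) \<Rightarrow> 'a \<Rightarrow> 'a set" where
  "clarke_subdiff f x = {\<xi>. \<forall>v. ereal (\<xi> \<bullet> v) \<le> clarke_dderiv f x v}"

text \<open>
  The filter \<open>inf (nhds x) (principal \<Omega>)\<close> describes \<open>y\<close> tending to \<open>x\<close> inside \<open>\<Omega>\<close> with
  \<open>y = x\<close> allowed, unlike \<open>at x within \<Omega>\<close>.
\<close>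

definition clarke_tangent_cone :: "'a::real_normed_vector set \<Rightarrow> 'a \<Rightarrow> 'a set" where
  "clarke_tangent_cone \<Omega> x =
     {v. ((\<lambda>(t, y). infdist (y + t *\<^sub>R v) \<Omega> / t) \<longlongrightarrow> 0)
           (at_right 0 \<times>\<^sub>F inf (nhds x) (principal \<Omega>))}"

definition clarke_normal_cone :: "'a::real_inner set \<Rightarrow> 'a \<Rightarrow> 'a set" where
  "clarke_normal_cone \<Omega> x =
     (if x \<in> \<Omega> then {\<zeta>. \<forall>v\<in>clarke_tangent_cone \<Omega> x. \<zeta> \<bullet> v \<le> 0} else {})"

definition upper_semicontinuous :: "('a::topological_space \<Rightarrow> ereal) \<Rightarrow> bool" where
  "upper_semicontinuous \<phi> \<longleftrightarrow> (\<forall>x. Limsup (at x) \<phi> \<le> \<phi> x)"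

definition scalarly_usc :: "('a::real_inner \<Rightarrow> 'a set) \<Rightarrow> bool" where
  "scalarly_usc F \<longleftrightarrow> (\<forall>\<zeta>. upper_semicontinuous (\<lambda>x. SUP z\<in>F x. ereal (\<zeta> \<bullet> z)))"

definition abs_continuous_on :: "real set \<Rightarrow> (real \<Rightarrow> 'a::real_normed_vector) \<Rightarrow> bool" where
  "abs_continuous_on J x \<longleftrightarrow>
     (\<forall>\<epsilon>>0. \<exists>\<delta>>0. \<forall>(n::nat) a b.
        (\<forall>k<n. a k \<le> b k \<and> {a k..b k} \<subseteq> J) \<and>
        disjoint_family_on (\<lambda>k. {a k<..<b k}) {..<n} \<and>
        (\<Sum>k<n. b k - a k) < \<delta>
        \<longrightarrow> (\<Sum>k<n. norm (x (b k) - x (a k))) < \<epsilon>)"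

definition constraint_set :: "nat \<Rightarrow> (nat \<Rightarrow> real \<Rightarrow> 'a \<Rightarrow> real) \<Rightarrow> real \<Rightarrow> 'a set" where
  "constraint_set m f t = {x. \<forall>i\<in>{1..m}. f i t x \<le> 0}"

definition sweeping_solution ::
  "real \<Rightarrow> (real \<Rightarrow> 'a::real_inner set) \<Rightarrow> (real \<Rightarrow> 'a \<Rightarrow> 'a) \<Rightarrow> 'a \<Rightarrow> (real \<Rightarrow> 'a) \<Rightarrow> bool"
where
  "sweeping_solution T C g x0 x \<longleftrightarrow>
     abs_continuous_on {0..T} x \<and> x 0 = x0 \<and>
     (AE t in lebesgue_on {0..T}. \<exists>x'.
        (x has_vector_derivative x') (at t within {0..T}) \<and>
        - x' \<in> {\<zeta> + g t (x t) | \<zeta>. \<zeta> \<in> clarke_normal_cone (C t) (x t)})"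

end

theory Submission
  imports Defs
begin

text \<open>
  Fix a time and put \<open>C = {x. f 1 x \<le> 0 \<and> ... \<and> f m x \<le> 0}\<close>. Hypomonotonicity of the Clarke
  subdifferentials with constant \<open>\<gamma>\<close> says that each constraint function becomes convex after adding
  \<open>\<gamma> / 2\<close> times the squared norm, locally on the balls around points of \<open>C\<close>. The common descent
  direction of slope \<open>\<mu>\<close> at every point of \<open>C\<close> therefore yields, for every small \<open>d\<close>, a point at
  distance at most \<open>d\<close> at which all constraints are at most \<open>- \<mu> d / 2\<close>: minimise the maximum of the
  constraints plus a quadratic penalty (lemma \<open>descent\<close>). Three things follow. The sets \<open>C t\<close> move
  in a Lipschitz way in \<open>t\<close>. Midpoints of points of \<open>C\<close> are quadratically close to \<open>C\<close>, whence
  points near \<open>C\<close> have projections. And proximal normals satisfy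
  \<open>\<zeta> \<bullet> (y - p) \<le> \<kappa> |\<zeta>| |y - p|\<^sup>2\<close> for all \<open>y\<close> in \<open>C\<close>, with one constant \<open>\<kappa>\<close> for all times.

  For such a moving set the solution is produced by the catching-up scheme: on a cell of the time
  grid the state in \<open>g\<close> is frozen, the integral of \<open>g\<close> is subtracted, and the result is projected
  to the set at the end of the cell. The approximate solution is \<open>x0 - H - \<Omega>\<close>, where \<open>H\<close> is the
  primitive of the frozen perturbation and \<open>\<Omega>\<close> collects the projection steps. The primitives \<open>H\<close>
  take values in a fixed compact convex set, because \<open>g\<close> has values in multiples of the compact set
  \<open>K\<close>, so a subsequence converges uniformly. The prox inequality turns the difference
  of two of the functions \<open>\<Omega>\<close> into a Gronwall estimate with an error controlled by the mesh sizes
  and by the difference of the functions \<open>H\<close>; hence the \<open>\<Omega>\<close> converge uniformly too,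
  without compactness of the constraint sets.

  The velocities \<open>\<omega>\<close> of \<open>\<Omega>\<close> are bounded in \<open>L\<^sup>2\<close>. Points of nearly minimal norm in the
  midpoint hulls of their tails form a Cauchy sequence by the parallelogram law, so iterated midpoints
  of the velocities converge almost everywhere, to a velocity of the limit. Inequalities that are
  linear in the velocity survive both the midpoints and the limit, which gives the normal cone inclusion.

  The space need not be separable, so vector integrals are replaced by primitives in the
  weak sense (\<open>weak_primitive\<close>). If the integrand has values in the closure of a countable set, a
  weak primitive is differentiable almost everywhere, by Lebesgue's theorem applied to the
  scalar functions \<open>|q - p|\<close> with \<open>p\<close> in that set.
\<close>

section \<open>Minimisation and supporting functionals\<close>

text \<open>The parallelogram law in abstract form: two nearly minimal points must be close, for otherwise
  a point near their midpoint would beat the infimum. Requiring only some \<open>m\<close> in place of the true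
  midpoint makes the lemma applicable to the projection to a non-convex set.\<close>
lemma midpoint_convex_minimizer:
  fixes \<phi> :: "'a::complete_space \<Rightarrow> real"
  assumes ne: "S \<noteq> {}" and lb: "\<And>x. x \<in> S \<Longrightarrow> B \<le> \<phi> x" and a: "a > 0"
    and mid: "\<And>x y. x \<in> S \<Longrightarrow> y \<in> S \<Longrightarrow> \<exists>m\<in>S. \<phi> m \<le> (\<phi> x + \<phi> y) / 2 - a * (dist x y)\<^sup>2"
    and lsc: "\<And>c. closed {x \<in> S. \<phi> x \<le> c}"
  shows "\<exists>x\<in>S. \<forall>y\<in>S. \<phi> x \<le> \<phi> y"
proof -
  define d where "d = Inf (\<phi> ` S)"
  have bdd: "bdd_below (\<phi> ` S)"
    using lb by (intro bdd_belowI2[of _ B]) auto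
  have d: "d \<le> \<phi> x" if "x \<in> S" for x
    unfolding d_def using bdd that by (auto intro: cInf_lower)
  have "\<exists>x\<in>S. \<phi> x < d + e" if "e > 0" for e
  proof -
    have "Inf (\<phi> ` S) < d + e" using that by (simp add: d_def)
    then show ?thesis using ne bdd by (subst (asm) cInf_less_iff) auto
  qed
  then have "\<exists>x\<in>S. \<phi> x < d + inverse (real (Suc n))" for n
    by simp
  then obtain X where X: "\<And>n. X n \<in> S" "\<And>n. \<phi> (X n) < d + inverse (real (Suc n))"
    by metis
  have X': "\<phi> (X n) \<le> d + inverse (real (Suc N))" if "n \<ge> N" for n N
  proof -
    have "inverse (real (Suc n)) \<le> inverse (real (Suc N))" using that by simp
    with X(2)[of n] show ?thesis by linarith
  qed
  have close: "a * (dist (X n) (X k))\<^sup>2 \<le> inverse (real (Suc N))" if "n \<ge> N" "k \<ge> N" for n k N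
  proof -
    obtain m where "m \<in> S" "\<phi> m \<le> (\<phi> (X n) + \<phi> (X k)) / 2 - a * (dist (X n) (X k))\<^sup>2"
      using mid X(1) by blast
    moreover define i where "i = inverse (real (Suc N))"
    ultimately show ?thesis
      using d[of m] X'[OF that(1)] X'[OF that(2)] unfolding i_def[symmetric] by (simp add: field_simps)
  qed
  have "Cauchy X"
  proof (rule metric_CauchyI)
    fix e :: real assume "e > 0"
    then have "a * e\<^sup>2 > 0" using a by simp
    then obtain N where N: "inverse (real (Suc N)) < a * e\<^sup>2"
      using reals_Archimedean by blast
    have "dist (X n) (X k) < e" if "n \<ge> N" "k \<ge> N" for n k
    proof -
      have "a * (dist (X n) (X k))\<^sup>2 < a * e\<^sup>2" using close[OF that] N by linarith
      then have "(dist (X n) (X k))\<^sup>2 < e\<^sup>2" using a by simp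
      then show ?thesis using \<open>e > 0\<close> by (simp add: power2_less_imp_less)
    qed
    then show "\<exists>M. \<forall>m\<ge>M. \<forall>n\<ge>M. dist (X m) (X n) < e" by blast
  qed
  then obtain x where x: "X \<longlonglongrightarrow> x"
    using Cauchy_convergent convergent_def by blast
  have sub: "x \<in> S \<and> \<phi> x \<le> d + inverse (real (Suc N))" for N
  proof -
    have "x \<in> {x \<in> S. \<phi> x \<le> d + inverse (real (Suc N))}"
    proof (rule Lim_in_closed_set[OF lsc _ _ x])
      show "\<forall>\<^sub>F n in sequentially. X n \<in> {x \<in> S. \<phi> x \<le> d + inverse (real (Suc N))}"
        using X(1) X' by (auto simp: eventually_sequentially)
    qed simp
    then show ?thesis by blast
  qed
  have "\<phi> x \<le> d"
  proof (rule field_le_epsilon)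
    fix e :: real assume "e > 0"
    then obtain N where "inverse (real (Suc N)) < e" using reals_Archimedean by blast
    with sub[of N] show "\<phi> x \<le> d + e" by linarith
  qed
  with sub[of 0] d show ?thesis by (meson order_trans)
qed

text \<open>For each \<open>e > 0\<close> the last point at which \<open>q\<close> has not fallen below the line of slope \<open>- e\<close>
  through \<open>(a, q a)\<close> must be \<open>b\<close>, since otherwise the Dini condition moves it to the right.\<close>
lemma dini_nondecreasing:
  fixes q :: "real \<Rightarrow> real"
  assumes ab: "a \<le> b" and cont: "continuous_on {a..b} q"
    and dini: "\<And>s e. \<lbrakk>a \<le> s; s < b; e > 0\<rbrakk> \<Longrightarrow>
       \<exists>\<delta>>0. \<forall>t. 0 < t \<longrightarrow> t < \<delta> \<longrightarrow> s + t \<le> b \<longrightarrow> q s - e * t \<le> q (s + t)"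
  shows "q a \<le> q b"
proof -
  have main: "q a - e * (b - a) \<le> q b" if e: "e > 0" for e
  proof -
    define A where "A = {s \<in> {a..b}. q a - e * (s - a) \<le> q s}"
    have "closed A"
      unfolding A_def using cont by (intro closed_Collect_le continuous_closed_preimage continuous_intros
        continuous_on_closed_Collect_le) auto
    then have "compact A" unfolding A_def
      by (metis (no_types, lifting) A_def compact_Icc closed_Int_compact inf.absorb_iff2 Collect_mem_eq Int_commute mem_Collect_eq subsetI)
    moreover have "a \<in> A" using ab by (simp add: A_def)
    ultimately obtain c where c: "c \<in> A" "\<And>s. s \<in> A \<Longrightarrow> s \<le> c"
      using compact_attains_sup[of A] by blast
    have "c = b"
    proof (rule ccontr)
      assume "c \<noteq> b"
      then have cb: "a \<le> c" "c < b" using c(1) by (auto simp: A_def)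
      obtain \<delta> where \<delta>: "\<delta> > 0" "\<And>t. 0 < t \<Longrightarrow> t < \<delta> \<Longrightarrow> c + t \<le> b \<Longrightarrow> q c - e * t \<le> q (c + t)"
        using dini[OF cb e] by blast
      define t where "t = min (\<delta> / 2) (b - c)"
      have t: "0 < t" "t < \<delta>" "c + t \<le> b" using \<delta>(1) cb by (auto simp: t_def min_def)
      have "q a - e * (c + t - a) \<le> q (c + t)"
        using \<delta>(2)[OF t] c(1) by (simp add: A_def algebra_simps)
      then have "c + t \<in> A" using t cb by (simp add: A_def)
      with c(2) t show False by fastforce
    qed
    with c(1) show ?thesis by (simp add: A_def)
  qed
  show ?thesis
  proof (cases "a = b")
    case False
    show ?thesis
    proof (rule field_le_epsilon)
      fix e :: real assume "e > 0"
      with ab False have "e / (b - a) > 0" "e / (b - a) * (b - a) = e" by auto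
      with main[of "e / (b - a)"] show "q a \<le> q b + e" by linarith
    qed
  qed simp
qed

text \<open>The Hahn-Banach theorem, up to \<open>e\<close>, for bounded sublinear functions on a Hilbert space. The
  proximal point \<open>w\<close> of \<open>N v\<close> exists by strong convexity, and its residual \<open>N v - w\<close> is a
  subgradient of \<open>p\<close> at \<open>w\<close>. Since \<open>w\<close> stays within \<open>L\<close> of \<open>N v\<close>, this subgradient
  nearly supports \<open>p\<close> at \<open>v\<close> when \<open>N\<close> is large.\<close>
lemma sublinear_support_functional:
  fixes p :: "'a::{real_inner, complete_space} \<Rightarrow> real"
  assumes sub: "\<And>v w. p (v + w) \<le> p v + p w"
    and hom: "\<And>c v. c > 0 \<Longrightarrow> p (c *\<^sub>R v) = c * p v"
    and bd: "\<And>v. p v \<le> L * norm v" and L: "L \<ge> 0" and e: "e > 0"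
  shows "\<exists>\<xi>. (\<forall>w. \<xi> \<bullet> w \<le> p w) \<and> p v - e \<le> \<xi> \<bullet> v"
proof -
  have p0: "p 0 = 0" using hom[of 2 0] by simp
  have low: "- L * norm w \<le> p w" for w
    using sub[of w "- w"] bd[of "- w"] p0 by simp
  have lip: "p w \<le> p u + L * norm (w - u)" for w u
    using sub[of u "w - u"] bd[of "w - u"] by simp
  \<comment> \<open>The estimate at the end of the proof loses \<open>L\<^sup>2 / (4 N)\<close>, which must be at most \<open>e\<close>.\<close>
  define N where "N = L\<^sup>2 / (4 * e) + 1"
  have N: "N > 0" unfolding N_def using e by (simp add: add_nonneg_pos)
  define \<phi> where "\<phi> w = p w + (norm (w - N *\<^sub>R v))\<^sup>2 / 2" for w
  have contp: "continuous_on UNIV p"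
  proof (rule continuous_onI)
    fix x e' assume "(0::real) < e'"
    moreover have "dist (p y) (p x) < e'" if "dist y x < e' / (L + 1)" for y
    proof -
      have "\<bar>p y - p x\<bar> \<le> L * norm (y - x)"
        using lip[of y x] lip[of x y] by (simp add: norm_minus_commute abs_le_iff)
      also have "\<dots> \<le> (L + 1) * norm (y - x)" by (simp add: distrib_right)
      also have "\<dots> < e'" using that L by (simp add: dist_norm field_simps)
      finally show ?thesis by (simp add: dist_real_def)
    qed
    ultimately show "\<exists>d>0. \<forall>x'\<in>UNIV. dist x' x < d \<longrightarrow> dist (p x') (p x) \<le> e'"
      using L by (intro exI[of _ "e' / (L + 1)"]) (auto intro: less_imp_le)
  qed
  have "\<exists>w\<in>UNIV. \<forall>y\<in>UNIV. \<phi> w \<le> \<phi> y"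
  proof (rule midpoint_convex_minimizer[where a = "1/8" and B = "- L\<^sup>2 / 2 - L * norm (N *\<^sub>R v)"])
    fix w
    let ?n = "norm (w - N *\<^sub>R v)"
    have "norm w \<le> ?n + norm (N *\<^sub>R v)" by (metis diff_add_cancel norm_triangle_ineq)
    then have "L * norm w \<le> L * ?n + L * norm (N *\<^sub>R v)"
      using L by (metis distrib_left mult_left_mono)
    then have "- L * ?n - L * norm (N *\<^sub>R v) \<le> p w" using low[of w] by simp
    moreover have "0 \<le> (?n - L)\<^sup>2 / 2" by simp
    then have "L * ?n \<le> ?n\<^sup>2 / 2 + L\<^sup>2 / 2" by (simp add: power2_diff field_simps)
    ultimately show "- L\<^sup>2 / 2 - L * norm (N *\<^sub>R v) \<le> \<phi> w" unfolding \<phi>_def by simp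
  next
    fix x y :: 'a
    let ?m = "(1/2) *\<^sub>R (x + y)"
    have "p ?m \<le> (p x + p y) / 2" using sub[of x y] hom[of "1/2" "x + y"] by simp
    moreover have "(norm (?m - N *\<^sub>R v))\<^sup>2 = ((norm (x - N *\<^sub>R v))\<^sup>2 + (norm (y - N *\<^sub>R v))\<^sup>2) / 2 - (dist x y)\<^sup>2 / 4"
      by (simp add: dist_norm power2_norm_eq_inner algebra_simps inner_commute) (simp add: field_simps)
    ultimately show "\<exists>m\<in>UNIV. \<phi> m \<le> (\<phi> x + \<phi> y) / 2 - 1/8 * (dist x y)\<^sup>2"
      unfolding \<phi>_def by (intro bexI[of _ ?m]) (auto simp: field_simps)
  next
    fix c
    have "closed {x. \<phi> x \<le> c}" unfolding \<phi>_def
      using contp by (intro closed_Collect_le continuous_intros) auto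
    then show "closed {x \<in> UNIV. \<phi> x \<le> c}" by simp
  qed auto
  then obtain w where w: "\<And>y. \<phi> w \<le> \<phi> y" by blast
  define \<xi> where "\<xi> = N *\<^sub>R v - w"
  have first: "p (w + s *\<^sub>R u) - p w \<ge> s * (\<xi> \<bullet> u) - s\<^sup>2 / 2 * (norm u)\<^sup>2" for s u
  proof -
    have "(norm (w + s *\<^sub>R u - N *\<^sub>R v))\<^sup>2 = (norm (w - N *\<^sub>R v))\<^sup>2 - 2 * s * (\<xi> \<bullet> u) + s\<^sup>2 * (norm u)\<^sup>2"
      unfolding \<xi>_def by (simp add: power2_norm_eq_inner algebra_simps inner_commute) (simp add: power2_eq_square)
    then show ?thesis using w[of "w + s *\<^sub>R u"] unfolding \<phi>_def by (simp add: field_simps)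
  qed
  have lim: "B \<le> A" if "\<And>s. 0 < s \<Longrightarrow> s < 1 \<Longrightarrow> B - s * c \<le> A" for A B c :: real
  proof (rule field_le_epsilon)
    fix e :: real assume "e > 0"
    define s where "s = min (1/2) (e / (\<bar>c\<bar> + 1))"
    have s: "0 < s" "s < 1" using \<open>e > 0\<close> by (auto simp: s_def)
    have "s * c \<le> s * (\<bar>c\<bar> + 1)" using s by (intro mult_left_mono) auto
    also have "\<dots> \<le> e / (\<bar>c\<bar> + 1) * (\<bar>c\<bar> + 1)" by (intro mult_right_mono) (auto simp: s_def)
    also have "\<dots> = e" by simp
    finally show "B \<le> A + e" using that[OF s] by simp
  qed
  have le: "\<xi> \<bullet> u \<le> p u" for u
  proof (rule lim[where c = "(norm u)\<^sup>2 / 2"])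
    fix s :: real assume s: "0 < s" "s < 1"
    have "s * (\<xi> \<bullet> u) - s\<^sup>2 / 2 * (norm u)\<^sup>2 \<le> s * p u"
      using first[of s u] sub[of w "s *\<^sub>R u"] hom[of s u] s by simp
    then have "s * (\<xi> \<bullet> u - s * ((norm u)\<^sup>2 / 2)) \<le> s * p u" by (simp add: algebra_simps power2_eq_square)
    then show "\<xi> \<bullet> u - s * ((norm u)\<^sup>2 / 2) \<le> p u" using s by simp
  qed
  have "p w \<le> \<xi> \<bullet> w"
  proof (rule lim[where c = "(norm w)\<^sup>2 / 2"])
    fix s :: real assume s: "0 < s" "s < 1"
    have "w + s *\<^sub>R (- w) = (1 - s) *\<^sub>R w" by (simp add: algebra_simps)
    then have "s * (\<xi> \<bullet> (- w)) - s\<^sup>2 / 2 * (norm w)\<^sup>2 \<le> (1 - s) * p w - p w"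
      using first[of s "- w"] hom[of "1 - s" w] s by simp
    then have "s * (p w - s * ((norm w)\<^sup>2 / 2)) \<le> s * (\<xi> \<bullet> w)" by (simp add: algebra_simps power2_eq_square)
    then show "p w - s * ((norm w)\<^sup>2 / 2) \<le> \<xi> \<bullet> w" using s by simp
  qed
  moreover have "p (N *\<^sub>R v) \<le> p w + L * norm \<xi>" using lip[of "N *\<^sub>R v" w] by (simp add: \<xi>_def)
  moreover have "\<xi> \<bullet> (N *\<^sub>R v) = \<xi> \<bullet> w + (norm \<xi>)\<^sup>2"
    by (simp add: \<xi>_def power2_norm_eq_inner algebra_simps inner_commute)
  moreover have "0 \<le> (norm \<xi> - L / 2)\<^sup>2" by simp
  then have "L * norm \<xi> \<le> (norm \<xi>)\<^sup>2 + L\<^sup>2 / 4" by (simp add: power2_diff field_simps)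
  ultimately have "N * p v - L\<^sup>2 / 4 \<le> N * (\<xi> \<bullet> v)" using hom[OF N, of v] by simp
  moreover have "L\<^sup>2 / 4 \<le> N * e" using e by (simp add: N_def field_simps)
  ultimately have "N * (p v - e) \<le> N * (\<xi> \<bullet> v)" by (simp add: algebra_simps)
  then show ?thesis using le N by auto
qed

section \<open>Clarke subgradients of hypomonotone functions\<close>

lemma eventually_nhds_at_right_iff:
  fixes x :: "'a::metric_space"
  shows "(\<forall>\<^sub>F (y, t) in nhds x \<times>\<^sub>F at_right (0::real). P y t) \<longleftrightarrow>
     (\<exists>\<delta>>0. \<forall>y t. dist y x < \<delta> \<longrightarrow> 0 < t \<longrightarrow> t < \<delta> \<longrightarrow> P y t)"
proof
  assume "\<forall>\<^sub>F (y, t) in nhds x \<times>\<^sub>F at_right (0::real). P y t"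
  then obtain Q R where QR: "eventually Q (nhds x)" "eventually R (at_right (0::real))"
    "\<And>y t. Q y \<Longrightarrow> R t \<Longrightarrow> P y t"
    unfolding eventually_prod_filter by auto
  obtain d1 where "d1 > 0" "\<And>y. dist y x < d1 \<Longrightarrow> Q y"
    using QR(1) unfolding eventually_nhds_metric by blast
  moreover obtain d2 where "d2 > 0" "\<And>t. 0 < t \<Longrightarrow> t < d2 \<Longrightarrow> R t"
    using QR(2) unfolding eventually_at_right_field by blast
  ultimately show "\<exists>\<delta>>0. \<forall>y t. dist y x < \<delta> \<longrightarrow> 0 < t \<longrightarrow> t < \<delta> \<longrightarrow> P y t"
    using QR(3) by (intro exI[of _ "min d1 d2"]) auto
next
  assume "\<exists>\<delta>>0. \<forall>y t. dist y x < \<delta> \<longrightarrow> 0 < t \<longrightarrow> t < \<delta> \<longrightarrow> P y t"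
  then obtain \<delta> where "\<delta> > 0" "\<And>y t. dist y x < \<delta> \<Longrightarrow> 0 < t \<Longrightarrow> t < \<delta> \<Longrightarrow> P y t" by blast
  then show "\<forall>\<^sub>F (y, t) in nhds x \<times>\<^sub>F at_right (0::real). P y t"
    unfolding eventually_prod_filter
    by (intro exI[of _ "\<lambda>y. dist y x < \<delta>"] exI[of _ "\<lambda>t. 0 < t \<and> t < \<delta>"])
       (auto simp: eventually_nhds_metric eventually_at_right_field)
qed

lemma clarke_dderiv_lessD:
  assumes "clarke_dderiv f x v < ereal a"
  shows "\<exists>\<delta>>0. \<forall>y t. dist y x < \<delta> \<longrightarrow> 0 < t \<longrightarrow> t < \<delta> \<longrightarrow> f (y + t *\<^sub>R v) - f y \<le> a * t"
proof -
  have "\<forall>\<^sub>F (y, t) in nhds x \<times>\<^sub>F at_right 0. ereal ((f (y + t *\<^sub>R v) - f y) / t) < ereal a"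
    using Limsup_lessD[OF assms[unfolded clarke_dderiv_def]] by (simp add: case_prod_unfold)
  then obtain \<delta> where "\<delta> > 0"
    and *: "\<And>y t. dist y x < \<delta> \<Longrightarrow> 0 < t \<Longrightarrow> t < \<delta> \<Longrightarrow> (f (y + t *\<^sub>R v) - f y) / t < a"
    unfolding eventually_nhds_at_right_iff by auto
  have "f (y + t *\<^sub>R v) - f y \<le> a * t" if "dist y x < \<delta>" "0 < t" "t < \<delta>" for y t
    using *[OF that] that by (simp add: field_simps)
  with \<open>\<delta> > 0\<close> show ?thesis by blast
qed

lemma clarke_dderiv_leI:
  assumes "\<delta> > 0" "\<And>y t. dist y x < \<delta> \<Longrightarrow> 0 < t \<Longrightarrow> t < \<delta> \<Longrightarrow> f (y + t *\<^sub>R v) - f y \<le> a * t"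
  shows "clarke_dderiv f x v \<le> ereal a"
  unfolding clarke_dderiv_def
proof (rule Limsup_bounded)
  have "\<forall>\<^sub>F (y, t) in nhds x \<times>\<^sub>F at_right 0. ereal ((f (y + t *\<^sub>R v) - f y) / t) \<le> ereal a"
    unfolding eventually_nhds_at_right_iff using assms by (intro exI[of _ \<delta>]) (auto simp: field_simps)
  then show "\<forall>\<^sub>F z in nhds x \<times>\<^sub>F at_right 0. (case z of (y, t) \<Rightarrow> ereal ((f (y + t *\<^sub>R v) - f y) / t)) \<le> ereal a"
    by (simp add: case_prod_unfold)
qed

text \<open>The generalised directional derivative of a Lipschitz function is a bounded sublinear function
  of the direction, and the Clarke subdifferential is the set of linear functionals below it.\<close>
lemma clarke_dderiv_support:
  fixes f :: "'a::{real_inner, complete_space} \<Rightarrow> real"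
  assumes lip: "L-lipschitz_on (ball x d) f" and d: "d > 0" and e: "e > 0"
  shows "\<exists>\<xi>\<in>clarke_subdiff f x. clarke_dderiv f x v \<le> ereal (\<xi> \<bullet> v + e)"
proof -
  have L: "L \<ge> 0" using lip by (rule lipschitz_on_nonneg)
  have step: "\<bar>f (y + t *\<^sub>R v) - f y\<bar> \<le> L * norm v * t"
    if y: "dist y x < d / (2 + norm v)" and t: "0 < t" "t < d / (2 + norm v)" for y t v
  proof -
    have pos: "2 + norm v > 0" by (simp add: add_pos_nonneg)
    have t': "t * (2 + norm v) < d" using t pos by (simp add: pos_less_divide_eq)
    have y': "dist y x * (2 + norm v) < d" using y pos by (simp add: pos_less_divide_eq)
    have "dist y x * 2 \<le> dist y x * (2 + norm v)" by (intro mult_left_mono) auto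
    then have yd: "dist y x < d / 2" using y' by simp
    have "dist (y + t *\<^sub>R v) x \<le> dist y x + t * norm v"
      using dist_triangle[of "y + t *\<^sub>R v" x y] t by (simp add: dist_norm)
    also have "\<dots> < d"
    proof -
      have "max t (dist y x) * (2 + norm v) < d" using t' y' by (auto simp: max_def)
      moreover have "t * norm v \<le> max t (dist y x) * norm v" by (intro mult_right_mono) auto
      moreover have "dist y x \<le> max t (dist y x) * 2" using t by (auto simp: max_def)
      ultimately show ?thesis by (simp add: distrib_left)
    qed
    finally have *: "dist (y + t *\<^sub>R v) x < d" .
    have "dist (f (y + t *\<^sub>R v)) (f y) \<le> L * dist (y + t *\<^sub>R v) y"
      using lip * yd d by (intro lipschitz_onD[OF lip]) (auto simp: dist_commute)
    then show ?thesis using t by (simp add: dist_norm mult.assoc mult.left_commute mult.commute)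
  qed
  have dpos: "d / (2 + norm v) > 0" for v :: 'a using d by (simp add: add_pos_nonneg)
  have up: "clarke_dderiv f x v \<le> ereal (L * norm v)" for v
    using step[of _ v] by (intro clarke_dderiv_leI[OF dpos]) (auto simp: abs_le_iff)
  have lowr: "\<not> clarke_dderiv f x v < ereal (- (L * norm v) - 1)" for v
  proof
    assume "clarke_dderiv f x v < ereal (- (L * norm v) - 1)"
    from clarke_dderiv_lessD[OF this] obtain \<delta> where \<delta>: "\<delta> > 0"
      "\<And>y t. dist y x < \<delta> \<Longrightarrow> 0 < t \<Longrightarrow> t < \<delta> \<Longrightarrow> f (y + t *\<^sub>R v) - f y \<le> (- (L * norm v) - 1) * t" by blast
    have "0 < min \<delta> (d / (2 + norm v))" using \<delta>(1) dpos[of v] by simp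
    then obtain t where t: "0 < t" "t < \<delta>" "t < d / (2 + norm v)"
      by (meson dense min_less_iff_conj)
    have "\<bar>f (x + t *\<^sub>R v) - f x\<bar> \<le> L * norm v * t" using step[of x v t] dpos[of v] t by simp
    moreover have "f (x + t *\<^sub>R v) - f x \<le> (- (L * norm v) - 1) * t" using \<delta>(2)[of x t] \<delta>(1) t by simp
    ultimately show False using t(1) by (simp add: algebra_simps)
  qed
  define p where "p v = real_of_ereal (clarke_dderiv f x v)" for v
  have p: "clarke_dderiv f x v = ereal (p v)" for v
    unfolding p_def using up[of v] lowr[of v] by (cases "clarke_dderiv f x v") auto
  have pD: "\<exists>\<delta>>0. \<forall>y t. dist y x < \<delta> \<longrightarrow> 0 < t \<longrightarrow> t < \<delta> \<longrightarrow> f (y + t *\<^sub>R v) - f y \<le> a * t" if "p v < a" for v a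
    using that by (intro clarke_dderiv_lessD) (simp add: p)
  have pI: "p v \<le> a" if "\<delta> > 0" "\<And>y t. dist y x < \<delta> \<Longrightarrow> 0 < t \<Longrightarrow> t < \<delta> \<Longrightarrow> f (y + t *\<^sub>R v) - f y \<le> a * t" for v a \<delta>
    using clarke_dderiv_leI[of \<delta> x f v a] that by (simp add: p)
  have sub: "p (v + w) \<le> p v + p w" for v w
  proof (rule field_le_epsilon)
    fix e :: real assume e: "e > 0"
    obtain d1 where d1: "d1 > 0" "\<And>y t. dist y x < d1 \<Longrightarrow> 0 < t \<Longrightarrow> t < d1 \<Longrightarrow> f (y + t *\<^sub>R v) - f y \<le> (p v + e/2) * t"
      using pD[of v "p v + e/2"] e by auto
    obtain d2 where d2: "d2 > 0" "\<And>y t. dist y x < d2 \<Longrightarrow> 0 < t \<Longrightarrow> t < d2 \<Longrightarrow> f (y + t *\<^sub>R w) - f y \<le> (p w + e/2) * t"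
      using pD[of w "p w + e/2"] e by auto
    define \<delta> where "\<delta> = min d1 (d2 / (2 + norm v))"
    have pos: "2 + norm v > 0" by (simp add: add_pos_nonneg)
    have dd0: "0 < d2 / (2 + norm v)" using d2(1) pos by simp
    have "d2 / (2 + norm v) * (2 + norm v) = d2" using pos by simp
    then have "2 * (d2 / (2 + norm v)) + d2 / (2 + norm v) * norm v = d2" by (simp only: distrib_right mult.commute)
    moreover have "d2 / (2 + norm v) * norm v \<ge> 0" using dd0 by (intro mult_nonneg_nonneg) auto
    ultimately have dd: "0 < d2 / (2 + norm v)" "d2 / (2 + norm v) \<le> d2 / 2"
      "d2 / (2 + norm v) * norm v \<le> d2 - d2 / (2 + norm v)"
      using dd0 by linarith+
    show "p (v + w) \<le> p v + p w + e"
    proof (rule pI[of \<delta>])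
      show "\<delta> > 0" using d1 dd by (simp add: \<delta>_def)
      fix y t assume yt: "dist y x < \<delta>" "0 < t" "t < \<delta>"
      have "t * norm v \<le> d2 / (2 + norm v) * norm v" using yt by (intro mult_right_mono) (auto simp: \<delta>_def)
      then have "dist (y + t *\<^sub>R v) x < d2"
        using dist_triangle[of "y + t *\<^sub>R v" x y] yt dd by (simp add: dist_norm \<delta>_def)
      moreover have "t < d2 / (2 + norm v)" using yt by (simp add: \<delta>_def)
      then have "t < d2" using dd d2(1) by linarith
      ultimately have "f (y + t *\<^sub>R v + t *\<^sub>R w) - f (y + t *\<^sub>R v) \<le> (p w + e/2) * t" using d2(2) yt by blast
      moreover have "f (y + t *\<^sub>R v) - f y \<le> (p v + e/2) * t" using d1(2) yt by (simp add: \<delta>_def)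
      ultimately show "f (y + t *\<^sub>R (v + w)) - f y \<le> (p v + p w + e) * t"
        by (simp add: algebra_simps)
    qed
  qed
  have hom1: "p (c *\<^sub>R v) \<le> c * p v" if c: "c > 0" for c v
  proof (rule field_le_epsilon)
    fix e :: real assume e: "e > 0"
    obtain d1 where d1: "d1 > 0" "\<And>y t. dist y x < d1 \<Longrightarrow> 0 < t \<Longrightarrow> t < d1 \<Longrightarrow> f (y + t *\<^sub>R v) - f y \<le> (p v + e/c) * t"
      using pD[of v "p v + e/c"] e c by auto
    show "p (c *\<^sub>R v) \<le> c * p v + e"
    proof (rule pI[of "min d1 (d1 / c)"])
      show "0 < min d1 (d1 / c)" using d1 c by simp
      fix y t assume yt: "dist y x < min d1 (d1 / c)" "0 < t" "t < min d1 (d1 / c)"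
      then have "t * c < d1" using c by (simp add: pos_less_divide_eq)
      then have "f (y + (t * c) *\<^sub>R v) - f y \<le> (p v + e/c) * (t * c)" using d1(2)[of y "t * c"] yt c by simp
      also have "\<dots> = (c * p v + e) * t" using c by (simp add: field_simps)
      finally show "f (y + t *\<^sub>R c *\<^sub>R v) - f y \<le> (c * p v + e) * t" by simp
    qed
  qed
  have hom: "p (c *\<^sub>R v) = c * p v" if c: "c > 0" for c v
  proof -
    have "p (inverse c *\<^sub>R (c *\<^sub>R v)) \<le> inverse c * p (c *\<^sub>R v)" by (rule hom1) (use c in simp)
    then have "c * p v \<le> p (c *\<^sub>R v)" using c by (simp add: field_simps)
    with hom1[OF c] show ?thesis by (simp add: antisym)
  qed
  have bd: "p v \<le> L * norm v" for v using up[of v] by (simp add: p)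
  obtain \<xi> where "\<And>w. \<xi> \<bullet> w \<le> p w" "p v - e \<le> \<xi> \<bullet> v"
    using sublinear_support_functional[OF sub hom bd L e] by blast
  then show ?thesis by (intro bexI[of _ \<xi>]) (auto simp: clarke_subdiff_def p)
qed

lemma clarke_subdiff_nonempty:
  fixes f :: "'a::{real_inner, complete_space} \<Rightarrow> real"
  assumes "L-lipschitz_on (ball x d) f" "d > 0"
  shows "clarke_subdiff f x \<noteq> {}"
  using clarke_dderiv_support[OF assms zero_less_one] by blast

text \<open>The form in which Clarke subgradients are used: a bound on all subgradients in the direction
  \<open>v\<close> bounds the difference quotients along \<open>v\<close> at all points near \<open>x\<close>.\<close>
lemma clarke_subdiff_upper_bound:
  fixes f :: "'a::{real_inner, complete_space} \<Rightarrow> real"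
  assumes "L-lipschitz_on (ball x d) f" "d > 0"
    and a: "\<And>\<xi>. \<xi> \<in> clarke_subdiff f x \<Longrightarrow> \<xi> \<bullet> v \<le> a" and ab: "a < b"
  shows "\<exists>\<delta>>0. \<forall>y t. dist y x < \<delta> \<longrightarrow> 0 < t \<longrightarrow> t < \<delta> \<longrightarrow> f (y + t *\<^sub>R v) - f y \<le> b * t"
proof (rule clarke_dderiv_lessD)
  obtain \<xi> where "\<xi> \<in> clarke_subdiff f x" "clarke_dderiv f x v \<le> ereal (\<xi> \<bullet> v + (b - a) / 2)"
    using clarke_dderiv_support[OF assms(1,2), of "(b - a) / 2" v] ab by auto
  moreover have "\<xi> \<bullet> v + (b - a) / 2 < b" using a[OF calculation(1)] ab by (simp add: field_simps)
  ultimately show "clarke_dderiv f x v < ereal b" by (meson ereal_less_eq(3) le_less_trans less_ereal.simps(1))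
qed

lemma clarke_subdiff_directional_bound:
  fixes f :: "'a::{real_inner, complete_space} \<Rightarrow> real"
  assumes "L-lipschitz_on (ball x d) f" "d > 0"
    and "\<And>\<xi>. \<xi> \<in> clarke_subdiff f x \<Longrightarrow> \<xi> \<bullet> v \<le> a" and "a < b"
  shows "\<forall>\<^sub>F t in at_right 0. f (x + t *\<^sub>R v) - f x \<le> b * t"
proof -
  obtain \<delta> where "\<delta> > 0" "\<And>y t. dist y x < \<delta> \<Longrightarrow> 0 < t \<Longrightarrow> t < \<delta> \<Longrightarrow> f (y + t *\<^sub>R v) - f y \<le> b * t"
    using clarke_subdiff_upper_bound[OF assms] by blast
  then show ?thesis unfolding eventually_at_right_field by (intro exI[of _ \<delta>]) auto
qed

text \<open>The endpoint \<open>a\<close> is excluded because hypomonotonicity gives no information about two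
  different subgradients at one and the same point.\<close>
lemma dini_nondecreasing_interior:
  fixes q :: "real \<Rightarrow> real"
  assumes ab: "a < b" and cont: "continuous_on {a..b} q"
    and dini: "\<And>s e. \<lbrakk>a < s; s < b; e > 0\<rbrakk> \<Longrightarrow>
       \<exists>\<delta>>0. \<forall>t. 0 < t \<longrightarrow> t < \<delta> \<longrightarrow> s + t \<le> b \<longrightarrow> q s - e * t \<le> q (s + t)"
  shows "q a \<le> q b"
proof (rule tendsto_upperbound)
  have "(q \<longlongrightarrow> q a) (at a within {a..b})"
    using cont ab by (simp add: continuous_on_def)
  then show "(q \<longlongrightarrow> q a) (at a within {a<..<b})"
    by (rule tendsto_within_subset) auto
  have "q s \<le> q b" if s: "a < s" "s < b" for s
  proof (rule dini_nondecreasing[where q = q])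
    show "continuous_on {s..b} q" using cont by (rule continuous_on_subset) (use s in auto)
  qed (use s dini in auto)
  then show "\<forall>\<^sub>F s in at a within {a<..<b}. q s \<le> q b"
    by (simp add: eventually_at_filter)
  show "at a within {a<..<b} \<noteq> bot"
    using ab islimpt_greaterThanLessThan1[of a b] by (simp add: trivial_limit_within)
qed

lemma locally_lipschitz_continuous_on:
  fixes f :: "'a::metric_space \<Rightarrow> real"
  assumes "\<And>x. x \<in> S \<Longrightarrow> \<exists>d>0. \<exists>L. L-lipschitz_on (ball x d) f"
  shows "continuous_on S f"
proof (rule continuous_at_imp_continuous_on, rule ballI)
  fix x assume "x \<in> S"
  then obtain d L where "d > 0" "L-lipschitz_on (ball x d) f" using assms by blast
  then show "isCont f x"
    using lipschitz_on_continuous_on[of L "ball x d" f] by (simp add: continuous_on_eq_continuous_at)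
qed

text \<open>Along the segment from \<open>y\<close> to \<open>z\<close> hypomonotonicity bounds all subgradients at
  \<open>y + s v\<close> in the direction \<open>- v\<close> by \<open>- \<xi> \<bullet> v + \<gamma> s |v|\<^sup>2\<close>. This is a lower bound on the right
  Dini derivative of the restriction, which is integrated over the segment.\<close>
lemma hypomonotone_subdiff_lower_quadratic:
  fixes f :: "'a::{real_inner, complete_space} \<Rightarrow> real"
  assumes S: "convex S" and lip: "\<And>x. x \<in> S \<Longrightarrow> \<exists>d>0. \<exists>L. L-lipschitz_on (ball x d) f"
    and hypo: "\<And>x1 x2 \<xi>1 \<xi>2. \<lbrakk>x1 \<in> S; x2 \<in> S; \<xi>1 \<in> clarke_subdiff f x1; \<xi>2 \<in> clarke_subdiff f x2\<rbrakk>
        \<Longrightarrow> (\<xi>1 - \<xi>2) \<bullet> (x1 - x2) \<ge> - \<gamma> * (norm (x1 - x2))\<^sup>2"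
    and y: "y \<in> S" and z: "z \<in> S" and \<xi>: "\<xi> \<in> clarke_subdiff f y" and \<gamma>: "\<gamma> \<ge> 0"
  shows "f y + \<xi> \<bullet> (z - y) - \<gamma> / 2 * (norm (z - y))\<^sup>2 \<le> f z"
proof -
  define v where "v = z - y"
  define V where "V = (norm v)\<^sup>2"
  have V: "V \<ge> 0" by (simp add: V_def)
  define q where "q s = f (y + s *\<^sub>R v) - s * (\<xi> \<bullet> v) + \<gamma> / 2 * s\<^sup>2 * V" for s :: real
  have seg: "y + s *\<^sub>R v \<in> S" if "0 \<le> s" "s \<le> 1" for s
  proof -
    have "(1 - s) *\<^sub>R y + s *\<^sub>R z \<in> S" using S y z that by (simp add: convex_alt)
    then show ?thesis by (simp add: v_def algebra_simps)
  qed
  have contf: "continuous_on S f" using lip by (rule locally_lipschitz_continuous_on)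
  have "continuous_on {0..1} (\<lambda>s. f (y + s *\<^sub>R v))"
  proof (rule continuous_on_compose2[OF contf])
    show "continuous_on {0..1} (\<lambda>s. y + s *\<^sub>R v)" by (intro continuous_intros)
  qed (use seg in auto)
  then have contq: "continuous_on {0..1} q" unfolding q_def by (intro continuous_intros)
  have "q 0 \<le> q 1"
  proof (rule dini_nondecreasing_interior[OF _ contq])
    fix s e :: real assume s: "0 < s" "s < 1" and e: "e > 0"
    let ?x = "y + s *\<^sub>R v"
    have x: "?x \<in> S" using seg s by simp
    then obtain d L where dL: "L-lipschitz_on (ball ?x d) f" "d > 0" using lip by blast
    have a: "\<eta> \<bullet> (- v) \<le> - (\<xi> \<bullet> v) + \<gamma> * s * V" if "\<eta> \<in> clarke_subdiff f ?x" for \<eta>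
    proof -
      have "(\<eta> - \<xi>) \<bullet> (?x - y) \<ge> - \<gamma> * (norm (?x - y))\<^sup>2" by (rule hypo[OF x y that \<xi>])
      then have "s * ((\<eta> - \<xi>) \<bullet> v) \<ge> s * (- \<gamma> * s * V)"
        using s by (simp add: V_def power_mult_distrib power2_eq_square algebra_simps)
      then have "(\<eta> - \<xi>) \<bullet> v \<ge> - \<gamma> * s * V" using s(1) by (rule mult_left_le_imp_le)
      then show ?thesis by (simp add: inner_diff_left)
    qed
    obtain \<delta> where \<delta>: "\<delta> > 0" "\<And>x' t. dist x' ?x < \<delta> \<Longrightarrow> 0 < t \<Longrightarrow> t < \<delta> \<Longrightarrow>
        f (x' + t *\<^sub>R (- v)) - f x' \<le> (- (\<xi> \<bullet> v) + \<gamma> * s * V + e) * t"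
      using clarke_subdiff_upper_bound[OF dL a, of "- (\<xi> \<bullet> v) + \<gamma> * s * V + e"] e by auto
    show "\<exists>\<delta>>0. \<forall>t. 0 < t \<longrightarrow> t < \<delta> \<longrightarrow> s + t \<le> 1 \<longrightarrow> q s - e * t \<le> q (s + t)"
    proof (intro exI conjI allI impI)
      show "\<delta> / (norm v + 1) > 0" using \<delta>(1) by (simp add: add_nonneg_pos)
      fix t assume t: "0 < t" "t < \<delta> / (norm v + 1)"
      have "t * (norm v + 1) < \<delta>" using t by (simp add: pos_less_divide_eq add_nonneg_pos)
      moreover have "t * norm v \<ge> 0" using t by simp
      ultimately have "t * norm v < \<delta>" "t < \<delta>" using t unfolding distrib_left by linarith+
      then have "f (y + (s + t) *\<^sub>R v + t *\<^sub>R (- v)) - f (y + (s + t) *\<^sub>R v) \<le> (- (\<xi> \<bullet> v) + \<gamma> * s * V + e) * t"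
        using t by (intro \<delta>(2)) (auto simp: dist_norm algebra_simps)
      moreover have "y + (s + t) *\<^sub>R v + t *\<^sub>R (- v) = ?x" by (simp add: algebra_simps)
      moreover have "\<gamma> / 2 * (s + t)\<^sup>2 * V \<ge> \<gamma> / 2 * s\<^sup>2 * V + \<gamma> * s * V * t"
      proof -
        have "\<gamma> / 2 * (s + t)\<^sup>2 * V = \<gamma> / 2 * s\<^sup>2 * V + \<gamma> * s * V * t + \<gamma> / 2 * t\<^sup>2 * V"
          by (simp add: power2_sum field_simps)
        moreover have "\<gamma> / 2 * t\<^sup>2 * V \<ge> 0" using \<gamma> V by simp
        ultimately show ?thesis by linarith
      qed
      ultimately show "q s - e * t \<le> q (s + t)" unfolding q_def by (simp add: algebra_simps)
    qed
  qed simp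
  then show ?thesis by (simp add: q_def v_def V_def)
qed

text \<open>Average the two quadratic lower bounds at the midpoint; the linear terms cancel.\<close>
lemma hypomonotone_subdiff_midpoint:
  fixes f :: "'a::{real_inner, complete_space} \<Rightarrow> real"
  assumes S: "convex S" and lip: "\<And>x. x \<in> S \<Longrightarrow> \<exists>d>0. \<exists>L. L-lipschitz_on (ball x d) f"
    and hypo: "\<And>x1 x2 \<xi>1 \<xi>2. \<lbrakk>x1 \<in> S; x2 \<in> S; \<xi>1 \<in> clarke_subdiff f x1; \<xi>2 \<in> clarke_subdiff f x2\<rbrakk>
        \<Longrightarrow> (\<xi>1 - \<xi>2) \<bullet> (x1 - x2) \<ge> - \<gamma> * (norm (x1 - x2))\<^sup>2"
    and y: "y \<in> S" and z: "z \<in> S" and \<gamma>: "\<gamma> \<ge> 0"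
  shows "f (midpoint y z) \<le> (f y + f z) / 2 + \<gamma> / 8 * (dist y z)\<^sup>2"
proof -
  let ?m = "midpoint y z"
  have m: "?m \<in> S"
    using S y z convexD[of S y z "1/2" "1/2"] by (simp add: midpoint_def scaleR_add_right)
  then obtain \<xi> where \<xi>: "\<xi> \<in> clarke_subdiff f ?m" using clarke_subdiff_nonempty lip by blast
  have q: "f ?m + \<xi> \<bullet> (x - ?m) - \<gamma> / 2 * (norm (x - ?m))\<^sup>2 \<le> f x" if "x \<in> S" for x
    by (rule hypomonotone_subdiff_lower_quadratic[OF S lip hypo m that \<xi> \<gamma>])
  have "y - ?m = (1/2) *\<^sub>R (2 *\<^sub>R y - (y + z))" "z - ?m = (1/2) *\<^sub>R (2 *\<^sub>R z - (y + z))"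
    by (simp_all add: midpoint_def scaleR_diff_right)
  moreover have "2 *\<^sub>R y - (y + z) = y - z" "2 *\<^sub>R z - (y + z) = - (y - z)"
    by (simp_all add: scaleR_2)
  ultimately have ym: "y - ?m = (1/2) *\<^sub>R (y - z)" "z - ?m = (1/2) *\<^sub>R (- (y - z))" by simp_all
  define w where "w = y - z"
  have "f ?m + (\<xi> \<bullet> w) / 2 - \<gamma> / 2 * ((norm w)\<^sup>2 / 4) \<le> f y"
    "f ?m - (\<xi> \<bullet> w) / 2 - \<gamma> / 2 * ((norm w)\<^sup>2 / 4) \<le> f z"
    using q[OF y] q[OF z] unfolding ym w_def[symmetric] by (simp_all add: power_divide)
  then show ?thesis by (simp add: dist_norm w_def[symmetric] field_simps)
qed

section \<open>Sublevel sets with a common descent direction\<close>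

text \<open>The constraint functions at a fixed time; \<open>U\<close> is the enlargement of \<open>C\<close> on which they are
  hypomonotone, and \<open>r\<close> is a finite radius with room for balls around points of \<open>C\<close>.\<close>
locale hypomonotone_sublevel_system =
  fixes I :: "'i set" and f :: "'i \<Rightarrow> 'a::{real_inner, complete_space} \<Rightarrow> real"
    and U C :: "'a set" and r \<gamma> \<mu> :: real
  assumes I: "finite I" "I \<noteq> {}" and C_eq: "C = {x. \<forall>i\<in>I. f i x \<le> 0}"
    and pos: "r > 0" "\<gamma> > 0" "\<mu> > 0" and ball_U: "\<And>x. x \<in> C \<Longrightarrow> ball x r \<subseteq> U"
    and lip: "\<And>i x. i \<in> I \<Longrightarrow> x \<in> U \<Longrightarrow> \<exists>d>0. \<exists>L. L-lipschitz_on (ball x d) (f i)"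
    and hypo: "\<And>i x1 x2 \<xi>1 \<xi>2. \<lbrakk>i \<in> I; x1 \<in> U; x2 \<in> U; \<xi>1 \<in> clarke_subdiff (f i) x1; \<xi>2 \<in> clarke_subdiff (f i) x2\<rbrakk>
        \<Longrightarrow> (\<xi>1 - \<xi>2) \<bullet> (x1 - x2) \<ge> - \<gamma> * (norm (x1 - x2))\<^sup>2"
    and slope: "\<And>x. x \<in> C \<Longrightarrow> \<exists>v. norm v = 1 \<and> (\<forall>i\<in>I. \<forall>\<xi>\<in>clarke_subdiff (f i) x. \<xi> \<bullet> v \<le> - \<mu>)"
begin

lemma in_C_iff: "x \<in> C \<longleftrightarrow> (\<forall>i\<in>I. f i x \<le> 0)"
  by (simp add: C_eq)

lemma C_subset_U: "x \<in> C \<Longrightarrow> x \<in> U"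
  using ball_U[of x] pos by auto

lemma lower_quadratic:
  assumes "i \<in> I" "c \<in> C" "y \<in> ball c r" "z \<in> ball c r" "\<xi> \<in> clarke_subdiff (f i) y"
  shows "f i y + \<xi> \<bullet> (z - y) - \<gamma> / 2 * (norm (z - y))\<^sup>2 \<le> f i z"
  using assms ball_U[OF assms(2)] lip hypo pos
  by (intro hypomonotone_subdiff_lower_quadratic[of "ball c r"]) (auto simp: subset_eq)

lemma midpoint_bound:
  assumes "i \<in> I" "c \<in> C" "y \<in> ball c r" "z \<in> ball c r"
  shows "f i (midpoint y z) \<le> (f i y + f i z) / 2 + \<gamma> / 8 * (dist y z)\<^sup>2"
  using assms ball_U[OF assms(2)] lip hypo pos
  by (intro hypomonotone_subdiff_midpoint[of "ball c r"]) (auto simp: subset_eq)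

lemma isCont_constraint: "i \<in> I \<Longrightarrow> x \<in> U \<Longrightarrow> isCont (f i) x"
  using lip[of i x] lipschitz_on_continuous_on[of _ "ball x _" "f i"]
  by (auto simp: continuous_on_eq_continuous_at)

lemma closed_C: "closed C"
  unfolding closed_sequential_limits
proof (intro allI impI, elim conjE)
  fix X x assume X: "\<forall>n. X n \<in> C" "X \<longlonglongrightarrow> x"
  then obtain n where "dist (X n) x < r"
    using pos metric_LIMSEQ_D by blast
  then have "x \<in> U" using ball_U[of "X n"] X by auto
  have "f i x \<le> 0" if "i \<in> I" for i
  proof (rule LIMSEQ_le_const2)
    show "(\<lambda>n. f i (X n)) \<longlonglongrightarrow> f i x"
      using isCont_constraint[OF that \<open>x \<in> U\<close>] X(2) by (rule isCont_tendsto_compose)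
    show "\<exists>N. \<forall>n\<ge>N. f i (X n) \<le> 0" using X(1) that by (auto simp: in_C_iff)
  qed
  then show "x \<in> C" by (simp add: in_C_iff)
qed

text \<open>The minimiser \<open>y\<close> of \<open>max f + A |x - y|\<^sup>2\<close> on the ball of radius \<open>d\<close> lies in \<open>C\<close>, hence has a
  descent direction of slope \<open>\<mu>\<close>. The penalty grows at rate at most \<open>2 A |x - y|\<close>, so for
  \<open>2 A d = \<mu>\<close> the point \<open>y\<close> cannot lie in the interior of the ball, and on the sphere the penalty
  accounts for a decrease by \<open>A d\<^sup>2 = \<mu> d / 2\<close>. The bound \<open>d < \<mu> / \<gamma>\<close> is what makes
  the penalised function strongly convex.\<close>
lemma descent:
  assumes x: "x \<in> C" and d: "0 < d" "d < r" "d < \<mu> / \<gamma>"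
  shows "\<exists>y. dist x y \<le> d \<and> (\<forall>i\<in>I. f i y \<le> - \<mu> * d / 2)"
proof -
  define A where "A = \<mu> / (2 * d)"
  have A: "A > \<gamma> / 2" "2 * A * d = \<mu>" using d pos by (auto simp: A_def field_simps)
  have A0: "A > 0" using A pos by linarith
  define F where "F y = Max ((\<lambda>i. f i y) ` I)" for y
  have F_le: "F y \<le> c \<longleftrightarrow> (\<forall>i\<in>I. f i y \<le> c)" for y c using I by (simp add: F_def)
  have F_ge: "f i y \<le> F y" if "i \<in> I" for i y using I that by (simp add: F_def)
  define \<phi> where "\<phi> y = F y + A * (dist x y)\<^sup>2" for y
  have sub: "cball x d \<subseteq> ball x r" using d by (auto simp: cball_def)
  have "\<exists>y\<in>cball x d. \<forall>z\<in>cball x d. \<phi> y \<le> \<phi> z"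
  proof -
    obtain i where i: "i \<in> I" using I by blast
    obtain \<xi> where \<xi>: "\<xi> \<in> clarke_subdiff (f i) x"
      using clarke_subdiff_nonempty lip[OF i C_subset_U[OF x]] by blast
    show ?thesis
    proof (rule midpoint_convex_minimizer[where a = "A / 4 - \<gamma> / 8" and B = "f i x - norm \<xi> * d - \<gamma> / 2 * d\<^sup>2"])
      fix y assume y: "y \<in> cball x d"
      then have n: "norm (y - x) \<le> d" by (simp add: dist_norm norm_minus_commute)
      have "f i x + \<xi> \<bullet> (y - x) - \<gamma> / 2 * (norm (y - x))\<^sup>2 \<le> f i y"
        using lower_quadratic[OF i x _ _ \<xi>, of y] y sub pos by auto
      moreover have "- (norm \<xi> * d) \<le> \<xi> \<bullet> (y - x)"
      proof -
        have "\<bar>\<xi> \<bullet> (y - x)\<bar> \<le> norm \<xi> * norm (y - x)" by (rule Cauchy_Schwarz_ineq2)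
        also have "\<dots> \<le> norm \<xi> * d" using n by (intro mult_left_mono) auto
        finally show ?thesis by linarith
      qed
      moreover have "\<gamma> / 2 * (norm (y - x))\<^sup>2 \<le> \<gamma> / 2 * d\<^sup>2" using n pos by (intro mult_left_mono power_mono) auto
      moreover have "A * (dist x y)\<^sup>2 \<ge> 0" using A0 by simp
      ultimately show "f i x - norm \<xi> * d - \<gamma> / 2 * d\<^sup>2 \<le> \<phi> y" using F_ge[OF i, of y] unfolding \<phi>_def by linarith
    next
      fix y z assume yz: "y \<in> cball x d" "z \<in> cball x d"
      have m: "midpoint y z \<in> cball x d"
        using yz convexD[OF convex_cball, of y x d z "1/2" "1/2"] by (simp add: midpoint_def scaleR_add_right)
      have "f i (midpoint y z) \<le> (F y + F z) / 2 + \<gamma> / 8 * (dist y z)\<^sup>2" if "i \<in> I" for i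
        using midpoint_bound[OF that x subsetD[OF sub yz(1)] subsetD[OF sub yz(2)]]
          F_ge[OF that, of y] F_ge[OF that, of z] by argo
      then have "F (midpoint y z) \<le> (F y + F z) / 2 + \<gamma> / 8 * (dist y z)\<^sup>2" by (simp add: F_le)
      moreover have "(dist x (midpoint y z))\<^sup>2 = ((dist x y)\<^sup>2 + (dist x z)\<^sup>2) / 2 - (dist y z)\<^sup>2 / 4"
        by (simp add: dist_norm midpoint_def power2_norm_eq_inner algebra_simps inner_commute) (simp add: field_simps)
      then have "A * (dist x (midpoint y z))\<^sup>2 = A * (((dist x y)\<^sup>2 + (dist x z)\<^sup>2) / 2 - (dist y z)\<^sup>2 / 4)" by simp
      ultimately have "\<phi> (midpoint y z) \<le> (\<phi> y + \<phi> z) / 2 - (A / 4 - \<gamma> / 8) * (dist y z)\<^sup>2"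
        unfolding \<phi>_def by (simp add: field_simps)
      with m show "\<exists>m\<in>cball x d. \<phi> m \<le> (\<phi> y + \<phi> z) / 2 - (A / 4 - \<gamma> / 8) * (dist y z)\<^sup>2" by blast
    next
      fix c
      have eq: "{y \<in> cball x d. \<phi> y \<le> c} = (\<Inter>i\<in>I. {y \<in> cball x d. f i y + A * (dist x y)\<^sup>2 \<le> c})"
        using I F_le[of _ "c - A * (dist x _)\<^sup>2"] by (auto simp: \<phi>_def le_diff_eq)
      have "continuous_on (cball x d) (f i)" if "i \<in> I" for i
        using that sub ball_U[OF x] lip by (intro locally_lipschitz_continuous_on) (auto simp: subset_eq)
      then show "closed {y \<in> cball x d. \<phi> y \<le> c}" unfolding eq
        by (intro closed_INT ballI continuous_on_closed_Collect_le continuous_intros) auto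
    qed (use d A in auto)
  qed
  then obtain y where y: "dist x y \<le> d" and ymin: "\<And>z. dist x z \<le> d \<Longrightarrow> \<phi> y \<le> \<phi> z" by auto
  have "F x \<le> 0" using x by (simp add: F_le in_C_iff)
  then have "\<phi> x \<le> 0" by (simp add: \<phi>_def)
  then have Fy: "F y \<le> - A * (dist x y)\<^sup>2" using ymin[of x] d by (simp add: \<phi>_def)
  also have "\<dots> \<le> 0" using A0 by simp
  finally have yC: "y \<in> C" by (simp add: in_C_iff F_le)
  have "dist x y = d"
  proof (rule ccontr)
    assume "dist x y \<noteq> d"
    then have lt: "dist x y < d" using y by simp
    obtain v where v: "norm v = 1" "\<And>i \<xi>. i \<in> I \<Longrightarrow> \<xi> \<in> clarke_subdiff (f i) y \<Longrightarrow> \<xi> \<bullet> v \<le> - \<mu>"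
      using slope[OF yC] by blast
    \<comment> \<open>Half the gap between the descent rate of the constraints and the growth rate of the penalty.\<close>
    define k where "k = (\<mu> - 2 * A * dist x y) / 2"
    have "2 * A * dist x y < 2 * A * d" using lt A0 by simp
    then have k: "k > 0" using A by (simp add: k_def)
    have kA: "- \<mu> < - k - 2 * A * dist x y" using k by (simp add: k_def field_simps)
    have "\<forall>\<^sub>F t in at_right 0. f i (y + t *\<^sub>R v) - f i y \<le> (- k - 2 * A * dist x y) * t" if "i \<in> I" for i
      using lip[OF that C_subset_U[OF yC]] clarke_subdiff_directional_bound[OF _ _ v(2)[OF that] kA] by blast
    then have "\<forall>\<^sub>F t in at_right 0. \<forall>i\<in>I. f i (y + t *\<^sub>R v) - f i y \<le> (- k - 2 * A * dist x y) * t"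
      using I by (simp add: eventually_ball_finite)
    moreover have "\<forall>\<^sub>F t in at_right 0. t \<in> {0<..<min (d - dist x y) (k / A)}"
      using lt k A0 by (intro eventually_at_right_real) simp
    ultimately have "\<forall>\<^sub>F t in at_right (0::real). False"
    proof eventually_elim
      case (elim t)
      then have t: "0 < t" "t < d - dist x y" "t * A < k" using A0 by (auto simp: pos_less_divide_eq)
      have n: "norm (t *\<^sub>R v) = t" using t v by simp
      have "dist x (y + t *\<^sub>R v) \<le> dist x y + t"
        using dist_triangle[of x "y + t *\<^sub>R v" y] n by (simp add: dist_norm)
      with t have "dist x (y + t *\<^sub>R v) \<le> d" by simp
      then have "\<phi> y \<le> \<phi> (y + t *\<^sub>R v)" by (rule ymin)
      moreover have "(dist x (y + t *\<^sub>R v))\<^sup>2 \<le> (dist x y + t)\<^sup>2"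
        using \<open>dist x (y + t *\<^sub>R v) \<le> dist x y + t\<close> by (intro power_mono) auto
      then have "A * (dist x (y + t *\<^sub>R v))\<^sup>2 \<le> A * (dist x y + t)\<^sup>2" using A0 by simp
      moreover have "f i (y + t *\<^sub>R v) \<le> F y + (- k - 2 * A * dist x y) * t" if "i \<in> I" for i
        using elim(1) F_ge[OF that, of y] that by force
      then have "F (y + t *\<^sub>R v) \<le> F y + (- k - 2 * A * dist x y) * t" by (simp add: F_le)
      ultimately have "0 \<le> t * (t * A - k)" unfolding \<phi>_def by (simp add: power2_sum algebra_simps power2_eq_square)
      then show False using t by (simp add: zero_le_mult_iff)
    qed
    then show False by (simp add: trivial_limit_at_right_real)
  qed
  with Fy have "F y \<le> - A * d\<^sup>2" by simp
  also have "\<dots> = - \<mu> * d / 2" unfolding A(2)[symmetric] by (simp add: power2_eq_square)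
  finally have "F y \<le> - \<mu> * d / 2" .
  then show ?thesis using y by (auto simp: F_le)
qed

text \<open>Push both points to depth \<open>\<mu> d / 2\<close> inside \<open>C\<close>; the midpoint of the pushed points loses at
  most \<open>\<gamma> / 8\<close> times their squared distance, and \<open>d\<close> is chosen so that this loss is compensated.\<close>
lemma near_midpoint:
  assumes y: "y1 \<in> C" "y2 \<in> C" and D: "dist y1 y2 \<le> \<mu> / (2 * \<gamma>)" "2 * dist y1 y2 < r"
  shows "\<exists>m\<in>C. dist m (midpoint y1 y2) \<le> \<gamma> / \<mu> * (dist y1 y2)\<^sup>2"
proof (cases "y1 = y2")
  case True
  then show ?thesis using y by (intro bexI[of _ y1]) auto
next
  case False
  define D where "D = dist y1 y2"
  \<comment> \<open>The pushed points are at distance at most \<open>2 D\<close>, and \<open>\<gamma> / 8 * (2 D)\<^sup>2 = \<mu> d / 2\<close>.\<close>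
  define d where "d = \<gamma> / \<mu> * D\<^sup>2"
  have D0: "D > 0" using False by (simp add: D_def)
  have D1: "\<gamma> / \<mu> * D \<le> 1/2" using D pos by (simp add: D_def field_simps)
  have "\<gamma> / \<mu> * D * D \<le> 1/2 * D" using D1 D0 by (intro mult_right_mono) auto
  then have dD: "d \<le> D / 2" by (simp add: d_def power2_eq_square)
  have "D / 2 < \<mu> / \<gamma>"
  proof -
    have "D \<le> \<mu> / (2 * \<gamma>)" using D by (simp add: D_def)
    moreover have "\<mu> / (2 * \<gamma>) < 2 * (\<mu> / \<gamma>)" using pos by (simp add: field_simps)
    ultimately show ?thesis by simp
  qed
  moreover have "2 * D < r" using D by (simp add: D_def)
  moreover have "0 < d" using D0 pos by (simp add: d_def)
  ultimately have d: "0 < d" "d < r" "d < \<mu> / \<gamma>" using dD D0 by linarith+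
  obtain z1 where z1: "dist y1 z1 \<le> d" "\<And>i. i \<in> I \<Longrightarrow> f i z1 \<le> - \<mu> * d / 2" using descent[OF y(1) d] by blast
  obtain z2 where z2: "dist y2 z2 \<le> d" "\<And>i. i \<in> I \<Longrightarrow> f i z2 \<le> - \<mu> * d / 2" using descent[OF y(2) d] by blast
  have zb: "z1 \<in> ball y1 r" "z2 \<in> ball y1 r"
    using z1(1) z2(1) dD D D0 dist_triangle[of y1 z2 y2] by (auto simp: D_def[symmetric])
  have "dist z1 z2 \<le> dist z1 y1 + dist y1 y2 + dist y2 z2" by (smt (verit) dist_triangle)
  then have "dist z1 z2 \<le> 2 * D" using z1(1) z2(1) dD by (simp add: D_def[symmetric] dist_commute)
  then have "(dist z1 z2)\<^sup>2 \<le> (2 * D)\<^sup>2" by (intro power_mono) auto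
  then have "\<gamma> / 8 * (dist z1 z2)\<^sup>2 \<le> \<gamma> / 8 * (2 * D)\<^sup>2" using pos by (intro mult_left_mono) auto
  also have "\<dots> = \<mu> * d / 2" using pos by (simp add: d_def field_simps power2_eq_square)
  finally have quad: "\<gamma> / 8 * (dist z1 z2)\<^sup>2 \<le> \<mu> * d / 2" .
  have "f i (midpoint z1 z2) \<le> 0" if "i \<in> I" for i
  proof -
    have "f i (midpoint z1 z2) \<le> (f i z1 + f i z2) / 2 + \<gamma> / 8 * (dist z1 z2)\<^sup>2"
      by (rule midpoint_bound[OF that y(1) zb])
    with quad z1(2)[OF that] z2(2)[OF that] show ?thesis by (simp add: field_simps)
  qed
  then have "midpoint z1 z2 \<in> C" by (simp add: in_C_iff)
  moreover have "midpoint z1 z2 - midpoint y1 y2 = (1/2) *\<^sub>R ((z1 - y1) + (z2 - y2))"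
    by (simp add: midpoint_def algebra_simps)
  then have "dist (midpoint z1 z2) (midpoint y1 y2) \<le> (norm (z1 - y1) + norm (z2 - y2)) / 2"
    using norm_triangle_ineq[of "z1 - y1" "z2 - y2"] by (simp add: dist_norm)
  then have "dist (midpoint z1 z2) (midpoint y1 y2) \<le> d"
    using z1(1) z2(1) by (simp add: dist_norm norm_minus_commute)
  ultimately show ?thesis unfolding d_def D_def by blast
qed

text \<open>By \<open>near_midpoint\<close> the squared distance to \<open>z\<close> decreases from two points of \<open>C\<close>
  to a point of \<open>C\<close> near their midpoint by a fixed multiple of their squared distance, provided
  that \<open>z\<close> is so close to \<open>C\<close> that the error of the midpoint does not spoil the gain.\<close>
lemma projection_exists:
  assumes ne: "C \<noteq> {}" and \<eta>: "\<eta> \<le> r / 8" "\<eta> \<le> \<mu> / (32 * \<gamma>)" and z: "infdist z C < \<eta>"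
  shows "\<exists>p\<in>C. \<forall>y\<in>C. dist z p \<le> dist z y"
proof -
  define S where "S = {y \<in> C. dist z y \<le> \<eta>}"
  have \<eta>0: "\<eta> > 0" using z infdist_nonneg[of z C] by linarith
  have "\<gamma> / \<mu> * \<eta> \<le> 1 / 32" using \<eta>(2) pos by (simp add: field_simps)
  then have c\<eta>: "4 * (\<gamma> / \<mu> * \<eta>) \<le> 4 * (1 / 32)" by (rule mult_left_mono) simp
  have "\<exists>p\<in>S. \<forall>y\<in>S. (dist z p)\<^sup>2 \<le> (dist z y)\<^sup>2"
  proof (rule midpoint_convex_minimizer[where a = "1/8" and B = 0])
    have "\<exists>y\<in>C. dist z y < \<eta>"
      using z ne unfolding infdist_def by (simp add: cInf_less_iff)
    then show "S \<noteq> {}" unfolding S_def by (auto intro: less_imp_le)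
  next
    fix y1 y2 assume "y1 \<in> S" "y2 \<in> S"
    then have y: "y1 \<in> C" "y2 \<in> C" "dist z y1 \<le> \<eta>" "dist z y2 \<le> \<eta>" by (auto simp: S_def)
    define D where "D = dist y1 y2"
    have D: "D \<le> 2 * \<eta>" using dist_triangle3[of y1 y2 z] y by (simp add: D_def)
    have D0: "D \<ge> 0" by (simp add: D_def)
    have "2 * \<eta> \<le> \<mu> / (2 * \<gamma>)" 
    proof -
      have "2 * \<eta> \<le> 2 * (\<mu> / (32 * \<gamma>))" using \<eta> by simp
      also have "\<dots> \<le> \<mu> / (2 * \<gamma>)" using pos by (simp add: field_simps)
      finally show ?thesis .
    qed
    then obtain m where m: "m \<in> C" "dist m (midpoint y1 y2) \<le> \<gamma> / \<mu> * D\<^sup>2"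
      using near_midpoint[OF y(1,2)] D \<eta> \<eta>0 pos unfolding D_def by fastforce
    define e where "e = \<gamma> / \<mu> * D\<^sup>2"
    have e0: "e \<ge> 0" using pos by (simp add: e_def)
    have mid: "(dist z (midpoint y1 y2))\<^sup>2 = ((dist z y1)\<^sup>2 + (dist z y2)\<^sup>2) / 2 - D\<^sup>2 / 4"
      unfolding D_def
      by (simp add: dist_norm midpoint_def power2_norm_eq_inner algebra_simps inner_commute) (simp add: field_simps)
    have sq: "(dist z y1)\<^sup>2 \<le> \<eta>\<^sup>2" "(dist z y2)\<^sup>2 \<le> \<eta>\<^sup>2" using y by (auto intro: power_mono)
    have "(dist z (midpoint y1 y2))\<^sup>2 \<le> \<eta>\<^sup>2" using mid sq zero_le_power2[of D] by argo
    then have zm: "dist z (midpoint y1 y2) \<le> \<eta>" using \<eta>0 by (simp add: power2_le_iff_abs_le)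
    have "dist z m \<le> dist z (midpoint y1 y2) + e"
      using dist_triangle[of z m "midpoint y1 y2"] m by (simp add: dist_commute e_def)
    then have "(dist z m)\<^sup>2 \<le> (dist z (midpoint y1 y2) + e)\<^sup>2" by (intro power_mono) auto
    also have "\<dots> \<le> (dist z (midpoint y1 y2))\<^sup>2 + (2 * \<eta> + e) * e"
      using mult_right_mono[OF zm e0] by (simp add: power2_sum power2_eq_square algebra_simps)
    also have "(2 * \<eta> + e) * e \<le> D\<^sup>2 / 8"
    proof -
      have "e \<le> \<gamma> / \<mu> * (2 * \<eta>)\<^sup>2" unfolding e_def using D D0 pos by (intro mult_left_mono power_mono) auto
      also have "\<dots> = 4 * (\<gamma> / \<mu> * \<eta>) * \<eta>" by (simp add: power2_eq_square)
      also have "\<dots> \<le> 4 * (1/32) * \<eta>" using c\<eta> by (rule mult_right_mono) (use \<eta>0 in simp)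
      finally have "(2 * \<eta> + e) * e \<le> (4 * \<eta>) * e" using e0 \<eta>0 by (intro mult_right_mono) auto
      also have "\<dots> = 4 * (\<gamma> / \<mu> * \<eta>) * D\<^sup>2" by (simp add: e_def)
      also have "\<dots> \<le> 4 * (1/32) * D\<^sup>2" using c\<eta> by (rule mult_right_mono) simp
      finally show ?thesis by simp
    qed
    finally have "(dist z m)\<^sup>2 \<le> ((dist z y1)\<^sup>2 + (dist z y2)\<^sup>2) / 2 - 1/8 * (dist y1 y2)\<^sup>2"
      using mid by (simp add: D_def)
    moreover from this have "(dist z m)\<^sup>2 \<le> \<eta>\<^sup>2" using sq zero_le_power2[of "dist y1 y2"] by argo
    then have "m \<in> S" using m \<eta>0 by (simp add: S_def power2_le_iff_abs_le)
    ultimately show "\<exists>m\<in>S. (dist z m)\<^sup>2 \<le> ((dist z y1)\<^sup>2 + (dist z y2)\<^sup>2) / 2 - 1/8 * (dist y1 y2)\<^sup>2" by blast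
  next
    fix c
    have "{y \<in> S. (dist z y)\<^sup>2 \<le> c} = C \<inter> ({y. dist z y \<le> \<eta>} \<inter> {y. (dist z y)\<^sup>2 \<le> c})" by (auto simp: S_def)
    also have "closed \<dots>" using closed_C by (intro closed_Int closed_Collect_le continuous_intros)
    finally show "closed {y \<in> S. (dist z y)\<^sup>2 \<le> c}" .
  qed auto
  then obtain p where p: "p \<in> S" "\<And>y. y \<in> S \<Longrightarrow> dist z p \<le> dist z y" by (auto simp: power2_le_iff_abs_le)
  then have "dist z p \<le> dist z y" if "y \<in> C" for y
    using that by (cases "dist z y \<le> \<eta>") (auto simp: S_def)
  with p(1) show ?thesis by (auto simp: S_def)
qed

text \<open>For \<open>w = y - p\<close> the direction \<open>w + h v\<close>, with \<open>v\<close> the descent direction at \<open>p\<close>, points into \<open>C\<close>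
  as soon as \<open>h\<close> exceeds \<open>\<gamma> |w|\<^sup>2 / (2 \<mu>)\<close>. Since \<open>p\<close> is nearest to \<open>z\<close>, such directions make
  a non-acute angle with \<open>z - p\<close>. The term \<open>1 / r\<close> covers points \<open>y\<close> at distance at least \<open>r\<close>.\<close>
lemma proximal_normal_inequality:
  assumes p: "p \<in> C" and near: "\<And>y. y \<in> C \<Longrightarrow> dist z p \<le> dist z y" and y: "y \<in> C"
  shows "(z - p) \<bullet> (y - p) \<le> (\<gamma> / \<mu> + 1 / r) * norm (z - p) * (dist y p)\<^sup>2"
proof (cases "dist y p < r")
  case False
  have "(z - p) \<bullet> (y - p) \<le> norm (z - p) * dist y p" by (simp add: dist_norm norm_cauchy_schwarz)
  also have "\<dots> \<le> norm (z - p) * (1 / r * (dist y p)\<^sup>2)"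
  proof (rule mult_left_mono)
    have "r * dist y p \<le> dist y p * dist y p" using False by (intro mult_right_mono) auto
    then show "dist y p \<le> 1 / r * (dist y p)\<^sup>2" using pos by (simp add: power2_eq_square field_simps)
  qed simp
  also have "\<dots> \<le> (\<gamma> / \<mu> + 1 / r) * norm (z - p) * (dist y p)\<^sup>2" using pos by (simp add: algebra_simps)
  finally show ?thesis .
next
  case True
  show ?thesis
  proof (cases "y = p")
    case False
    define w where "w = y - p"
    have w: "norm w > 0" "dist y p = norm w" using False by (auto simp: w_def dist_norm)
    obtain v where v: "norm v = 1" "\<And>i \<xi>. i \<in> I \<Longrightarrow> \<xi> \<in> clarke_subdiff (f i) p \<Longrightarrow> \<xi> \<bullet> v \<le> - \<mu>"
      using slope[OF p] by blast
    define h where "h = \<gamma> / \<mu> * (norm w)\<^sup>2"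
    define d where "d = w + h *\<^sub>R v"
    have h: "h > 0" "h * \<mu> = \<gamma> * (norm w)\<^sup>2" using w pos by (auto simp: h_def)
    have "\<forall>\<^sub>F t in at_right 0. f i (p + t *\<^sub>R d) \<le> 0" if i: "i \<in> I" for i
    proof (cases "f i p < 0")
      case True
      have "((\<lambda>t. f i (p + t *\<^sub>R d)) \<longlongrightarrow> f i p) (at_right 0)"
      proof (rule isCont_tendsto_compose[OF isCont_constraint[OF i C_subset_U[OF p]]])
        have "((\<lambda>t. p + t *\<^sub>R d) \<longlongrightarrow> p + 0 *\<^sub>R d) (at_right 0)" by (intro tendsto_intros)
        then show "((\<lambda>t. p + t *\<^sub>R d) \<longlongrightarrow> p) (at_right 0)" by simp
      qed
      then have "\<forall>\<^sub>F t in at_right 0. f i (p + t *\<^sub>R d) < 0" using True by (rule order_tendstoD(2))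
      then show ?thesis by (rule eventually_mono) simp
    next
      case False
      then have fp: "f i p = 0" using p i by (simp add: in_C_iff antisym)
      have "\<xi> \<bullet> d \<le> - (\<gamma> / 2 * (norm w)\<^sup>2)" if \<xi>: "\<xi> \<in> clarke_subdiff (f i) p" for \<xi>
      proof -
        have "f i p + \<xi> \<bullet> (y - p) - \<gamma> / 2 * (norm (y - p))\<^sup>2 \<le> f i y"
          using lower_quadratic[OF i p _ _ \<xi>, of y] \<open>dist y p < r\<close> pos by (simp add: dist_commute)
        moreover have "f i y \<le> 0" using y i by (simp add: in_C_iff)
        moreover have "h * (\<xi> \<bullet> v) \<le> h * (- \<mu>)" using v(2)[OF i \<xi>] h by (intro mult_left_mono) auto
        ultimately show ?thesis using h fp by (simp add: d_def w_def inner_add_right)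
      qed
      moreover have "- (\<gamma> / 2 * (norm w)\<^sup>2) < 0" using w pos by simp
      ultimately have "\<forall>\<^sub>F t in at_right 0. f i (p + t *\<^sub>R d) - f i p \<le> 0 * t"
        using lip[OF i C_subset_U[OF p]] clarke_subdiff_directional_bound by blast
      then show ?thesis using fp by simp
    qed
    then have "\<forall>\<^sub>F t in at_right 0. \<forall>i\<in>I. f i (p + t *\<^sub>R d) \<le> 0" using I by (simp add: eventually_ball_finite)
    moreover have "\<forall>\<^sub>F t in at_right (0::real). t > 0" by (simp add: eventually_at_right_less)
    ultimately have "\<forall>\<^sub>F t in at_right 0. (z - p) \<bullet> d \<le> t * (norm d)\<^sup>2 / 2"
    proof eventually_elim
      case (elim t)
      then have "p + t *\<^sub>R d \<in> C" by (simp add: in_C_iff)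
      then have "(dist z p)\<^sup>2 \<le> (dist z (p + t *\<^sub>R d))\<^sup>2" using near by (intro power_mono) auto
      also have "\<dots> = (dist z p)\<^sup>2 - 2 * t * ((z - p) \<bullet> d) + t\<^sup>2 * (norm d)\<^sup>2"
        by (simp add: dist_norm power2_norm_eq_inner algebra_simps inner_commute) (simp add: power2_eq_square)
      finally have "t * (2 * ((z - p) \<bullet> d)) \<le> t * (t * (norm d)\<^sup>2)" by (simp add: power2_eq_square algebra_simps)
      then show ?case using elim by simp
    qed
    moreover have "((\<lambda>t. t * (norm d)\<^sup>2 / 2) \<longlongrightarrow> 0 * (norm d)\<^sup>2 / 2) (at_right 0)" by (intro tendsto_intros) auto
    ultimately have "(z - p) \<bullet> d \<le> 0"
      using tendsto_lowerbound[of "\<lambda>t. t * (norm d)\<^sup>2 / 2" 0 "at_right (0::real)"] by simp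
    then have "(z - p) \<bullet> w \<le> h * (- ((z - p) \<bullet> v))" by (simp add: d_def inner_add_right)
    also have "\<dots> \<le> h * norm (z - p)"
      using Cauchy_Schwarz_ineq2[of "z - p" v] v h by (intro mult_left_mono) auto
    also have "\<dots> \<le> (\<gamma> / \<mu> + 1 / r) * norm (z - p) * (norm w)\<^sup>2" using pos by (simp add: h_def algebra_simps)
    finally show ?thesis using w by (simp add: w_def)
  qed simp
qed

end

section \<open>Weak primitives, Lebesgue points and compactness\<close>

text \<open>If \<open>J\<close> were outside \<open>Q\<close>, the direction from its nearest point in \<open>Q\<close> to \<open>J\<close> would separate.\<close>
lemma closed_convex_membership:
  fixes J :: "'a::real_inner"
  assumes Q: "convex Q" "compact Q" "Q \<noteq> {}"
    and sup: "\<And>\<zeta> c. (\<And>y. y \<in> Q \<Longrightarrow> y \<bullet> \<zeta> \<le> c) \<Longrightarrow> J \<bullet> \<zeta> \<le> c"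
  shows "J \<in> Q"
proof -
  have "continuous_on Q (\<lambda>y. dist J y)" by (intro continuous_intros)
  from continuous_attains_inf[OF Q(2,3) this]
  obtain p where p: "p \<in> Q" "\<And>y. y \<in> Q \<Longrightarrow> dist J p \<le> dist J y" by blast
  have "y \<bullet> (J - p) \<le> p \<bullet> (J - p)" if "y \<in> Q" for y
    using any_closest_point_dot[OF Q(1) compact_imp_closed[OF Q(2)] p(1) that, of J] p(2)
    by (simp add: inner_diff_right inner_diff_left inner_commute)
  from sup[OF this] have "(J - p) \<bullet> (J - p) \<le> 0" by (simp add: inner_diff_left)
  then have "J = p" by (metis eq_iff_diff_eq_0 inner_eq_zero_iff inner_ge_zero order_antisym)
  with p(1) show ?thesis by simp
qed

text \<open>The convex hull of \<open>K\<close> lies in a small neighbourhood of the convex hull of a finite net of \<open>K\<close>,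
  and the latter is compact.\<close>
lemma compact_closure_convex_hull:
  fixes K :: "'a::{real_normed_vector, complete_space} set"
  assumes "compact K"
  shows "compact (closure (convex hull K))"
  unfolding compact_eq_totally_bounded
proof (intro conjI allI impI)
  show "complete (closure (convex hull K))" by (simp add: complete_eq_closed)
next
  fix e :: real assume e: "e > 0"
  obtain F where F: "finite F" "K \<subseteq> (\<Union>x\<in>F. ball x (e/3))"
    using assms e unfolding compact_eq_totally_bounded by (metis divide_pos_pos zero_less_numeral)
  have "compact (convex hull F)" using F(1) by (rule finite_imp_compact_convex_hull)
  then obtain k where k: "finite k" "convex hull F \<subseteq> (\<Union>x\<in>k. ball x (e/3))"
    using e unfolding compact_eq_totally_bounded by (metis divide_pos_pos zero_less_numeral)
  define W where "W = (\<Union>x\<in>convex hull F. \<Union>y\<in>ball 0 (e/3). {x + y})"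
  have "convex W" unfolding W_def by (intro convex_sums convex_convex_hull convex_ball)
  moreover have "K \<subseteq> W"
  proof
    fix z assume "z \<in> K"
    then obtain x where "x \<in> F" "dist x z < e/3" using F by auto
    then show "z \<in> W" unfolding W_def
      by (intro UN_I[of x] UN_I[of "z - x"]) (auto simp: hull_inc dist_norm norm_minus_commute)
  qed
  ultimately have KW: "convex hull K \<subseteq> W" by (simp add: hull_minimal)
  have "closure (convex hull K) \<subseteq> (\<Union>x\<in>k. ball x e)"
  proof
    fix z assume "z \<in> closure (convex hull K)"
    then obtain y where "y \<in> convex hull K" "dist y z < e/3"
      using e by (metis closure_approachable divide_pos_pos zero_less_numeral)
    moreover from this KW obtain x u where "x \<in> convex hull F" "norm u < e/3" "y = x + u"
      unfolding W_def by auto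
    moreover from this k obtain c where "c \<in> k" "dist c x < e/3" by auto
    moreover have "dist c z \<le> dist c x + dist x y + dist y z" by (smt (verit) dist_triangle)
    ultimately have "dist c z < e" by (simp add: dist_norm)
    with \<open>c \<in> k\<close> show "z \<in> (\<Union>x\<in>k. ball x e)" by auto
  qed
  with k(1) show "\<exists>k. finite k \<and> closure (convex hull K) \<subseteq> (\<Union>x\<in>k. ball x e)" by blast
qed

text \<open>The Riesz representation: a functional below a linear one coincides with it.\<close>
lemma bounded_functional_representation:
  fixes l :: "'a::{real_inner, complete_space} \<Rightarrow> real"
  assumes lin: "\<And>v w. l (v + w) = l v + l w" "\<And>c v. l (c *\<^sub>R v) = c * l v"
    and bd: "\<And>v. l v \<le> L * norm v" and L: "L \<ge> 0"
  shows "\<exists>J. \<forall>v. J \<bullet> v = l v"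
proof -
  obtain J where J: "\<And>w. J \<bullet> w \<le> l w"
    using sublinear_support_functional[of l L 1 0] lin bd L by auto
  have "J \<bullet> v = l v" for v
    using J[of v] J[of "- v"] lin(2)[of "-1" v] by simp
  then show ?thesis by blast
qed

text \<open>A substitute for the vector-valued Lebesgue integral that makes sense in spaces that are not
  second countable: \<open>G b - G a\<close> is the Pettis integral of \<open>q\<close> over \<open>{a..b}\<close>.\<close>
definition weak_primitive :: "real \<Rightarrow> (real \<Rightarrow> 'a::real_inner) \<Rightarrow> (real \<Rightarrow> 'a) \<Rightarrow> bool" where
  "weak_primitive T q G \<longleftrightarrow> (\<forall>\<zeta> a b. 0 \<le> a \<longrightarrow> a \<le> b \<longrightarrow> b \<le> T \<longrightarrow>
     ((\<lambda>s. q s \<bullet> \<zeta>) has_integral (G b - G a) \<bullet> \<zeta>) {a..b})"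

lemma weak_primitiveD:
  "weak_primitive T q G \<Longrightarrow> 0 \<le> a \<Longrightarrow> a \<le> b \<Longrightarrow> b \<le> T \<Longrightarrow>
     ((\<lambda>s. q s \<bullet> \<zeta>) has_integral (G b - G a) \<bullet> \<zeta>) {a..b}"
  by (simp add: weak_primitive_def)

lemma weak_primitive_exists:
  fixes q :: "real \<Rightarrow> 'a::{real_inner, complete_space}"
  assumes int: "\<And>\<zeta>. (\<lambda>s. q s \<bullet> \<zeta>) integrable_on {0..T}"
    and w: "w integrable_on {0..T}" "\<And>s. s \<in> {0..T} \<Longrightarrow> norm (q s) \<le> w s"
  shows "\<exists>G. G 0 = 0 \<and> weak_primitive T q G"
proof -
  have w0: "w s \<ge> 0" if "s \<in> {0..T}" for s using w(2)[OF that] norm_ge_zero order_trans by blast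
  have "\<exists>J. \<forall>\<zeta>. J \<bullet> \<zeta> = integral {0..b} (\<lambda>s. q s \<bullet> \<zeta>)" if b: "b \<in> {0..T}" for b
  proof (rule bounded_functional_representation[where L = "integral {0..b} w"])
    have i: "(\<lambda>s. q s \<bullet> \<zeta>) integrable_on {0..b}" for \<zeta>
      using int by (rule integrable_on_subinterval) (use b in auto)
    have iw: "w integrable_on {0..b}" using w(1) by (rule integrable_on_subinterval) (use b in auto)
    show "integral {0..b} (\<lambda>s. q s \<bullet> (v + v')) = integral {0..b} (\<lambda>s. q s \<bullet> v) + integral {0..b} (\<lambda>s. q s \<bullet> v')" for v v'
      using integral_add[OF i i] by (simp add: inner_add_right)
    show "integral {0..b} (\<lambda>s. q s \<bullet> (c *\<^sub>R v)) = c * integral {0..b} (\<lambda>s. q s \<bullet> v)" for c v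
      by simp
    show "integral {0..b} (\<lambda>s. q s \<bullet> v) \<le> integral {0..b} w * norm v" for v
    proof -
      have "integral {0..b} (\<lambda>s. q s \<bullet> v) \<le> integral {0..b} (\<lambda>s. w s * norm v)"
      proof (rule integral_le[OF i])
        show "(\<lambda>s. w s * norm v) integrable_on {0..b}" using iw by (rule integrable_on_mult_left)
        fix s assume s: "s \<in> {0..b}"
        have "q s \<bullet> v \<le> norm (q s) * norm v" by (rule norm_cauchy_schwarz)
        also have "\<dots> \<le> w s * norm v" using w(2)[of s] s b by (intro mult_right_mono) auto
        finally show "q s \<bullet> v \<le> w s * norm v" .
      qed
      then show ?thesis by simp
    qed
    show "integral {0..b} w \<ge> 0" using w0 b by (intro integral_nonneg[OF iw]) auto
  qed
  then obtain G where G: "\<And>b \<zeta>. b \<in> {0..T} \<Longrightarrow> G b \<bullet> \<zeta> = integral {0..b} (\<lambda>s. q s \<bullet> \<zeta>)" by metis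
  have "weak_primitive T q (\<lambda>b. if b = 0 then 0 else G b)"
    unfolding weak_primitive_def
  proof (intro allI impI)
    fix \<zeta> a b assume ab: "0 \<le> a" "a \<le> b" "b \<le> (T::real)"
    have G': "(if c = 0 then 0 else G c) \<bullet> \<zeta> = integral {0..c} (\<lambda>s. q s \<bullet> \<zeta>)" if "c \<in> {0..T}" for c
      using G[OF that] by simp
    have i: "(\<lambda>s. q s \<bullet> \<zeta>) integrable_on {0..b}"
      using int by (rule integrable_on_subinterval) (use ab in auto)
    have "(\<lambda>s. q s \<bullet> \<zeta>) integrable_on {a..b}"
      using int by (rule integrable_on_subinterval) (use ab in auto)
    moreover have "integral {a..b} (\<lambda>s. q s \<bullet> \<zeta>) = integral {0..b} (\<lambda>s. q s \<bullet> \<zeta>) - integral {0..a} (\<lambda>s. q s \<bullet> \<zeta>)"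
      using Henstock_Kurzweil_Integration.integral_combine[OF ab(1,2) i] by simp
    ultimately show "((\<lambda>s. q s \<bullet> \<zeta>) has_integral ((if b = 0 then 0 else G b) - (if a = 0 then 0 else G a)) \<bullet> \<zeta>) {a..b}"
      using G'[of a] G'[of b] ab by (simp add: inner_diff_left has_integral_integral)
  qed
  then show ?thesis by (intro exI[of _ "\<lambda>b. if b = 0 then 0 else G b"]) simp
qed

text \<open>Test the weak primitive with the vector whose norm is to be estimated.\<close>
lemma weak_primitive_increment_bound:
  assumes G: "weak_primitive T q G" and ab: "0 \<le> a" "a \<le> b" "b \<le> T"
    and n: "n integrable_on {a..b}" "\<And>s. s \<in> {a..b} \<Longrightarrow> norm (q s - p) \<le> n s"
  shows "norm (G b - G a - (b - a) *\<^sub>R p) \<le> integral {a..b} n"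
proof -
  define z where "z = G b - G a - (b - a) *\<^sub>R p"
  have "((\<lambda>s. q s \<bullet> z - p \<bullet> z) has_integral ((G b - G a) \<bullet> z - (b - a) *\<^sub>R (p \<bullet> z))) {a..b}"
    using has_integral_diff[OF weak_primitiveD[OF G ab, of z] has_integral_const_real[of "p \<bullet> z" a b]] ab
    by (simp add: content_real_if)
  then have hi: "((\<lambda>s. (q s - p) \<bullet> z) has_integral z \<bullet> z) {a..b}"
    by (simp add: z_def inner_diff_left)
  have "((\<lambda>s. n s * norm z) has_integral (integral {a..b} n * norm z)) {a..b}"
    using integrable_integral[OF n(1)] by (rule has_integral_mult_left)
  with hi have "z \<bullet> z \<le> integral {a..b} n * norm z"
  proof (rule has_integral_le)
    fix s assume "s \<in> {a..b}"
    then have "norm (q s - p) * norm z \<le> n s * norm z" using n(2) by (intro mult_right_mono) auto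
    then show "(q s - p) \<bullet> z \<le> n s * norm z" using norm_cauchy_schwarz[of "q s - p" z] by linarith
  qed
  then have "norm z * norm z \<le> integral {a..b} n * norm z" by (simp add: power2_norm_eq_inner[symmetric] power2_eq_square)
  moreover have "integral {a..b} n \<ge> 0"
    using n by (intro integral_nonneg) (auto intro: order_trans[OF norm_ge_zero])
  ultimately show ?thesis unfolding z_def[symmetric] by (cases "norm z = 0") auto
qed

text \<open>Differentiation of the indefinite integral from the right gives the increments with \<open>s < y\<close>; the
  same theorem for the reflected function gives those with \<open>y < s\<close>.\<close>
lemma lebesgue_points:
  fixes \<phi> :: "real \<Rightarrow> real"
  assumes \<phi>: "\<phi> integrable_on {0..T}"
  shows "\<exists>N. negligible N \<and> (\<forall>s\<in>{0..T} - N. \<forall>e>0. \<exists>d>0. \<forall>y\<in>{0..T}. \<bar>y - s\<bar> < d \<longrightarrow>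
     \<bar>integral {min s y..max s y} \<phi> - \<bar>y - s\<bar> * \<phi> s\<bar> \<le> e * \<bar>y - s\<bar>)"
proof -
  define \<phi>0 where "\<phi>0 s = (if s \<in> {0..T} then \<phi> s else 0)" for s
  have U: "\<phi>0 integrable_on UNIV" unfolding \<phi>0_def using \<phi> by (simp only: integrable_restrict_UNIV)
  have i1: "\<phi>0 integrable_on cbox a b" for a b using U by (rule integrable_on_subcbox) simp
  have i2: "(\<lambda>s. \<phi>0 (- s)) integrable_on cbox a b" for a b :: real
    using i1[of "- b" "- a"] Henstock_Kurzweil_Integration.integrable_reflect_real[of \<phi>0 "- a" "- b"]
    by simp
  obtain N1 where N1: "negligible N1" "\<And>x e. x \<notin> N1 \<Longrightarrow> 0 < e \<Longrightarrow>
      \<exists>d>0. \<forall>h. 0 < h \<and> h < d \<longrightarrow> norm (integral (cbox x (x + h *\<^sub>R One)) \<phi>0 /\<^sub>R h ^ DIM(real) - \<phi>0 x) < e"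
    using integrable_ccontinuous_explicit[OF i1] by blast
  obtain N2 where N2: "negligible N2" "\<And>x e. x \<notin> N2 \<Longrightarrow> 0 < e \<Longrightarrow>
      \<exists>d>0. \<forall>h. 0 < h \<and> h < d \<longrightarrow> norm (integral (cbox x (x + h *\<^sub>R One)) (\<lambda>s. \<phi>0 (- s)) /\<^sub>R h ^ DIM(real) - \<phi>0 (- x)) < e"
    using integrable_ccontinuous_explicit[OF i2] by blast
  have conv: "\<bar>I - h * v\<bar> \<le> e * h" if "norm (I /\<^sub>R h ^ DIM(real) - v) < e" "h > 0" for I h v e :: real
  proof -
    have "\<bar>I - h * v\<bar> = h * \<bar>I / h - v\<bar>" using that(2) by (simp add: abs_mult[symmetric] field_simps)
    also have "\<dots> \<le> h * e" using that by (intro mult_left_mono) (auto simp: divide_inverse mult.commute)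
    finally show ?thesis by (simp add: mult.commute)
  qed
  have "negligible (uminus ` N2)"
  proof (rule negligible_locally_Lipschitz_image[OF _ N2(1)])
    show "\<exists>A B. open A \<and> x \<in> A \<and> (\<forall>y\<in>N2 \<inter> A. norm (- y - - x) \<le> B * norm (y - x))" for x
      by (rule exI[of _ UNIV], rule exI[of _ 1]) auto
  qed simp
  then have "negligible (N1 \<union> uminus ` N2)" using N1(1) by (rule negligible_Un[rotated])
  moreover have "\<exists>d>0. \<forall>y\<in>{0..T}. \<bar>y - s\<bar> < d \<longrightarrow>
     \<bar>integral {min s y..max s y} \<phi> - \<bar>y - s\<bar> * \<phi> s\<bar> \<le> e * \<bar>y - s\<bar>"
    if s: "s \<in> {0..T} - (N1 \<union> uminus ` N2)" and e: "e > 0" for s e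
  proof -
    have s1: "s \<notin> N1" "- s \<notin> N2" using s by (auto simp: image_iff)
    obtain d1 where d1: "d1 > 0" "\<And>h. 0 < h \<Longrightarrow> h < d1 \<Longrightarrow> norm (integral {s..s + h} \<phi>0 /\<^sub>R h ^ DIM(real) - \<phi>0 s) < e"
      using N1(2)[OF s1(1) e] by auto
    obtain d2 where d2: "d2 > 0" "\<And>h. 0 < h \<Longrightarrow> h < d2 \<Longrightarrow> norm (integral {- s..- s + h} (\<lambda>s. \<phi>0 (- s)) /\<^sub>R h ^ DIM(real) - \<phi>0 s) < e"
      using N2(2)[OF s1(2) e] by auto
    have "\<bar>integral {min s y..max s y} \<phi> - \<bar>y - s\<bar> * \<phi> s\<bar> \<le> e * \<bar>y - s\<bar>"
      if y: "y \<in> {0..T}" "\<bar>y - s\<bar> < min d1 d2" for y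
    proof -
      have \<phi>0: "integral {min s y..max s y} \<phi> = integral {min s y..max s y} \<phi>0" "\<phi>0 s = \<phi> s"
        using s y by (auto simp: \<phi>0_def intro!: integral_cong)
      have y': "\<bar>y - s\<bar> < d1" "\<bar>y - s\<bar> < d2" using y by simp_all
      consider "y = s" | "s < y" | "y < s" by linarith
      then show ?thesis
      proof cases
        case 1 then show ?thesis by simp
      next
        case 2
        then show ?thesis using conv[OF d1(2)[of "y - s"]] y' \<phi>0 by (simp add: min_def max_def)
      next
        case 3
        have "integral {- s..- s + (s - y)} (\<lambda>s. \<phi>0 (- s)) = integral {y..s} \<phi>0"
          using Henstock_Kurzweil_Integration.integral_reflect_real[of s y \<phi>0] by simp
        then show ?thesis using conv[OF d2(2)[of "s - y"]] 3 y' \<phi>0 by (simp add: min_def max_def)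
      qed
    qed
    then show ?thesis using d1(1) d2(1) by (intro exI[of _ "min d1 d2"]) auto
  qed
  ultimately show ?thesis by blast
qed

text \<open>At a common Lebesgue point of the countably many scalar functions \<open>|q - p|\<close> with \<open>p\<close> in \<open>D\<close>,
  choose \<open>p\<close> close to \<open>q s\<close>; then \<open>p\<close> is nearly the difference quotient of \<open>G\<close>.\<close>
lemma weak_primitive_differentiable_ae:
  fixes q :: "real \<Rightarrow> 'a::real_inner"
  assumes G: "weak_primitive T q G" and D: "countable D" "\<And>s. s \<in> {0..T} \<Longrightarrow> q s \<in> closure D"
    and int: "\<And>p. p \<in> D \<Longrightarrow> (\<lambda>s. norm (q s - p)) integrable_on {0..T}"
  shows "\<exists>N. negligible N \<and> (\<forall>s\<in>{0..T} - N. (G has_vector_derivative q s) (at s within {0..T}))"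
proof -
  obtain N where N: "\<And>p. p \<in> D \<Longrightarrow> negligible (N p)"
    "\<And>p s e. p \<in> D \<Longrightarrow> s \<in> {0..T} - N p \<Longrightarrow> e > 0 \<Longrightarrow> \<exists>d>0. \<forall>y\<in>{0..T}. \<bar>y - s\<bar> < d \<longrightarrow>
     \<bar>integral {min s y..max s y} (\<lambda>s. norm (q s - p)) - \<bar>y - s\<bar> * norm (q s - p)\<bar> \<le> e * \<bar>y - s\<bar>"
    using lebesgue_points[OF int] by metis
  have "negligible (\<Union>(N ` D))" using N(1) D(1) by (intro negligible_countable_Union) auto
  moreover have "(G has_vector_derivative q s) (at s within {0..T})" if s: "s \<in> {0..T} - \<Union>(N ` D)" for s
    unfolding has_vector_derivative_def has_derivative_within_alt
  proof (intro conjI allI impI)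
    show "bounded_linear (\<lambda>x. x *\<^sub>R q s)" by (rule bounded_linear_scaleR_left)
    fix e :: real assume e: "e > 0"
    obtain p where p: "p \<in> D" "dist p (q s) < e / 3"
      using D(2)[of s] s e by (metis DiffD1 closure_approachable divide_pos_pos zero_less_numeral)
    have sp: "s \<in> {0..T} - N p" and e3: "e / 3 > 0" using s p(1) e by auto
    obtain d where d: "d > 0" "\<And>y. y \<in> {0..T} \<Longrightarrow> \<bar>y - s\<bar> < d \<Longrightarrow>
       \<bar>integral {min s y..max s y} (\<lambda>s. norm (q s - p)) - \<bar>y - s\<bar> * norm (q s - p)\<bar> \<le> e / 3 * \<bar>y - s\<bar>"
      using N(2)[OF p(1) sp e3] by blast
    have "norm (G y - G s - (y - s) *\<^sub>R q s) \<le> e * norm (y - s)"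
      if y: "y \<in> {0..T}" "norm (y - s) < d" for y
    proof -
      let ?a = "min s y" and ?b = "max s y"
      have ab: "0 \<le> ?a" "?a \<le> ?b" "?b \<le> T" using s y by auto
      have "norm (G ?b - G ?a - (?b - ?a) *\<^sub>R p) \<le> integral {?a..?b} (\<lambda>s. norm (q s - p))"
        by (rule weak_primitive_increment_bound[OF G ab])
           (rule integrable_on_subinterval[OF int[OF p(1)]], use ab in auto)
      also have "\<dots> \<le> \<bar>y - s\<bar> * norm (q s - p) + e / 3 * \<bar>y - s\<bar>"
        using d(2)[OF y(1)] y(2) unfolding real_norm_def by linarith
      also have "norm (G ?b - G ?a - (?b - ?a) *\<^sub>R p) = norm (G y - G s - (y - s) *\<^sub>R p)"
      proof (cases "s \<le> y")
        case False
        then have "G ?b - G ?a - (?b - ?a) *\<^sub>R p = - (G y - G s - (y - s) *\<^sub>R p)"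
          by (simp add: min_def max_def algebra_simps)
        then show ?thesis by (metis norm_minus_cancel)
      qed (simp add: min_def max_def)
      finally have 1: "norm (G y - G s - (y - s) *\<^sub>R p) \<le> \<bar>y - s\<bar> * norm (q s - p) + e / 3 * \<bar>y - s\<bar>" .
      have "G y - G s - (y - s) *\<^sub>R q s = (G y - G s - (y - s) *\<^sub>R p) + (y - s) *\<^sub>R (p - q s)"
        by (simp add: algebra_simps)
      then have "norm (G y - G s - (y - s) *\<^sub>R q s) \<le> norm (G y - G s - (y - s) *\<^sub>R p) + \<bar>y - s\<bar> * norm (p - q s)"
        by (metis norm_scaleR norm_triangle_ineq)
      moreover have pq: "norm (p - q s) \<le> e / 3" "norm (q s - p) \<le> e / 3"
        using p(2) by (simp_all add: dist_norm norm_minus_commute)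
      moreover note mult_left_mono[OF pq(1) abs_ge_zero[of "y - s"]] mult_left_mono[OF pq(2) abs_ge_zero[of "y - s"]]
      ultimately have "norm (G y - G s - (y - s) *\<^sub>R q s) \<le> 3 * (\<bar>y - s\<bar> * (e / 3))" using 1 by argo
      then show ?thesis by (simp add: mult.commute)
    qed
    with d(1) show "\<exists>d>0. \<forall>y\<in>{0..T}. norm (y - s) < d \<longrightarrow> norm (G y - G s - (y - s) *\<^sub>R q s) \<le> e * norm (y - s)"
      by blast
  qed
  ultimately show ?thesis by blast
qed

text \<open>The Arzela-Ascoli theorem for a target space without the Heine-Borel property: Tychonoff's
  theorem gives convergence at the rationals (moved into the interval by \<open>cl\<close>), and the Lipschitz
  bound makes it uniform.\<close>
lemma equilipschitz_compact_subsequence: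
  fixes F :: "nat \<Rightarrow> real \<Rightarrow> 'a::complete_space"
  assumes Q: "compact Q" and FQ: "\<And>n s. s \<in> {0..S} \<Longrightarrow> F n s \<in> Q" and S: "S \<ge> 0"
    and lip: "\<And>n s t. s \<in> {0..S} \<Longrightarrow> t \<in> {0..S} \<Longrightarrow> dist (F n s) (F n t) \<le> \<bar>s - t\<bar>"
  shows "\<exists>r G. strict_mono (r :: nat \<Rightarrow> nat) \<and> (\<forall>e>0. \<exists>N. \<forall>n\<ge>N. \<forall>s\<in>{0..S}. dist (F (r n) s) (G s) < e)"
proof -
  define cl where "cl s = max 0 (min S s)" for s
  have cl: "cl s \<in> {0..S}" "\<bar>cl s - cl t\<bar> \<le> \<bar>s - t\<bar>" for s t using S by (auto simp: cl_def)
  have cl_id: "cl s = s" if "s \<in> {0..S}" for s using that by (auto simp: cl_def)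
  define q where "q i = (from_nat_into \<rat> i :: real)" for i
  have "compactin (product_topology (\<lambda>_::nat. euclidean) UNIV) (PiE UNIV (\<lambda>_. Q))"
    using Q by (subst compactin_PiE) simp
  then have "compact (PiE (UNIV::nat set) (\<lambda>_. Q))" by (simp add: euclidean_product_topology)
  moreover have "(\<lambda>i. F n (cl (q i))) \<in> PiE UNIV (\<lambda>_. Q)" for n using FQ cl(1) by auto
  ultimately obtain g r where r: "strict_mono (r :: nat \<Rightarrow> nat)" "((\<lambda>n i. F n (cl (q i))) \<circ> r) \<longlonglongrightarrow> g"
    unfolding compact_eq_seq_compact_metric seq_compact_def by metis
  have conv: "(\<lambda>n. F (r n) (cl (q i))) \<longlonglongrightarrow> g i" for i
    using isCont_tendsto_compose[OF _ r(2), of "\<lambda>\<phi>. \<phi> i"]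
    by (simp add: o_def continuous_on_eq_continuous_at[OF open_UNIV, symmetric] flip: continuous_on_eq_continuous_at)
       (metis UNIV_I continuous_on_eq_continuous_at continuous_on_product_coordinates open_UNIV)
  have "\<exists>N. \<forall>m\<ge>N. \<forall>n\<ge>N. \<forall>s\<in>{0..S}. dist (F (r m) s) (F (r n) s) < e" if e: "e > 0" for e
  proof -
    have "{0..S} \<subseteq> (\<Union>i\<in>UNIV. ball (q i) (e/4))"
    proof
      fix s assume "s \<in> {0..S}"
      obtain x where "x \<in> \<rat>" "s - e/4 < x" "x < s" using Rats_dense_in_real[of "s - e/4" s] e by auto
      moreover obtain i where "q i = x" unfolding q_def
        using from_nat_into_surj[OF countable_rat \<open>x \<in> \<rat>\<close>] by blast
      ultimately show "s \<in> (\<Union>i\<in>UNIV. ball (q i) (e/4))" by (auto simp: dist_real_def intro!: exI[of _ i])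
    qed
    then obtain I where I: "finite I" "{0..S} \<subseteq> (\<Union>i\<in>I. ball (q i) (e/4))"
      using compactE_image[of "{0..S}" UNIV "\<lambda>i. ball (q i) (e/4)"] by auto
    have "\<forall>i. \<exists>N. \<forall>m\<ge>N. \<forall>n\<ge>N. dist (F (r m) (cl (q i))) (F (r n) (cl (q i))) < e/4"
      using LIMSEQ_imp_Cauchy[OF conv] e unfolding Cauchy_def by (metis divide_pos_pos zero_less_numeral)
    then obtain N where N: "\<And>i m n. m \<ge> N i \<Longrightarrow> n \<ge> N i \<Longrightarrow> dist (F (r m) (cl (q i))) (F (r n) (cl (q i))) < e/4" by metis
    have "dist (F (r m) s) (F (r n) s) < e" if mn: "m \<ge> Max (insert 0 (N ` I))" "n \<ge> Max (insert 0 (N ` I))" and s: "s \<in> {0..S}" for m n s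
    proof -
      obtain i where i: "i \<in> I" "dist (q i) s < e/4" using I(2) s by auto
      have Ni: "m \<ge> N i" "n \<ge> N i" using mn i(1) I(1) by auto
      have near: "dist (F k s) (F k (cl (q i))) \<le> e/4" for k
        using lip[OF s cl(1)[of "q i"], of k] cl(2)[of s "q i"] i(2)
        unfolding cl_id[OF s] dist_real_def by linarith
      have "dist (F (r m) s) (F (r n) s) \<le> dist (F (r m) s) (F (r m) (cl (q i)))
        + dist (F (r m) (cl (q i))) (F (r n) (cl (q i))) + dist (F (r n) s) (F (r n) (cl (q i)))"
        by (smt (verit) dist_commute dist_triangle)
      with near[of "r m"] near[of "r n"] N[OF Ni] e show ?thesis by linarith
    qed
    then show ?thesis by blast
  qed
  then have "\<forall>e>0. \<exists>N. \<forall>m n s. N \<le> m \<and> N \<le> n \<and> s \<in> {0..S} \<longrightarrow> dist (F (r m) s) (F (r n) s) < e" by meson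
  then obtain G where "\<forall>e>0. \<exists>N. \<forall>n s. N \<le> n \<and> s \<in> {0..S} \<longrightarrow> dist (F (r n) s) (G s) < e"
    using uniformly_convergent_eq_cauchy[of "\<lambda>s. s \<in> {0..S}" "\<lambda>n. F (r n)"] by blast
  with r(1) show ?thesis by blast
qed

text \<open>Only right derivatives are required, so that the estimate applies to piecewise linear
  functions at all points, including their nodes.\<close>
lemma gronwall_right_derivative:
  fixes \<phi> \<phi>' :: "real \<Rightarrow> real"
  assumes S: "0 \<le> S" and cont: "continuous_on {0..S} \<phi>" and k: "k > 0"
    and deriv: "\<And>s. 0 \<le> s \<Longrightarrow> s < S \<Longrightarrow> (\<phi> has_real_derivative \<phi>' s) (at s within {s..})"
    and bound: "\<And>s. 0 \<le> s \<Longrightarrow> s < S \<Longrightarrow> \<phi>' s \<le> k * \<phi> s + c"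
  shows "\<phi> S + c / k \<le> (\<phi> 0 + c / k) * exp (k * S)"
proof -
  \<comment> \<open>The shift by \<open>c / k\<close> absorbs the inhomogeneous term of the differential inequality.\<close>
  define q where "q s = - ((\<phi> s + c / k) * exp (- k * s))" for s
  have "q 0 \<le> q S"
  proof (rule dini_nondecreasing[OF S])
    show "continuous_on {0..S} q" unfolding q_def by (intro continuous_intros cont)
    fix s e :: real assume s: "0 \<le> s" "s < S" and e: "e > 0"
    define q' where "q' = - (\<phi>' s * exp (- k * s) + (\<phi> s + c / k) * (exp (- k * s) * (- k)))"
    have "(q has_real_derivative q') (at s within {s..})"
      unfolding q_def q'_def
      by (auto intro!: derivative_eq_intros deriv[OF s] simp: algebra_simps)
    then have "\<exists>d>0. \<forall>y\<in>{s..}. norm (y - s) < d \<longrightarrow> norm (q y - q s - q' * (y - s)) \<le> e * norm (y - s)"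
      using e unfolding has_field_derivative_def has_derivative_within_alt by blast
    then obtain d where d: "d > 0" "\<And>y. y \<ge> s \<Longrightarrow> \<bar>y - s\<bar> < d \<Longrightarrow> \<bar>q y - q s - q' * (y - s)\<bar> \<le> e * \<bar>y - s\<bar>"
      by auto
    have "q' = exp (- k * s) * (k * \<phi> s + c - \<phi>' s)" using k by (simp add: q'_def field_simps)
    then have q': "q' \<ge> 0" using bound[OF s] by simp
    have "q s - e * t \<le> q (s + t)" if t: "0 < t" "t < d" for t
    proof -
      have "\<bar>q (s + t) - q s - q' * t\<bar> \<le> e * t" using d(2)[of "s + t"] t by simp
      moreover have "q' * t \<ge> 0" using q' t by simp
      ultimately show ?thesis by linarith
    qed
    with d(1) show "\<exists>\<delta>>0. \<forall>t. 0 < t \<longrightarrow> t < \<delta> \<longrightarrow> s + t \<le> S \<longrightarrow> q s - e * t \<le> q (s + t)" by blast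
  qed
  then have "(\<phi> S + c / k) * exp (- k * S) * exp (k * S) \<le> (\<phi> 0 + c / k) * exp (k * S)"
    unfolding q_def by (intro mult_right_mono) auto
  then show ?thesis by (simp add: mult.assoc flip: exp_add)
qed

section \<open>The catching-up scheme\<close>

text \<open>The step by which the scheme is extended from one cell of the grid to the next.\<close>
lemma weak_primitive_glue:
  assumes G: "weak_primitive a q G" and a: "0 \<le> a" "a \<le> b"
    and G2: "\<And>\<zeta> s t. a \<le> s \<Longrightarrow> s \<le> t \<Longrightarrow> t \<le> b \<Longrightarrow> ((\<lambda>r. q2 r \<bullet> \<zeta>) has_integral (G2 t - G2 s) \<bullet> \<zeta>) {s..t}"
  shows "weak_primitive b (\<lambda>s. if s < a then q s else q2 s) (\<lambda>t. if t \<le> a then G t else G a + (G2 t - G2 a))"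
  (is "weak_primitive b ?q ?G")
  unfolding weak_primitive_def
proof (intro allI impI)
  fix \<zeta> s t assume st: "0 \<le> s" "s \<le> t" "t \<le> b"
  have left: "((\<lambda>r. ?q r \<bullet> \<zeta>) has_integral (G t' - G s) \<bullet> \<zeta>) {s..t'}" if t': "s \<le> t'" "t' \<le> a" for t'
  proof (rule has_integral_spike_finite[of "{a}"])
    show "((\<lambda>r. q r \<bullet> \<zeta>) has_integral (G t' - G s) \<bullet> \<zeta>) {s..t'}"
      by (rule weak_primitiveD[OF G st(1) t'])
  qed (use t' in auto)
  have right: "((\<lambda>r. ?q r \<bullet> \<zeta>) has_integral (G2 t - G2 s') \<bullet> \<zeta>) {s'..t}" if s': "a \<le> s'" "s' \<le> t" for s'
  proof (rule has_integral_eq)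
    show "((\<lambda>r. q2 r \<bullet> \<zeta>) has_integral (G2 t - G2 s') \<bullet> \<zeta>) {s'..t}" by (rule G2[OF s' st(3)])
  qed (use s' in auto)
  show "((\<lambda>r. ?q r \<bullet> \<zeta>) has_integral (?G t - ?G s) \<bullet> \<zeta>) {s..t}"
  proof (cases "t \<le> a")
    case True
    then show ?thesis using left[of t] st by simp
  next
    case t: False
    show ?thesis
    proof (cases "s \<le> a")
      case True
      have "((\<lambda>r. ?q r \<bullet> \<zeta>) has_integral ((G a - G s) \<bullet> \<zeta> + (G2 t - G2 a) \<bullet> \<zeta>)) {s..t}"
        using True t by (intro has_integral_combine[OF _ _ left[of a] right[of a]]) auto
      moreover have "(?G t - ?G s) \<bullet> \<zeta> = (G a - G s) \<bullet> \<zeta> + (G2 t - G2 a) \<bullet> \<zeta>"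
        using True t by (simp add: algebra_simps)
      ultimately show ?thesis by (simp only:)
    next
      case False
      then have "?G t - ?G s = G2 t - G2 s" using t by simp
      then show ?thesis using right[of s] False st by simp
    qed
  qed
qed

text \<open>A sweeping process for a family of sets that are uniformly prox-regular (assumption \<open>project\<close>)
  and move in a Lipschitz way for small time differences (assumption \<open>move\<close>).\<close>
locale sweeping_process =
  fixes T L \<kappa> \<eta> \<delta>0 :: real
    and C :: "real \<Rightarrow> 'a::{real_inner, complete_space} set"
    and g :: "real \<Rightarrow> 'a \<Rightarrow> 'a" and K :: "'a set" and \<beta> :: "real \<Rightarrow> real" and x0 :: 'a
  assumes pos: "T > 0" "L > 0" "\<kappa> \<ge> 0" "\<eta> > 0" "\<delta>0 > 0"
    and closed_C: "\<And>t. t \<in> {0..T} \<Longrightarrow> closed (C t)"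
    and move: "\<And>s t x. \<lbrakk>s \<in> {0..T}; t \<in> {0..T}; x \<in> C s; \<bar>t - s\<bar> \<le> \<delta>0\<rbrakk> \<Longrightarrow> \<exists>y\<in>C t. dist x y \<le> L * \<bar>t - s\<bar>"
    and project: "\<And>t z. \<lbrakk>t \<in> {0..T}; infdist z (C t) < \<eta>\<rbrakk> \<Longrightarrow>
       \<exists>p\<in>C t. (\<forall>y\<in>C t. dist z p \<le> dist z y) \<and>
         (\<forall>y\<in>C t. (z - p) \<bullet> (y - p) \<le> \<kappa> * norm (z - p) * (dist y p)\<^sup>2)"
    and g_meas: "\<And>x. (\<lambda>t. g t x) \<in> borel_measurable (lebesgue_on {0..T})"
    and g_cont: "\<And>t x. t \<in> {0..T} \<Longrightarrow> isCont (g t) x"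
    and K: "compact K" "K \<subseteq> cball 0 1"
    and \<beta>: "\<And>t. t \<in> {0..T} \<Longrightarrow> \<beta> t \<ge> 0" "\<beta> integrable_on {0..T}"
    and g_growth: "\<And>t x. t \<in> {0..T} \<Longrightarrow> g t x \<in> (\<lambda>z. (\<beta> t * (1 + norm x)) *\<^sub>R z) ` K"
    and x0: "x0 \<in> C 0"
begin

definition B :: "real \<Rightarrow> real" where "B t = integral {0..t} \<beta>"

text \<open>An a priori bound for \<open>1 + |x|\<close>, from Gronwall's lemma and the growth condition.\<close>
definition M :: real where "M = (1 + norm x0 + L * T) * exp (2 * B T)"

text \<open>The new time \<open>\<sigma> = \<tau> t\<close>: the derivative \<open>1 + L + M \<beta>\<close> of \<open>\<tau>\<close> dominates the speed of the constraint
  set and of the perturbation, so both have speed at most one in the time \<open>\<sigma>\<close>. The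
  summand \<open>1\<close> makes the inverse of \<open>\<tau>\<close> Lipschitz.\<close>
definition \<tau> :: "real \<Rightarrow> real" where "\<tau> t = (1 + L) * t + M * B t"

definition S :: real where "S = \<tau> T"

definition \<tau>_inv :: "real \<Rightarrow> real" where "\<tau>_inv \<sigma> = (SOME t. t \<in> {0..T} \<and> \<tau> t = \<sigma>)"

lemma \<beta>_integrable_sub: "0 \<le> s \<Longrightarrow> t \<le> T \<Longrightarrow> \<beta> integrable_on {s..t}"
  using \<beta>(2) by (rule integrable_on_subinterval) auto

lemma B_diff: "0 \<le> s \<Longrightarrow> s \<le> t \<Longrightarrow> t \<le> T \<Longrightarrow> integral {s..t} \<beta> = B t - B s"
  using Henstock_Kurzweil_Integration.integral_combine[of 0 s t \<beta>] \<beta>_integrable_sub[of 0 t]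
  by (simp add: B_def)

lemma B_mono: "0 \<le> s \<Longrightarrow> s \<le> t \<Longrightarrow> t \<le> T \<Longrightarrow> B s \<le> B t"
  using B_diff[of s t] integral_nonneg[OF \<beta>_integrable_sub[of s t]] \<beta>(1) by simp

lemma B_0: "B 0 = 0"
  by (simp add: B_def)

lemma B_nonneg: "0 \<le> t \<Longrightarrow> t \<le> T \<Longrightarrow> 0 \<le> B t"
  using B_mono[of 0 t] by (simp add: B_0)

lemma M_ge: "M \<ge> 1"
proof -
  have "1 * 1 \<le> (1 + norm x0 + L * T) * exp (2 * B T)"
    using pos B_nonneg[of T] by (intro mult_mono) auto
  then show ?thesis by (simp add: M_def)
qed

lemma \<tau>_0: "\<tau> 0 = 0"
  by (simp add: \<tau>_def B_0)

lemma \<tau>_diff_ge: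
  assumes "0 \<le> s" "s \<le> t" "t \<le> T"
  shows "(1 + L) * (t - s) + M * (B t - B s) = \<tau> t - \<tau> s" "t - s \<le> \<tau> t - \<tau> s"
    "L * (t - s) + M * (B t - B s) \<le> \<tau> t - \<tau> s" "M * (B t - B s) \<le> \<tau> t - \<tau> s" "L * (t - s) \<le> \<tau> t - \<tau> s"
proof -
  show eq: "(1 + L) * (t - s) + M * (B t - B s) = \<tau> t - \<tau> s" by (simp add: \<tau>_def algebra_simps)
  have "M * (B t - B s) \<ge> 0" "L * (t - s) \<ge> 0"
    using B_mono[OF assms] M_ge pos assms by auto
  with eq assms show "t - s \<le> \<tau> t - \<tau> s"
    "L * (t - s) + M * (B t - B s) \<le> \<tau> t - \<tau> s" "M * (B t - B s) \<le> \<tau> t - \<tau> s" "L * (t - s) \<le> \<tau> t - \<tau> s"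
    by (simp_all add: distrib_right)
qed

lemma \<tau>_strict_mono: "0 \<le> s \<Longrightarrow> s < t \<Longrightarrow> t \<le> T \<Longrightarrow> \<tau> s < \<tau> t"
  using \<tau>_diff_ge(2)[of s t] by simp

lemma \<tau>_mono: "0 \<le> s \<Longrightarrow> s \<le> t \<Longrightarrow> t \<le> T \<Longrightarrow> \<tau> s \<le> \<tau> t"
  using \<tau>_diff_ge(2)[of s t] by simp

lemma S_pos: "S > 0"
  using \<tau>_strict_mono[of 0 T] pos by (simp add: S_def \<tau>_0)

lemma \<tau>_range: "t \<in> {0..T} \<Longrightarrow> \<tau> t \<in> {0..S}"
  using \<tau>_mono[of 0 t] \<tau>_mono[of t T] by (simp add: S_def \<tau>_0)

lemma continuous_on_B: "continuous_on {0..T} B"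
  unfolding B_def using indefinite_integral_continuous_1[OF \<beta>(2)] .

lemma continuous_on_\<tau>: "continuous_on {0..T} \<tau>"
  unfolding \<tau>_def by (intro continuous_intros continuous_on_B)

lemma \<tau>_inv:
  assumes "\<sigma> \<in> {0..S}"
  shows "\<tau>_inv \<sigma> \<in> {0..T}" "\<tau> (\<tau>_inv \<sigma>) = \<sigma>"
proof -
  have "\<exists>t. 0 \<le> t \<and> t \<le> T \<and> \<tau> t = \<sigma>"
    using assms pos by (intro IVT' continuous_on_\<tau>) (auto simp: \<tau>_0 S_def)
  then have "\<exists>t. t \<in> {0..T} \<and> \<tau> t = \<sigma>" by auto
  from someI_ex[OF this] show "\<tau>_inv \<sigma> \<in> {0..T}" "\<tau> (\<tau>_inv \<sigma>) = \<sigma>" by (auto simp: \<tau>_inv_def)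
qed

lemma \<tau>_inv_\<tau>:
  assumes "t \<in> {0..T}" shows "\<tau>_inv (\<tau> t) = t"
proof -
  have "\<tau> (\<tau>_inv (\<tau> t)) = \<tau> t" "\<tau>_inv (\<tau> t) \<in> {0..T}" using \<tau>_inv \<tau>_range assms by auto
  then show ?thesis using \<tau>_strict_mono[of t "\<tau>_inv (\<tau> t)"] \<tau>_strict_mono[of "\<tau>_inv (\<tau> t)" t] assms
    by (cases "\<tau>_inv (\<tau> t)" t rule: linorder_cases) auto
qed

lemma \<tau>_inv_mono:
  assumes "0 \<le> a" "a \<le> b" "b \<le> S" shows "\<tau>_inv a \<le> \<tau>_inv b"
  using \<tau>_strict_mono[of "\<tau>_inv b" "\<tau>_inv a"] \<tau>_inv[of a] \<tau>_inv[of b] assms by force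

lemma \<tau>_inv_strict_mono:
  assumes "0 \<le> a" "a < b" "b \<le> S" shows "\<tau>_inv a < \<tau>_inv b"
  using \<tau>_mono[of "\<tau>_inv b" "\<tau>_inv a"] \<tau>_inv[of a] \<tau>_inv[of b] assms by force

lemma \<tau>_inv_lipschitz:
  assumes "a \<in> {0..S}" "b \<in> {0..S}"
  shows "\<bar>\<tau>_inv b - \<tau>_inv a\<bar> \<le> \<bar>b - a\<bar>" "L * \<bar>\<tau>_inv b - \<tau>_inv a\<bar> \<le> \<bar>b - a\<bar>"
proof -
  have *: "\<tau>_inv b - \<tau>_inv a \<le> b - a" "L * (\<tau>_inv b - \<tau>_inv a) \<le> b - a" "0 \<le> \<tau>_inv b - \<tau>_inv a"
    if "a \<in> {0..S}" "b \<in> {0..S}" "a \<le> b" for a b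
    using \<tau>_inv_mono[of a b] \<tau>_diff_ge(2,5)[of "\<tau>_inv a" "\<tau>_inv b"] \<tau>_inv[of a] \<tau>_inv[of b] that by auto
  show "\<bar>\<tau>_inv b - \<tau>_inv a\<bar> \<le> \<bar>b - a\<bar>" "L * \<bar>\<tau>_inv b - \<tau>_inv a\<bar> \<le> \<bar>b - a\<bar>"
    using *[of a b] *[of b a] assms by (cases "a \<le> b"; simp add: abs_minus_commute)+
qed

lemma \<tau>_inv_0: "\<tau>_inv 0 = 0"
  using \<tau>_inv_\<tau>[of 0] pos by (simp add: \<tau>_0)

lemma \<tau>_inv_S: "\<tau>_inv S = T"
  using \<tau>_inv_\<tau>[of T] pos by (simp add: S_def)

text \<open>In the new time variable the constraint set moves with speed at most one.\<close>
lemma move_\<sigma>: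
  assumes "a \<in> {0..S}" "b \<in> {0..S}" "\<bar>b - a\<bar> \<le> \<delta>0" "x \<in> C (\<tau>_inv a)"
  shows "\<exists>y\<in>C (\<tau>_inv b). dist x y \<le> \<bar>b - a\<bar>"
proof -
  have "\<exists>y\<in>C (\<tau>_inv b). dist x y \<le> L * \<bar>\<tau>_inv b - \<tau>_inv a\<bar>"
    using \<tau>_inv(1)[OF assms(1)] \<tau>_inv(1)[OF assms(2)] \<tau>_inv_lipschitz(1)[OF assms(1,2)] assms(3,4)
    by (intro move) auto
  then show ?thesis using \<tau>_inv_lipschitz(2)[OF assms(1,2)] by (meson order_trans)
qed

lemma g_norm_le:
  assumes "t \<in> {0..T}" shows "norm (g t x) \<le> \<beta> t * (1 + norm x)"
proof -
  obtain z where z: "z \<in> K" "g t x = (\<beta> t * (1 + norm x)) *\<^sub>R z" using g_growth[OF assms] by auto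
  have "norm z \<le> 1" using z K by auto
  moreover have "\<beta> t * (1 + norm x) \<ge> 0" using \<beta>(1)[OF assms] by simp
  ultimately show ?thesis using z mult_left_mono[of "norm z" 1 "\<beta> t * (1 + norm x)"] by simp
qed

text \<open>A frozen perturbation selects measurably among the finitely many functions \<open>g _ x\<close> with \<open>x\<close> a
  value of \<open>xb\<close>.\<close>
lemma frozen_measurable:
  fixes \<Phi> :: "'a \<Rightarrow> real"
  assumes xb: "simple_function borel xb" and \<Phi>: "continuous_on UNIV \<Phi>"
  shows "(\<lambda>t. \<Phi> (g t (xb t))) \<in> borel_measurable (lebesgue_on {0..T})"
proof (rule measurable_compose_countable'[where I = "range xb" and f = "\<lambda>x t. \<Phi> (g t x)"])
  show fin: "countable (range xb)" using simple_functionD(1)[OF xb] by (simp add: countable_finite)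
  have "xb -` {a} \<inter> {0..T} \<in> sets (lebesgue_on {0..T})" for a
  proof -
    have "xb -` {a} \<inter> space borel \<in> sets borel" using xb by (rule simple_functionD(2))
    then have "xb -` {a} \<in> sets lebesgue" by simp
    then have "xb -` {a} \<inter> {0..T} \<in> sets lebesgue" by (rule sets.Int) simp
    then show ?thesis by (simp add: sets_restrict_space_iff)
  qed
  then show "xb \<in> lebesgue_on {0..T} \<rightarrow>\<^sub>M count_space (range xb)"
    using measurable_count_space_eq_countable[OF fin, of xb "lebesgue_on {0..T}"] by auto
  show "(\<lambda>t. \<Phi> (g t x)) \<in> borel_measurable (lebesgue_on {0..T})" for x
    by (rule borel_measurable_continuous_on[OF \<Phi> g_meas])
qed

lemma frozen_dominated:
  assumes "1 + norm x \<le> M" "t \<in> {0..T}" shows "norm (g t x) \<le> M * \<beta> t"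
proof -
  have "norm (g t x) \<le> \<beta> t * (1 + norm x)" by (rule g_norm_le[OF assms(2)])
  also have "\<dots> \<le> \<beta> t * M" using assms \<beta>(1)[OF assms(2)] by (intro mult_left_mono) auto
  finally show ?thesis by (simp add: mult.commute)
qed

lemma frozen_integrable:
  assumes xb: "simple_function borel xb" and bd: "\<And>t. 1 + norm (xb t) \<le> M"
  shows "(\<lambda>t. g t (xb t) \<bullet> \<zeta>) integrable_on {0..T}"
proof (rule measurable_bounded_by_integrable_imp_integrable)
  show "(\<lambda>t. g t (xb t) \<bullet> \<zeta>) \<in> borel_measurable (lebesgue_on {0..T})"
    by (rule frozen_measurable[OF xb, of "\<lambda>y. y \<bullet> \<zeta>"]) (intro continuous_intros)
  show "(\<lambda>t. M * \<beta> t * norm \<zeta>) integrable_on {0..T}"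
    by (intro integrable_on_mult_left integrable_on_mult_right \<beta>(2))
  show "norm (g t (xb t) \<bullet> \<zeta>) \<le> M * \<beta> t * norm \<zeta>" if "t \<in> {0..T}" for t
  proof -
    have "\<bar>g t (xb t) \<bullet> \<zeta>\<bar> \<le> norm (g t (xb t)) * norm \<zeta>" by (rule Cauchy_Schwarz_ineq2)
    also have "\<dots> \<le> M * \<beta> t * norm \<zeta>" using frozen_dominated[OF bd that] by (intro mult_right_mono) auto
    finally show ?thesis by simp
  qed
qed auto

lemma frozen_primitive_increment:
  assumes H: "weak_primitive T' (\<lambda>t. g t (xb t)) H" and T': "T' \<le> T" and bd: "\<And>t. 1 + norm (xb t) \<le> m"
    and st: "0 \<le> s" "s \<le> t" "t \<le> T'"
  shows "norm (H t - H s) \<le> m * (B t - B s)"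
proof -
  have "norm (H t - H s - (t - s) *\<^sub>R 0) \<le> integral {s..t} (\<lambda>r. m * \<beta> r)"
  proof (rule weak_primitive_increment_bound[OF H st])
    show "(\<lambda>r. m * \<beta> r) integrable_on {s..t}"
      using st T' by (intro integrable_on_mult_right \<beta>_integrable_sub) auto
    fix r assume "r \<in> {s..t}"
    then have r: "r \<in> {0..T}" using st T' by auto
    have "norm (g r (xb r)) \<le> \<beta> r * (1 + norm (xb r))" by (rule g_norm_le[OF r])
    also have "\<dots> \<le> \<beta> r * m" using bd[of r] \<beta>(1)[OF r] by (intro mult_left_mono) auto
    finally show "norm (g r (xb r) - 0) \<le> m * \<beta> r" by (simp add: mult.commute)
  qed
  then show ?thesis using B_diff[of s t] st T' by simp
qed

text \<open>The outcome of the scheme with mesh \<open>\<epsilon>\<close> up to the time \<open>a\<close>. The state frozen in \<open>g\<close> is \<open>xb t\<close>, a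
  function of the original time, as is \<open>H\<close>; the velocity \<open>\<omega>\<close> and its primitive \<open>\<Omega>\<close> are functions of
  the new time. The solution itself is \<open>x0 - H (\<tau>_inv \<sigma>) - \<Omega> \<sigma>\<close>. The last clause says that \<open>\<omega> \<sigma>\<close> is a
  proximal normal at a nearby point \<open>p\<close> of the constraint set at a nearby time \<open>\<theta>\<close>.\<close>
definition approximate_solution ::
  "real \<Rightarrow> real \<Rightarrow> (real \<Rightarrow> 'a) \<Rightarrow> (real \<Rightarrow> 'a) \<Rightarrow> (real \<Rightarrow> 'a) \<Rightarrow> (real \<Rightarrow> 'a) \<Rightarrow> bool" where
  "approximate_solution \<epsilon> a xb \<omega> H \<Omega> \<longleftrightarrow>
     simple_function borel xb \<and> simple_function borel \<omega> \<and>
     (\<forall>\<sigma>. norm (\<omega> \<sigma>) \<le> 1) \<and> (\<forall>t. 1 + norm (xb t) \<le> M) \<and> H 0 = 0 \<and> \<Omega> 0 = 0 \<and>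
     weak_primitive (\<tau>_inv a) (\<lambda>t. g t (xb t)) H \<and> weak_primitive a \<omega> \<Omega> \<and>
     (\<forall>\<sigma>\<in>{0..<a}. \<exists>d>0. \<forall>u. 0 \<le> u \<longrightarrow> u < d \<longrightarrow> \<Omega> (\<sigma> + u) = \<Omega> \<sigma> + u *\<^sub>R \<omega> \<sigma>) \<and>
     (\<forall>\<sigma>\<in>{0..<a}. dist (xb (\<tau>_inv \<sigma>)) (x0 - H (\<tau>_inv \<sigma>) - \<Omega> \<sigma>) \<le> 2 * \<epsilon>) \<and>
     (\<forall>\<sigma>\<in>{0..<a}. \<exists>\<theta>\<in>{0..S}. \<bar>\<theta> - \<sigma>\<bar> \<le> \<epsilon> \<and>
        (\<exists>p\<in>C (\<tau>_inv \<theta>). dist p (x0 - H (\<tau>_inv \<sigma>) - \<Omega> \<sigma>) \<le> 2 * \<epsilon> \<and>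
           (\<forall>y\<in>C (\<tau>_inv \<theta>). \<omega> \<sigma> \<bullet> (y - p) \<le> \<kappa> * (dist y p)\<^sup>2)))"

text \<open>One step of the catching-up scheme. The projection displacement \<open>z - p\<close> is spread evenly over the
  cell, as the constant velocity \<open>w\<close>. The last inequality is a discrete Gronwall estimate; together
  with the definition of \<open>M\<close> it keeps \<open>1 + |x|\<close> below \<open>M\<close>.\<close>
lemma approximate_solution_step:
  assumes A: "approximate_solution \<epsilon> a xb \<omega> H \<Omega>"
    and end_a: "x0 - H (\<tau>_inv a) - \<Omega> a \<in> C (\<tau>_inv a)"
      "1 + norm (x0 - H (\<tau>_inv a) - \<Omega> a) \<le> (1 + norm x0 + L * \<tau>_inv a) * exp (2 * B (\<tau>_inv a))"
    and ab: "0 \<le> a" "a < b" "b \<le> S" "b - a \<le> \<epsilon>" and \<epsilon>: "\<epsilon> < \<eta>" "\<epsilon> \<le> \<delta>0"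
  shows "\<exists>xb' \<omega>' H' \<Omega>'. approximate_solution \<epsilon> b xb' \<omega>' H' \<Omega>' \<and>
     x0 - H' (\<tau>_inv b) - \<Omega>' b \<in> C (\<tau>_inv b) \<and>
      1 + norm (x0 - H' (\<tau>_inv b) - \<Omega>' b) \<le> (1 + norm x0 + L * \<tau>_inv b) * exp (2 * B (\<tau>_inv b))"
proof -
  define x where "x = x0 - H (\<tau>_inv a) - \<Omega> a"
  define s where "s = \<tau>_inv a"
  define t where "t = \<tau>_inv b"
  have st: "0 \<le> s" "s < t" "t \<le> T" "\<tau> s = a" "\<tau> t = b"
    using \<tau>_inv[of a] \<tau>_inv[of b] \<tau>_inv_strict_mono[of a b] ab by (auto simp: s_def t_def)
  have le: "L * (t - s) + M * (B t - B s) \<le> b - a" using \<tau>_diff_ge(3)[of s t] st by simp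
  have dB: "B t - B s \<ge> 0" using B_mono[of s t] st by simp
  have xM: "1 + norm x \<le> M"
  proof -
    have "1 + norm x \<le> (1 + norm x0 + L * s) * exp (2 * B s)" using end_a(2) by (simp add: x_def s_def)
    also have "\<dots> \<le> M" unfolding M_def
      using st pos B_mono[of s T] by (intro mult_mono add_mono mult_left_mono) (auto simp: add_nonneg_nonneg)
    finally show ?thesis .
  qed
  have simple_x: "simple_function borel (\<lambda>_::real. x)" by simp
  obtain J where J: "weak_primitive T (\<lambda>r. g r x) J"
    using weak_primitive_exists[of "\<lambda>r. g r x" T "\<lambda>r. M * \<beta> r"] frozen_integrable[OF simple_x] xM
      frozen_dominated[OF xM] integrable_on_mult_right[OF \<beta>(2)] by blast
  have J_bd: "norm (J v - J u) \<le> (1 + norm x) * (B v - B u)" "norm (J v - J u) \<le> \<tau> v - \<tau> u"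
    if "0 \<le> u" "u \<le> v" "v \<le> T" for u v
  proof -
    show 1: "norm (J v - J u) \<le> (1 + norm x) * (B v - B u)"
      using frozen_primitive_increment[OF J order_refl, of "1 + norm x"] that by simp
    also have "\<dots> \<le> M * (B v - B u)" using xM B_mono[OF that] by (intro mult_right_mono) auto
    also have "\<dots> \<le> \<tau> v - \<tau> u" by (rule \<tau>_diff_ge(4)[OF that])
    finally show "norm (J v - J u) \<le> \<tau> v - \<tau> u" .
  qed
  define z where "z = x - (J t - J s)"
  have "\<bar>t - s\<bar> \<le> \<delta>0" using \<tau>_diff_ge(2)[of s t] st ab \<epsilon> by simp
  then obtain y where y: "y \<in> C t" "dist x y \<le> L * (t - s)"
    using move[of s t x] st end_a(1) by (auto simp: x_def s_def)
  have zx: "norm (z - x) \<le> (1 + norm x) * (B t - B s)" using J_bd(1)[of s t] st by (simp add: z_def norm_minus_commute)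
  have "(1 + norm x) * (B t - B s) \<le> M * (B t - B s)" using xM dB by (intro mult_right_mono) auto
  have "dist z y \<le> norm (z - x) + dist x y" using dist_triangle[of z y x] by (simp add: dist_norm)
  with zx y have zy: "dist z y \<le> (1 + norm x) * (B t - B s) + L * (t - s)" by simp
  with \<open>(1 + norm x) * (B t - B s) \<le> M * (B t - B s)\<close> le have zy': "dist z y \<le> b - a" by simp
  have "infdist z (C t) \<le> dist z y" using y(1) by (rule infdist_le)
  then have "infdist z (C t) < \<eta>" using zy' ab \<epsilon> by simp
  then obtain p where p: "p \<in> C t" "\<And>y. y \<in> C t \<Longrightarrow> dist z p \<le> dist z y"
    "\<And>y. y \<in> C t \<Longrightarrow> (z - p) \<bullet> (y - p) \<le> \<kappa> * norm (z - p) * (dist y p)\<^sup>2"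
    using project[of t z] st by auto
  have zp: "norm (z - p) \<le> (1 + norm x) * (B t - B s) + L * (t - s)" "norm (z - p) \<le> b - a"
    using p(2)[OF y(1)] zy zy' by (auto simp: dist_norm)
  define w where "w = (1 / (b - a)) *\<^sub>R (z - p)"
  have w: "norm w \<le> 1" "(b - a) *\<^sub>R w = z - p" using zp(2) ab by (auto simp: w_def divide_simps)
  have w_prox: "w \<bullet> (y - p) \<le> \<kappa> * (dist y p)\<^sup>2" if "y \<in> C t" for y
  proof -
    have "(b - a) * (w \<bullet> (y - p)) \<le> \<kappa> * norm (z - p) * (dist y p)\<^sup>2"
      using p(3)[OF that] by (simp flip: w(2))
    also have "\<dots> \<le> \<kappa> * (b - a) * (dist y p)\<^sup>2" using zp(2) pos by (intro mult_right_mono mult_left_mono) auto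
    finally have "(b - a) * (w \<bullet> (y - p)) \<le> (b - a) * (\<kappa> * (dist y p)\<^sup>2)" by (simp add: mult_ac)
    then show ?thesis by (rule mult_left_le_imp_le) (use ab in simp)
  qed
  define xb' where "xb' r = (if r < s then xb r else x)" for r
  define \<omega>' where "\<omega>' \<sigma> = (if \<sigma> < a then \<omega> \<sigma> else w)" for \<sigma>
  define H' where "H' r = (if r \<le> s then H r else H s + (J r - J s))" for r
  define \<Omega>' where "\<Omega>' \<sigma> = (if \<sigma> \<le> a then \<Omega> \<sigma> else \<Omega> a + (\<sigma> *\<^sub>R w - a *\<^sub>R w))" for \<sigma>
  define X where "X \<sigma> = x0 - H' (\<tau>_inv \<sigma>) - \<Omega>' \<sigma>" for \<sigma>
  have X_old: "X \<sigma> = x0 - H (\<tau>_inv \<sigma>) - \<Omega> \<sigma>" if "0 \<le> \<sigma>" "\<sigma> \<le> a" for \<sigma>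
    using that \<tau>_inv_mono[of \<sigma> a] ab by (simp add: X_def H'_def \<Omega>'_def s_def)
  have X_new: "X \<sigma> = x - (J (\<tau>_inv \<sigma>) - J s) - (\<sigma> - a) *\<^sub>R w" if "a \<le> \<sigma>" "\<sigma> \<le> b" for \<sigma>
  proof (cases "\<sigma> = a")
    case True
    then show ?thesis using X_old[of a] ab by (simp add: x_def s_def)
  next
    case False
    then have "s < \<tau>_inv \<sigma>" "a < \<sigma>" using \<tau>_inv_strict_mono[of a \<sigma>] that ab by (auto simp: s_def)
    then show ?thesis by (simp add: X_def H'_def \<Omega>'_def x_def s_def algebra_simps)
  qed
  have Xb: "X b = p" using X_new[of b] ab w(2) by (simp add: z_def t_def)
  have Xx: "dist x (X \<sigma>) \<le> 2 * \<epsilon>" "dist p (X \<sigma>) \<le> 2 * \<epsilon>" if \<sigma>: "a \<le> \<sigma>" "\<sigma> \<le> b" for \<sigma>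
  proof -
    have r: "s \<le> \<tau>_inv \<sigma>" "\<tau>_inv \<sigma> \<le> t" "\<tau> (\<tau>_inv \<sigma>) = \<sigma>"
      using \<sigma> ab \<tau>_inv_mono[of a \<sigma>] \<tau>_inv_mono[of \<sigma> b] \<tau>_inv[of \<sigma>] by (auto simp: s_def t_def)
    have 1: "norm (J (\<tau>_inv \<sigma>) - J s) \<le> \<sigma> - a" "norm (J t - J (\<tau>_inv \<sigma>)) \<le> b - \<sigma>"
      using J_bd(2)[of s "\<tau>_inv \<sigma>"] J_bd(2)[of "\<tau>_inv \<sigma>" t] r st by auto
    have 2: "norm ((\<sigma> - a) *\<^sub>R w) \<le> \<sigma> - a" "norm ((b - \<sigma>) *\<^sub>R w) \<le> b - \<sigma>"
      using w(1) \<sigma> mult_left_mono[of "norm w" 1 "\<sigma> - a"] mult_left_mono[of "norm w" 1 "b - \<sigma>"] by auto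
    have "x - X \<sigma> = (J (\<tau>_inv \<sigma>) - J s) + (\<sigma> - a) *\<^sub>R w" using X_new[OF \<sigma>] by simp
    then have "dist x (X \<sigma>) \<le> norm (J (\<tau>_inv \<sigma>) - J s) + norm ((\<sigma> - a) *\<^sub>R w)"
      unfolding dist_norm by (metis norm_triangle_ineq)
    then show "dist x (X \<sigma>) \<le> 2 * \<epsilon>" using 1 2 \<sigma> ab by simp
    have "X \<sigma> - p = (J t - J (\<tau>_inv \<sigma>)) + (b - \<sigma>) *\<^sub>R w"
      using X_new[OF \<sigma>] X_new[of b] Xb ab by (simp add: t_def algebra_simps)
    then have "dist (X \<sigma>) p \<le> norm (J t - J (\<tau>_inv \<sigma>)) + norm ((b - \<sigma>) *\<^sub>R w)"
      unfolding dist_norm by (metis norm_triangle_ineq)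
    then show "dist p (X \<sigma>) \<le> 2 * \<epsilon>" using 1 2 \<sigma> ab by (simp add: dist_commute)
  qed
  note A' = A[unfolded approximate_solution_def]
  have "approximate_solution \<epsilon> b xb' \<omega>' H' \<Omega>'"
    unfolding approximate_solution_def
  proof (intro conjI)
    show "simple_function borel xb'" unfolding xb'_def
      using A' by (intro simple_function_If) auto
    show "simple_function borel \<omega>'" unfolding \<omega>'_def
      using A' by (intro simple_function_If) auto
    show "\<forall>\<sigma>. norm (\<omega>' \<sigma>) \<le> 1" using A' w by (auto simp: \<omega>'_def)
    show "\<forall>r. 1 + norm (xb' r) \<le> M" using A' xM by (auto simp: xb'_def)
    show "H' 0 = 0" "\<Omega>' 0 = 0" using A' st ab by (auto simp: H'_def \<Omega>'_def)
    have "weak_primitive t (\<lambda>r. if r < s then g r (xb r) else g r x) H'"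
      unfolding H'_def using A' st
      by (intro weak_primitive_glue) (auto simp: s_def intro: weak_primitiveD[OF J])
    moreover have "(\<lambda>r. if r < s then g r (xb r) else g r x) = (\<lambda>r. g r (xb' r))" by (auto simp: xb'_def)
    ultimately show "weak_primitive (\<tau>_inv b) (\<lambda>r. g r (xb' r)) H'" by (simp add: t_def)
    show "weak_primitive b \<omega>' \<Omega>'"
      unfolding \<omega>'_def \<Omega>'_def
    proof (rule weak_primitive_glue)
      fix \<zeta> u v assume "a \<le> u" "u \<le> v" "v \<le> b"
      then show "((\<lambda>r. w \<bullet> \<zeta>) has_integral (v *\<^sub>R w - u *\<^sub>R w) \<bullet> \<zeta>) {u..v}"
        using has_integral_const_real[of "w \<bullet> \<zeta>" u v] by (simp add: inner_diff_left content_real_if algebra_simps)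
    qed (use A' ab in auto)
    show "\<forall>\<sigma>\<in>{0..<b}. \<exists>d>0. \<forall>u. 0 \<le> u \<longrightarrow> u < d \<longrightarrow> \<Omega>' (\<sigma> + u) = \<Omega>' \<sigma> + u *\<^sub>R \<omega>' \<sigma>"
    proof
      fix \<sigma> assume \<sigma>: "\<sigma> \<in> {0..<b}"
      show "\<exists>d>0. \<forall>u. 0 \<le> u \<longrightarrow> u < d \<longrightarrow> \<Omega>' (\<sigma> + u) = \<Omega>' \<sigma> + u *\<^sub>R \<omega>' \<sigma>"
      proof (cases "\<sigma> < a")
        case True
        then obtain d where "d > 0" "\<And>u. 0 \<le> u \<Longrightarrow> u < d \<Longrightarrow> \<Omega> (\<sigma> + u) = \<Omega> \<sigma> + u *\<^sub>R \<omega> \<sigma>"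
          using A' \<sigma> by (meson atLeastLessThan_iff)
        then show ?thesis using True by (intro exI[of _ "min d (a - \<sigma>)"]) (auto simp: \<Omega>'_def \<omega>'_def)
      next
        case False
        then show ?thesis by (intro exI[of _ 1]) (auto simp: \<Omega>'_def \<omega>'_def algebra_simps)
      qed
    qed
    have old: "\<tau>_inv \<sigma> < s" if "0 \<le> \<sigma>" "\<sigma> < a" for \<sigma>
      using \<tau>_inv_strict_mono[of \<sigma> a] that ab by (simp add: s_def)
    have new: "\<not> \<tau>_inv \<sigma> < s" if "a \<le> \<sigma>" "\<sigma> < b" for \<sigma>
      using \<tau>_inv_mono[of a \<sigma>] that ab by (simp add: s_def)
    show "\<forall>\<sigma>\<in>{0..<b}. dist (xb' (\<tau>_inv \<sigma>)) (x0 - H' (\<tau>_inv \<sigma>) - \<Omega>' \<sigma>) \<le> 2 * \<epsilon>"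
    proof
      fix \<sigma> assume \<sigma>: "\<sigma> \<in> {0..<b}"
      have "dist (xb' (\<tau>_inv \<sigma>)) (X \<sigma>) \<le> 2 * \<epsilon>"
      proof (cases "\<sigma> < a")
        case True
        then show ?thesis using A' \<sigma> old[of \<sigma>] X_old[of \<sigma>] by (simp add: xb'_def)
      next
        case False
        then show ?thesis using \<sigma> new[of \<sigma>] Xx(1)[of \<sigma>] by (simp add: xb'_def)
      qed
      then show "dist (xb' (\<tau>_inv \<sigma>)) (x0 - H' (\<tau>_inv \<sigma>) - \<Omega>' \<sigma>) \<le> 2 * \<epsilon>" by (simp add: X_def)
    qed
    show "\<forall>\<sigma>\<in>{0..<b}. \<exists>\<theta>\<in>{0..S}. \<bar>\<theta> - \<sigma>\<bar> \<le> \<epsilon> \<and>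
        (\<exists>p\<in>C (\<tau>_inv \<theta>). dist p (x0 - H' (\<tau>_inv \<sigma>) - \<Omega>' \<sigma>) \<le> 2 * \<epsilon> \<and>
           (\<forall>y\<in>C (\<tau>_inv \<theta>). \<omega>' \<sigma> \<bullet> (y - p) \<le> \<kappa> * (dist y p)\<^sup>2))"
      unfolding X_def[symmetric]
    proof
      fix \<sigma> assume \<sigma>: "\<sigma> \<in> {0..<b}"
      show "\<exists>\<theta>\<in>{0..S}. \<bar>\<theta> - \<sigma>\<bar> \<le> \<epsilon> \<and> (\<exists>p\<in>C (\<tau>_inv \<theta>). dist p (X \<sigma>) \<le> 2 * \<epsilon> \<and>
           (\<forall>y\<in>C (\<tau>_inv \<theta>). \<omega>' \<sigma> \<bullet> (y - p) \<le> \<kappa> * (dist y p)\<^sup>2))"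
      proof (cases "\<sigma> < a")
        case True
        then show ?thesis using A' \<sigma> X_old[of \<sigma>] by (simp add: \<omega>'_def)
      next
        case False
        then show ?thesis using \<sigma> Xx(2)[of \<sigma>] p(1) w_prox ab
          by (intro bexI[of _ b] conjI bexI[of _ p]) (auto simp: \<omega>'_def t_def)
      qed
    qed
  qed
  moreover have "1 + norm p \<le> (1 + norm x0 + L * t) * exp (2 * B t)"
  proof -
    define P where "P = 1 + norm x0"
    define D where "D = B t - B s"
    have D: "D \<ge> 0" using dB by (simp add: D_def)
    have "norm p \<le> norm x + norm (z - x) + norm (z - p)"
      by (smt (verit) norm_triangle_ineq4 norm_triangle_sub norm_minus_commute)
    then have "1 + norm p \<le> (1 + norm x) * (1 + 2 * D) + L * (t - s)"
      using zx zp(1) by (simp add: D_def algebra_simps)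
    also have "(1 + norm x) * (1 + 2 * D) \<le> (1 + norm x) * exp (2 * D)"
      by (intro mult_left_mono) (simp_all add: exp_ge_add_one_self)
    also have "(1 + norm x) * exp (2 * D) \<le> ((P + L * s) * exp (2 * B s)) * exp (2 * D)"
      using end_a(2) by (intro mult_right_mono) (auto simp: x_def s_def P_def)
    also have "\<dots> = (P + L * s) * exp (2 * B t)"
      by (simp add: D_def mult.assoc flip: exp_add)
    also have "L * (t - s) \<le> L * (t - s) * exp (2 * B t)"
      using B_nonneg[of t] st pos mult_left_mono[of 1 "exp (2 * B t)" "L * (t - s)"] by simp
    finally have "1 + norm p \<le> (P + L * s) * exp (2 * B t) + L * (t - s) * exp (2 * B t)" by simp
    then show ?thesis by (simp add: P_def algebra_simps)
  qed
  ultimately show ?thesis using p(1) Xb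
    by (intro exI[of _ xb'] exI[of _ \<omega>'] exI[of _ H'] exI[of _ \<Omega>']) (simp add: X_def t_def)
qed

lemma approximate_solution_exists:
  assumes N: "N > 0" "S / real N < \<eta>" "S / real N \<le> \<delta>0"
  shows "\<exists>xb \<omega> H \<Omega>. approximate_solution (S / real N) S xb \<omega> H \<Omega>"
proof -
  let ?h = "S / real N"
  have "\<exists>xb \<omega> H \<Omega>. approximate_solution ?h (real k * ?h) xb \<omega> H \<Omega> \<and>
     x0 - H (\<tau>_inv (real k * ?h)) - \<Omega> (real k * ?h) \<in> C (\<tau>_inv (real k * ?h)) \<and>
      1 + norm (x0 - H (\<tau>_inv (real k * ?h)) - \<Omega> (real k * ?h))
       \<le> (1 + norm x0 + L * \<tau>_inv (real k * ?h)) * exp (2 * B (\<tau>_inv (real k * ?h)))" if "k \<le> N" for k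
    using that
  proof (induction k)
    case 0
    have "1 + norm x0 \<le> M"
    proof -
      have "(1 + norm x0) * 1 \<le> (1 + norm x0 + L * T) * exp (2 * B T)"
        using pos B_nonneg[of T] by (intro mult_mono) auto
      then show ?thesis by (simp add: M_def)
    qed
    moreover have "weak_primitive 0 q (\<lambda>_. 0)" for q :: "real \<Rightarrow> 'a"
      unfolding weak_primitive_def by (auto simp: has_integral_null_eq)
    ultimately show ?case using x0
      by (intro exI[of _ "\<lambda>_. x0"] exI[of _ "\<lambda>_. 0"]) (simp add: approximate_solution_def \<tau>_inv_0 B_0)
  next
    case (Suc k)
    then obtain xb \<omega> H \<Omega> where IH: "approximate_solution ?h (real k * ?h) xb \<omega> H \<Omega>"
     "x0 - H (\<tau>_inv (real k * ?h)) - \<Omega> (real k * ?h) \<in> C (\<tau>_inv (real k * ?h))"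
      "1 + norm (x0 - H (\<tau>_inv (real k * ?h)) - \<Omega> (real k * ?h))
       \<le> (1 + norm x0 + L * \<tau>_inv (real k * ?h)) * exp (2 * B (\<tau>_inv (real k * ?h)))" by auto
    have h: "?h > 0" using N S_pos by simp
    have "real (Suc k) * ?h \<le> real N * ?h" using Suc.prems h by (intro mult_right_mono) auto
    then have le: "real (Suc k) * ?h \<le> S" using N by simp
    have e: "real (Suc k) * ?h = real k * ?h + ?h" by (simp only: of_nat_Suc distrib_right mult_1 add.commute)
    have "real k * ?h \<ge> 0" using h by (intro mult_nonneg_nonneg) auto
    then show ?case using h N le e by (intro approximate_solution_step[OF IH]) linarith+
  qed
  from this[of N] show ?thesis using N by auto
qed

end

section \<open>Almost everywhere convergent midpoints\<close>

text \<open>A convex hull of functions restricted to iterated midpoints. It suffices for the parallelogram law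
  and comes with a convenient induction principle.\<close>
inductive_set midpoint_hull :: "(real \<Rightarrow> 'a::real_vector) set \<Rightarrow> (real \<Rightarrow> 'a) set" for W where
  base: "u \<in> W \<Longrightarrow> u \<in> midpoint_hull W"
| mid: "u \<in> midpoint_hull W \<Longrightarrow> v \<in> midpoint_hull W \<Longrightarrow> (\<lambda>s. (1/2) *\<^sub>R (u s + v s)) \<in> midpoint_hull W"

lemma midpoint_hull_mono: "W \<subseteq> W' \<Longrightarrow> midpoint_hull W \<subseteq> midpoint_hull W'"
proof
  fix u assume "u \<in> midpoint_hull W" "W \<subseteq> W'"
  then show "u \<in> midpoint_hull W'" by (induction) (auto intro: midpoint_hull.intros)
qed

lemma midpoint_hull_simple:
  assumes "\<And>u. u \<in> W \<Longrightarrow> simple_function borel u" "u \<in> midpoint_hull W"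
  shows "simple_function borel u"
  using assms(2)
proof induction
  case (mid u v)
  show ?case by (rule simple_function_compose2[OF mid(3,4), of "\<lambda>a b. (1/2) *\<^sub>R (a + b)"])
qed (rule assms(1))

lemma midpoint_hull_inner_le:
  assumes "\<And>u. u \<in> W \<Longrightarrow> u s \<bullet> z \<le> c" "u \<in> midpoint_hull W"
  shows "u s \<bullet> z \<le> c"
  using assms(2)
  by induction (auto simp: inner_add_left assms(1))

lemma midpoint_hull_norm_le:
  fixes W :: "(real \<Rightarrow> 'a::real_normed_vector) set"
  assumes "\<And>u. u \<in> W \<Longrightarrow> norm (u s) \<le> c" "u \<in> midpoint_hull W"
  shows "norm (u s) \<le> c"
  using assms(2)
proof induction
  case (mid u v)
  then show ?case using norm_triangle_ineq[of "u s" "v s"] by simp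
qed (rule assms(1))

lemma midpoint_hull_primitive:
  fixes W :: "(real \<Rightarrow> 'a::real_inner) set"
  assumes "\<And>u. u \<in> W \<Longrightarrow> \<exists>U. weak_primitive T u U \<and> (\<forall>s\<in>{0..T}. dist (U s) (G s) \<le> e)" "u \<in> midpoint_hull W"
  shows "\<exists>U. weak_primitive T u U \<and> (\<forall>s\<in>{0..T}. dist (U s) (G s) \<le> e)"
  using assms(2)
proof induction
  case (mid u v)
  then obtain U V where UV: "weak_primitive T u U" "\<And>s. s \<in> {0..T} \<Longrightarrow> dist (U s) (G s) \<le> e"
    "weak_primitive T v V" "\<And>s. s \<in> {0..T} \<Longrightarrow> dist (V s) (G s) \<le> e" by blast
  let ?U = "\<lambda>s. (1/2) *\<^sub>R (U s + V s)"
  have "weak_primitive T (\<lambda>s. (1/2) *\<^sub>R (u s + v s)) ?U"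
    unfolding weak_primitive_def
  proof (intro allI impI)
    fix \<zeta> a b assume ab: "0 \<le> a" "a \<le> b" "b \<le> T"
    have "((\<lambda>s. (1/2) * (u s \<bullet> \<zeta> + v s \<bullet> \<zeta>)) has_integral (1/2) * ((U b - U a) \<bullet> \<zeta> + (V b - V a) \<bullet> \<zeta>)) {a..b}"
      by (intro has_integral_mult_right has_integral_add weak_primitiveD[OF UV(1) ab] weak_primitiveD[OF UV(3) ab])
    then show "((\<lambda>s. ((1/2) *\<^sub>R (u s + v s)) \<bullet> \<zeta>) has_integral (?U b - ?U a) \<bullet> \<zeta>) {a..b}"
      by (simp add: inner_add_left inner_diff_left algebra_simps)
  qed
  moreover have "dist (?U s) (G s) \<le> e" if "s \<in> {0..T}" for s
  proof -
    have "?U s - G s = (1/2) *\<^sub>R ((U s - G s) + (V s - G s))"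
      by (simp add: algebra_simps flip: scaleR_add_left)
    then have "dist (?U s) (G s) \<le> (norm (U s - G s) + norm (V s - G s)) / 2"
      using norm_triangle_ineq[of "U s - G s" "V s - G s"] by (simp add: dist_norm)
    then show ?thesis using UV(2,4)[OF that] by (simp add: dist_norm)
  qed
  ultimately show ?case by blast
qed (rule assms(1))

lemma simple_function_integrable_on:
  fixes f :: "real \<Rightarrow> real"
  assumes "simple_function borel f"
  shows "f integrable_on {a..b}"
proof -
  have "finite (range f)" using simple_functionD(1)[OF assms] by simp
  then have fin: "finite (range (\<lambda>x. \<bar>f x\<bar>))" by (metis finite_imageI image_image)
  show ?thesis
  proof (rule measurable_bounded_by_integrable_imp_integrable)
    have "f \<in> borel_measurable borel" using assms by (rule borel_measurable_simple_function)
    then show "f \<in> borel_measurable (lebesgue_on {a..b})"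
      by (simp add: borel_measurable_if_D measurable_completion measurable_restrict_space1)
    show "norm (f s) \<le> Max (range (\<lambda>x. \<bar>f x\<bar>))" for s using fin by simp
  qed auto
qed

text \<open>Monotone convergence applied to the series of the functions.\<close>
lemma ae_summable_of_summable_integrals:
  fixes f :: "nat \<Rightarrow> real \<Rightarrow> real"
  assumes f: "\<And>k. simple_function borel (f k)" "\<And>k s. 0 \<le> f k s"
    and c: "\<And>k. integral {a..b} (f k) \<le> c k" "summable c"
  shows "\<exists>N. negligible N \<and> (\<forall>s\<in>{a..b} - N. summable (\<lambda>k. f k s))"
proof -
  let ?M = "lebesgue_on {a..b}"
  have int: "integrable ?M (f k)" for k
  proof (rule absolutely_integrable_imp_integrable)
    show "f k absolutely_integrable_on {a..b}"
      using simple_function_integrable_on[OF f(1)] f(2) by (intro nonnegative_absolutely_integrable_1) auto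
  qed simp
  then have [measurable]: "f k \<in> borel_measurable ?M" for k by (rule borel_measurable_integrable)
  have c0: "c k \<ge> 0" for k
  proof -
    have "0 \<le> integral {a..b} (f k)"
      by (rule integral_nonneg[OF simple_function_integrable_on[OF f(1)]]) (rule f(2))
    then show ?thesis using c(1)[of k] by (rule order_trans)
  qed
  have "(\<integral>\<^sup>+ s. (\<Sum>k. ennreal (f k s)) \<partial>?M) = (\<Sum>k. \<integral>\<^sup>+ s. ennreal (f k s) \<partial>?M)"
    by (rule nn_integral_suminf) simp
  also have "\<dots> \<le> (\<Sum>k. ennreal (c k))"
  proof (rule suminf_le)
    show "(\<integral>\<^sup>+ s. ennreal (f k s) \<partial>?M) \<le> ennreal (c k)" for k
    proof -
      have "(\<integral>\<^sup>+ s. ennreal (f k s) \<partial>?M) = ennreal (integral\<^sup>L ?M (f k))"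
        using int f(2) by (intro nn_integral_eq_integral) auto
      also have "integral\<^sup>L ?M (f k) = integral {a..b} (f k)" by (rule lebesgue_integral_eq_integral[OF int]) simp
      finally show ?thesis using c(1)[of k] by (simp add: ennreal_leI)
    qed
  qed auto
  also have "\<dots> = ennreal (\<Sum>k. c k)" using c0 c(2) by (intro suminf_ennreal2) auto
  finally have "(\<integral>\<^sup>+ s. (\<Sum>k. ennreal (f k s)) \<partial>?M) \<noteq> \<infinity>"
    by (metis ennreal_neq_top infinity_ennreal_def top.extremum_unique)
  then have "AE s in ?M. (\<Sum>k. ennreal (f k s)) \<noteq> \<infinity>"
    by (intro nn_integral_noteq_infinite) simp_all
  then have "AE s in lebesgue. s \<in> {a..b} \<longrightarrow> (\<Sum>k. ennreal (f k s)) \<noteq> \<infinity>"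
    by (subst (asm) AE_restrict_space_iff) auto
  then obtain N where N: "\<And>s. s \<in> space lebesgue - N \<Longrightarrow> s \<in> {a..b} \<longrightarrow> (\<Sum>k. ennreal (f k s)) \<noteq> \<infinity>"
    "N \<in> null_sets lebesgue" by (rule AE_E3) blast
  have "summable (\<lambda>k. f k s)" if "s \<in> {a..b} - N" for s
  proof (rule summable_suminf_not_top)
    have "s \<in> space lebesgue - N" "s \<in> {a..b}" using that by auto
    then have "(\<Sum>k. ennreal (f k s)) \<noteq> \<infinity>" using N(1) by blast
    then show "(\<Sum>k. ennreal (f k s)) \<noteq> top" unfolding infinity_ennreal_def .
  qed (rule f(2))
  then show ?thesis using N(2) unfolding negligible_iff_null_sets[symmetric] by blast
qed

text \<open>Choose \<open>v n\<close> in the midpoint hull of the \<open>n\<close>-th tail with nearly minimal energy \<open>E\<close>. The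
  midpoint of \<open>v n\<close> and \<open>v m\<close> is again a competitor for the smaller index, so the parallelogram law makes
  the sequence Cauchy in the mean square. A fast subsequence converges almost everywhere.\<close>
lemma midpoint_hull_ae_convergent:
  fixes \<omega> :: "nat \<Rightarrow> real \<Rightarrow> 'a::{real_inner, complete_space}"
  assumes simple: "\<And>n. simple_function borel (\<omega> n)" and bd: "\<And>n s. norm (\<omega> n s) \<le> 1" and S: "S \<ge> 0"
  shows "\<exists>v N. (\<forall>k. v k \<in> midpoint_hull (\<omega> ` {k..})) \<and> negligible N \<and> (\<forall>s\<in>{0..S} - N. convergent (\<lambda>k. v k s))"
proof -
  define W where "W n = midpoint_hull (\<omega> ` {n..})" for n
  have W_mono: "W m \<subseteq> W n" if "n \<le> m" for n m
    unfolding W_def using that by (intro midpoint_hull_mono) auto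
  have W_simple: "simple_function borel u" if "u \<in> W n" for u n
    by (rule midpoint_hull_simple[OF _ that[unfolded W_def]]) (use simple in auto)
  have W_bd: "norm (u s) \<le> 1" if "u \<in> W n" for u n s
    by (rule midpoint_hull_norm_le[OF _ that[unfolded W_def]]) (use bd in auto)
  define E where "E u = integral {0..S} (\<lambda>s. (norm (u s :: 'a))\<^sup>2)" for u
  have int2: "(\<lambda>s. h (u s) (v s)) integrable_on {0..S}" if "u \<in> W n" "v \<in> W m" for u v n m and h :: "'a \<Rightarrow> 'a \<Rightarrow> real"
    by (rule simple_function_integrable_on, rule simple_function_compose2[where h = h],
        rule W_simple[OF that(1)], rule W_simple[OF that(2)])
  have E0: "E u \<ge> 0" if "u \<in> W n" for u n
    unfolding E_def by (rule integral_nonneg[OF int2[OF that that, of "\<lambda>a b. (norm a)\<^sup>2"]]) simp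
  have E1: "E u \<le> S" if "u \<in> W n" for u n
  proof -
    have "E u \<le> integral {0..S} (\<lambda>_. 1::real)" unfolding E_def
      by (rule integral_le[OF int2[OF that that, of "\<lambda>a b. (norm a)\<^sup>2"]])
         (use W_bd[OF that] in \<open>auto simp: power_le_one\<close>)
    then show ?thesis using S by simp
  qed
  have W_ne: "\<omega> n \<in> W n" for n unfolding W_def by (auto intro: midpoint_hull.base)
  have bdd: "bdd_below (E ` W n)" for n using E0 by (intro bdd_belowI2[of _ 0])
  define d where "d n = Inf (E ` W n)" for n
  have d_le: "d n \<le> E u" if "u \<in> W n" for n u
    unfolding d_def using bdd that by (auto intro: cInf_lower)
  have "\<exists>u\<in>W n. E u < d n + inverse (real (Suc n))" for n
  proof -
    have "Inf (E ` W n) < d n + inverse (real (Suc n))" by (simp add: d_def)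
    moreover have "E ` W n \<noteq> {}" using W_ne by blast
    ultimately show ?thesis using bdd[of n] by (subst (asm) cInf_less_iff) auto
  qed
  then obtain v where v: "\<And>n. v n \<in> W n" "\<And>n. E (v n) < d n + inverse (real (Suc n))" by metis
  have d_mono: "d n \<le> d m" if "n \<le> m" for n m
    unfolding d_def using W_mono[OF that] W_ne[of m] bdd[of n] by (intro cInf_superset_mono) auto
  have d_bd: "d n \<le> S" for n using d_le[OF W_ne] E1[OF W_ne] order_trans by blast
  have dist2: "integral {0..S} (\<lambda>s. (norm (v n s - v m s))\<^sup>2) \<le> 2 * (d m - d n) + 4 * inverse (real (Suc n))"
    if nm: "n \<le> m" for n m
  proof -
    have vm: "v m \<in> W n" using v(1) W_mono[OF nm] by blast
    have mid: "(\<lambda>s. (1/2) *\<^sub>R (v n s + v m s)) \<in> W n"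
      using v(1)[of n] vm unfolding W_def by (rule midpoint_hull.mid)
    have i: "(\<lambda>s. (norm (v n s))\<^sup>2) integrable_on {0..S}" "(\<lambda>s. (norm (v m s))\<^sup>2) integrable_on {0..S}"
      "(\<lambda>s. (norm ((1/2) *\<^sub>R (v n s + v m s)))\<^sup>2) integrable_on {0..S}"
      using int2[OF v(1)[of n] v(1)[of m], of "\<lambda>a b. (norm a)\<^sup>2"] int2[OF v(1)[of n] v(1)[of m], of "\<lambda>a b. (norm b)\<^sup>2"]
        int2[OF v(1)[of n] v(1)[of m], of "\<lambda>a b. (norm ((1/2) *\<^sub>R (a + b)))\<^sup>2"] by simp_all
    have "(norm (v n s - v m s))\<^sup>2 = 2 * (norm (v n s))\<^sup>2 + 2 * (norm (v m s))\<^sup>2 - 4 * (norm ((1/2) *\<^sub>R (v n s + v m s)))\<^sup>2" for s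
      by (simp add: power2_norm_eq_inner inner_commute algebra_simps)
    then have "((\<lambda>s. (norm (v n s - v m s))\<^sup>2) has_integral
        (2 * E (v n) + 2 * E (v m) - 4 * E (\<lambda>s. (1/2) *\<^sub>R (v n s + v m s)))) {0..S}"
      unfolding E_def
      by (simp only:) (intro has_integral_diff has_integral_add has_integral_mult_right integrable_integral i)
    then have "integral {0..S} (\<lambda>s. (norm (v n s - v m s))\<^sup>2) = 2 * E (v n) + 2 * E (v m) - 4 * E (\<lambda>s. (1/2) *\<^sub>R (v n s + v m s))"
      by (rule integral_unique)
    moreover have "E (\<lambda>s. (1/2) *\<^sub>R (v n s + v m s)) \<ge> d n" using d_le[OF mid] .
    moreover have "inverse (real (Suc m)) \<le> inverse (real (Suc n))" using nm by simp
    ultimately show ?thesis using v(2)[of n] v(2)[of m] by argo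
  qed
  have "norm (d n) \<le> \<bar>d 0\<bar> + \<bar>S\<bar>" for n
    using d_mono[of 0 n] d_bd[of n] by auto
  then have "Bseq d" by (rule BseqI')
  then have "convergent d" using d_mono by (intro Bseq_mono_convergent) auto
  then have "Cauchy d" by (rule convergent_Cauchy)
  have "\<exists>N. \<forall>n\<ge>N. \<forall>m\<ge>n. integral {0..S} (\<lambda>s. (norm (v n s - v m s))\<^sup>2) \<le> e" if e: "e > 0" for e
  proof -
    obtain N1 where N1: "\<And>m n. m \<ge> N1 \<Longrightarrow> n \<ge> N1 \<Longrightarrow> \<bar>d m - d n\<bar> < e / 4"
      using \<open>Cauchy d\<close> e unfolding Cauchy_def dist_real_def by (metis divide_pos_pos zero_less_numeral)
    obtain N2 where N2: "inverse (real (Suc N2)) < e / 8" using e reals_Archimedean[of "e / 8"] by auto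
    have "integral {0..S} (\<lambda>s. (norm (v n s - v m s))\<^sup>2) \<le> e" if "n \<ge> max N1 N2" "m \<ge> n" for n m
    proof -
      have "inverse (real (Suc n)) \<le> inverse (real (Suc N2))" using that by simp
      moreover have "\<bar>d m - d n\<bar> < e / 4" using that by (intro N1) auto
      then have "d m - d n < e / 4" by linarith
      ultimately show ?thesis using dist2[OF that(2)] N2 by argo
    qed
    then show ?thesis by blast
  qed
  then have "\<forall>k. \<exists>N. \<forall>n\<ge>N. \<forall>m\<ge>n. integral {0..S} (\<lambda>s. (norm (v n s - v m s))\<^sup>2) \<le> (1/4) ^ k" by simp
  then obtain R where R: "\<And>k n m. n \<ge> R k \<Longrightarrow> m \<ge> n \<Longrightarrow> integral {0..S} (\<lambda>s. (norm (v n s - v m s))\<^sup>2) \<le> (1/4) ^ k"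
    by metis
  \<comment> \<open>A nondecreasing choice of indices that dominates both \<open>R k\<close> and \<open>k\<close>.\<close>
  define r where "r k = k + (\<Sum>j\<le>k. R j)" for k
  have r: "r k \<ge> R k" "r k \<ge> k" "r k \<le> r (Suc k)" for k
    unfolding r_def by (auto intro: le_add2 order_trans[OF member_le_sum[of k "{..k}" R]])
  define f where "f k s = norm (v (r k) s - v (r (Suc k)) s)" for k s
  have "integral {0..S} (f k) \<le> (S + 1) / 2 * (1/2) ^ k" for k
  proof -
    have i1: "f k integrable_on {0..S}" "(\<lambda>s. (f k s)\<^sup>2) integrable_on {0..S}"
      unfolding f_def
      by (rule int2[OF v(1) v(1), of "\<lambda>a b. norm (a - b)"], rule int2[OF v(1) v(1), of "\<lambda>a b. (norm (a - b))\<^sup>2"])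
    \<comment> \<open>Pass from the mean square to the mean by the weighted inequality between arithmetic and geometric means.\<close>
    have "integral {0..S} (f k) \<le> integral {0..S} (\<lambda>s. (1/2) ^ k / 2 + 2 ^ k / 2 * (f k s)\<^sup>2)"
    proof (rule integral_le[OF i1(1)])
      show "(\<lambda>s. (1/2) ^ k / 2 + 2 ^ k / 2 * (f k s)\<^sup>2) integrable_on {0..S}"
        by (intro integrable_add integrable_on_mult_right i1 integrable_const_ivl)
      fix s
      have square: "A * (x - b)\<^sup>2 / 2 = A / 2 * x\<^sup>2 - (A * b) * x + (A * b) * b / 2" for A b x :: real
        by (simp add: power2_diff power2_eq_square field_simps)
      have "0 \<le> 2 ^ k * (f k s - (1/2) ^ k)\<^sup>2 / 2" by simp
      also note square
      also have "2 ^ k * (1/2) ^ k = (1::real)" by (simp flip: power_mult_distrib)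
      finally show "f k s \<le> (1/2) ^ k / 2 + 2 ^ k / 2 * (f k s)\<^sup>2" by simp
    qed
    also have "\<dots> = S * ((1/2) ^ k / 2) + 2 ^ k / 2 * integral {0..S} (\<lambda>s. (f k s)\<^sup>2)"
      using S i1 by (subst integral_add) (auto intro: integrable_on_mult_right)
    also have "\<dots> \<le> S * ((1/2) ^ k / 2) + 2 ^ k / 2 * (1/4) ^ k"
      using R[OF r(1) r(3), of k] unfolding f_def by (intro add_left_mono mult_left_mono) auto
    also have "2 ^ k * (1/4) ^ k = ((1/2) ^ k :: real)" by (simp flip: power_mult_distrib)
    then have "S * ((1/2) ^ k / 2) + 2 ^ k / 2 * (1/4) ^ k = (S + 1) / 2 * (1/2 :: real) ^ k" by (simp add: field_simps)
    finally show ?thesis .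
  qed
  moreover have "simple_function borel (f k)" for k
    unfolding f_def
    by (rule simple_function_compose2[where h = "\<lambda>a b. norm (a - b)"]) (rule W_simple[OF v(1)])+
  moreover have "summable (\<lambda>k. (S + 1) / 2 * (1/2 :: real) ^ k)" by (intro summable_mult summable_geometric) simp
  ultimately obtain N where N: "negligible N" "\<And>s. s \<in> {0..S} - N \<Longrightarrow> summable (\<lambda>k. f k s)"
    using ae_summable_of_summable_integrals[of f 0 S "\<lambda>k. (S + 1) / 2 * (1/2) ^ k"] by (auto simp: f_def)
  have "convergent (\<lambda>k. v (r k) s)" if s: "s \<in> {0..S} - N" for s
  proof (rule Cauchy_convergent)
    show "Cauchy (\<lambda>k. v (r k) s)"
    proof (rule metric_CauchyI)
      fix e :: real assume e: "e > 0"
      obtain n0 where n0: "\<And>m n. m \<ge> n0 \<Longrightarrow> norm (\<Sum>k=m..<n. f k s) < e"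
        using N(2)[OF s] e unfolding summable_Cauchy by blast
      have tele: "norm (v (r m) s - v (r n) s) \<le> (\<Sum>k=m..<n. f k s)" if "m \<le> n" for m n
        using that
      proof (induction n rule: dec_induct)
        case (step n)
        have "norm (v (r m) s - v (r (Suc n)) s) \<le> norm (v (r m) s - v (r n) s) + f n s"
          unfolding f_def using norm_triangle_ineq[of "v (r m) s - v (r n) s" "v (r n) s - v (r (Suc n)) s"] by simp
        then show ?case using step by simp
      qed simp
      have "dist (v (r m) s) (v (r n) s) < e" if "m \<ge> n0" "n \<ge> n0" for m n
      proof (cases "m \<le> n")
        case True
        then show ?thesis using tele[OF True] n0[OF that(1), of n] by (simp add: dist_norm)
      next
        case False
        then show ?thesis using tele[of n m] n0[OF that(2), of m] by (simp add: dist_norm norm_minus_commute)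
      qed
      then show "\<exists>M. \<forall>m\<ge>M. \<forall>n\<ge>M. dist (v (r m) s) (v (r n) s) < e" by blast
    qed
  qed
  moreover have "v (r k) \<in> midpoint_hull (\<omega> ` {k..})" for k
    using v(1)[of "r k"] W_mono[OF r(2)[of k]] unfolding W_def by blast
  ultimately show ?thesis using N(1) by (intro exI[of _ "\<lambda>k. v (r k)"] exI[of _ N]) auto
qed

section \<open>Passage to the limit\<close>

lemma weak_primitive_lipschitz:
  assumes G: "weak_primitive T q G" and bd: "\<And>s. norm (q s) \<le> 1" and st: "0 \<le> s" "s \<le> t" "t \<le> T"
  shows "norm (G t - G s) \<le> t - s"
proof -
  have "norm (G t - G s - (t - s) *\<^sub>R 0) \<le> integral {s..t} (\<lambda>_. 1)"
    using bd by (intro weak_primitive_increment_bound[OF G st]) (auto intro: integrable_const_ivl)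
  then show ?thesis using st by simp
qed

lemma weak_primitive_continuous_on:
  assumes G: "weak_primitive T q G" and bd: "\<And>s. norm (q s) \<le> 1"
  shows "continuous_on {0..T} G"
proof (rule lipschitz_on_continuous_on[of 1])
  show "1-lipschitz_on {0..T} G"
  proof (rule lipschitz_onI)
    fix s t assume "s \<in> {0..T}" "t \<in> {0..T}"
    then show "dist (G s) (G t) \<le> 1 * dist s t"
      using weak_primitive_lipschitz[OF G bd, of s t] weak_primitive_lipschitz[OF G bd, of t s]
      by (cases "s \<le> t") (auto simp: dist_norm norm_minus_commute)
  qed simp
qed

context sweeping_process
begin

text \<open>Compare the second approximate solution with a point of the set to which the first one was
  projected; the errors are bounded by the mesh sizes because the sets move with speed at most one.\<close>
lemma approximate_solution_prox:
  assumes A1: "approximate_solution \<epsilon>1 S xb1 \<omega>1 H1 \<Omega>1" and A2: "approximate_solution \<epsilon>2 S xb2 \<omega>2 H2 \<Omega>2"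
    and \<epsilon>: "0 \<le> \<epsilon>1" "0 \<le> \<epsilon>2" "\<epsilon>1 + \<epsilon>2 \<le> \<delta>0" and \<sigma>: "\<sigma> \<in> {0..<S}"
    and X: "X1 = x0 - H1 (\<tau>_inv \<sigma>) - \<Omega>1 \<sigma>" "X2 = x0 - H2 (\<tau>_inv \<sigma>) - \<Omega>2 \<sigma>"
  shows "\<omega>1 \<sigma> \<bullet> (X2 - X1) \<le> 2 * \<kappa> * (norm (X2 - X1))\<^sup>2 + 18 * \<kappa> * (\<epsilon>1 + \<epsilon>2)\<^sup>2 + 3 * (\<epsilon>1 + \<epsilon>2)"
proof -
  obtain \<theta>1 p1 where 1: "\<theta>1 \<in> {0..S}" "\<bar>\<theta>1 - \<sigma>\<bar> \<le> \<epsilon>1" "p1 \<in> C (\<tau>_inv \<theta>1)" "dist p1 X1 \<le> 2 * \<epsilon>1"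
    "\<And>y. y \<in> C (\<tau>_inv \<theta>1) \<Longrightarrow> \<omega>1 \<sigma> \<bullet> (y - p1) \<le> \<kappa> * (dist y p1)\<^sup>2"
    using A1 \<sigma> unfolding approximate_solution_def X by meson
  obtain \<theta>2 p2 where 2: "\<theta>2 \<in> {0..S}" "\<bar>\<theta>2 - \<sigma>\<bar> \<le> \<epsilon>2" "p2 \<in> C (\<tau>_inv \<theta>2)" "dist p2 X2 \<le> 2 * \<epsilon>2"
    using A2 \<sigma> unfolding approximate_solution_def X by meson
  have w: "norm (\<omega>1 \<sigma>) \<le> 1" using A1 unfolding approximate_solution_def by blast
  have \<theta>: "\<bar>\<theta>1 - \<theta>2\<bar> \<le> \<epsilon>1 + \<epsilon>2" using 1(2) 2(2) by linarith
  then obtain y where y: "y \<in> C (\<tau>_inv \<theta>1)" "dist p2 y \<le> \<bar>\<theta>1 - \<theta>2\<bar>"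
    using move_\<sigma>[OF 2(1) 1(1) _ 2(3)] \<epsilon> by auto
  define Y where "Y = X2 - X1"
  define d where "d = (y - p1) - Y"
  have d_eq: "d = (y - p2) + (p2 - X2) - (p1 - X1)" by (simp add: d_def Y_def)
  have "norm d \<le> norm (y - p2) + norm (p2 - X2) + norm (p1 - X1)"
    using norm_triangle_ineq4[of "(y - p2) + (p2 - X2)" "p1 - X1"] norm_triangle_ineq[of "y - p2" "p2 - X2"]
    unfolding d_eq by argo
  then have nd: "norm d \<le> 3 * (\<epsilon>1 + \<epsilon>2)" using y(2) 1(4) 2(4) \<theta> by (simp add: dist_norm norm_minus_commute)
  have "\<omega>1 \<sigma> \<bullet> (Y + d) \<le> \<kappa> * (norm (Y + d))\<^sup>2" using 1(5)[OF y(1)] by (simp add: d_def dist_norm)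
  moreover have "\<kappa> * (norm (Y + d))\<^sup>2 \<le> \<kappa> * (2 * (norm Y)\<^sup>2 + 2 * (3 * (\<epsilon>1 + \<epsilon>2))\<^sup>2)"
  proof (rule mult_left_mono)
    have "(norm (Y + d))\<^sup>2 + (norm (Y - d))\<^sup>2 = 2 * (norm Y)\<^sup>2 + 2 * (norm d)\<^sup>2"
      by (simp add: power2_norm_eq_inner algebra_simps inner_commute)
    moreover have "(norm (Y - d))\<^sup>2 \<ge> 0" by simp
    moreover have "(norm d)\<^sup>2 \<le> (3 * (\<epsilon>1 + \<epsilon>2))\<^sup>2" using nd by (intro power_mono) auto
    ultimately show "(norm (Y + d))\<^sup>2 \<le> 2 * (norm Y)\<^sup>2 + 2 * (3 * (\<epsilon>1 + \<epsilon>2))\<^sup>2" by argo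
  qed (use pos in simp)
  moreover have "- (\<omega>1 \<sigma> \<bullet> d) \<le> norm d"
  proof -
    have "\<bar>\<omega>1 \<sigma> \<bullet> d\<bar> \<le> norm (\<omega>1 \<sigma>) * norm d" by (rule Cauchy_Schwarz_ineq2)
    also have "\<dots> \<le> 1 * norm d" using w by (intro mult_right_mono) auto
    finally show ?thesis by linarith
  qed
  ultimately have "\<omega>1 \<sigma> \<bullet> Y \<le> \<kappa> * (2 * (norm Y)\<^sup>2 + 2 * (3 * (\<epsilon>1 + \<epsilon>2))\<^sup>2) + 3 * (\<epsilon>1 + \<epsilon>2)"
    using nd unfolding inner_add_right by linarith
  moreover have "(3 * (\<epsilon>1 + \<epsilon>2))\<^sup>2 = 9 * (\<epsilon>1 + \<epsilon>2)\<^sup>2" by (simp only: power_mult_distrib) simp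
  ultimately have "\<omega>1 \<sigma> \<bullet> Y \<le> \<kappa> * (2 * (norm Y)\<^sup>2 + 2 * (9 * (\<epsilon>1 + \<epsilon>2)\<^sup>2)) + 3 * (\<epsilon>1 + \<epsilon>2)" by simp
  then show ?thesis unfolding Y_def[symmetric] by (simp add: algebra_simps)
qed

text \<open>With \<open>A = \<Omega>1 - \<Omega>2\<close> and \<open>E\<close> the difference of the perturbation parts, adding the prox
  inequalities of both solutions bounds \<open>A \<bullet> (\<omega>1 - \<omega>2)\<close> by a multiple of \<open>|A|\<^sup>2\<close> plus an
  error, and this scalar product is half the right derivative of \<open>|A|\<^sup>2\<close>.\<close>
lemma approximate_solution_compare:
  assumes A1: "approximate_solution \<epsilon>1 S xb1 \<omega>1 H1 \<Omega>1" and A2: "approximate_solution \<epsilon>2 S xb2 \<omega>2 H2 \<Omega>2"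
    and \<epsilon>: "0 \<le> \<epsilon>1" "0 \<le> \<epsilon>2" "\<epsilon>1 + \<epsilon>2 \<le> \<delta>0" "\<epsilon>1 + \<epsilon>2 \<le> 1"
    and e: "\<And>\<sigma>. \<sigma> \<in> {0..S} \<Longrightarrow> dist (H1 (\<tau>_inv \<sigma>)) (H2 (\<tau>_inv \<sigma>)) \<le> e" "0 \<le> e" "e \<le> 1"
    and \<sigma>: "\<sigma> \<in> {0..S}"
  shows "(dist (\<Omega>1 \<sigma>) (\<Omega>2 \<sigma>))\<^sup>2 \<le> (72 * \<kappa> + 12) * (e + (\<epsilon>1 + \<epsilon>2)) * exp ((16 * \<kappa> + 1) * S)"
proof -
  define s where "s = \<epsilon>1 + \<epsilon>2"
  define k where "k = 16 * \<kappa> + 1"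
  \<comment> \<open>The errors of the two prox inequalities, collected; \<open>e \<le> 1\<close> and \<open>s \<le> 1\<close> turn squares into first powers.\<close>
  define c where "c = (72 * \<kappa> + 12) * (e + s)"
  have k: "k \<ge> 1" using pos by (simp add: k_def)
  have s: "0 \<le> s" "s \<le> 1" using \<epsilon> by (auto simp: s_def)
  have c: "c \<ge> 0" using e s pos by (simp add: c_def)
  define A where "A \<sigma> = \<Omega>1 \<sigma> - \<Omega>2 \<sigma>" for \<sigma>
  define \<phi> where "\<phi> \<sigma> = A \<sigma> \<bullet> A \<sigma>" for \<sigma>
  have prim: "weak_primitive S \<omega>1 \<Omega>1" "weak_primitive S \<omega>2 \<Omega>2" "\<And>\<sigma>. norm (\<omega>1 \<sigma>) \<le> 1" "\<And>\<sigma>. norm (\<omega>2 \<sigma>) \<le> 1"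
    "\<Omega>1 0 = 0" "\<Omega>2 0 = 0"
    using A1 A2 unfolding approximate_solution_def by auto
  have contA: "continuous_on {0..S} A"
    unfolding A_def using prim by (intro continuous_intros weak_primitive_continuous_on)
  have "\<phi> \<sigma> + c / k \<le> (\<phi> 0 + c / k) * exp (k * \<sigma>)"
  proof (rule gronwall_right_derivative[where \<phi>' = "\<lambda>\<sigma>. 2 * (A \<sigma> \<bullet> (\<omega>1 \<sigma> - \<omega>2 \<sigma>))"])
    show "0 \<le> \<sigma>" "k > 0" using \<sigma> k by auto
    have "continuous_on {0..\<sigma>} A" using contA by (rule continuous_on_subset) (use \<sigma> in auto)
    then show "continuous_on {0..\<sigma>} \<phi>" unfolding \<phi>_def by (intro continuous_intros)
    fix u assume "0 \<le> u" "u < \<sigma>"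
    then have u: "u \<in> {0..<S}" "u \<in> {0..S}" using \<sigma> by auto
    let ?a = "\<omega>1 u - \<omega>2 u"
    obtain d1 where d1: "d1 > 0" "\<And>v. 0 \<le> v \<Longrightarrow> v < d1 \<Longrightarrow> \<Omega>1 (u + v) = \<Omega>1 u + v *\<^sub>R \<omega>1 u"
      using A1 u(1) unfolding approximate_solution_def by meson
    obtain d2 where d2: "d2 > 0" "\<And>v. 0 \<le> v \<Longrightarrow> v < d2 \<Longrightarrow> \<Omega>2 (u + v) = \<Omega>2 u + v *\<^sub>R \<omega>2 u"
      using A2 u(1) unfolding approximate_solution_def by meson
    have "((\<lambda>v. A u + (v - u) *\<^sub>R ?a) has_derivative (\<lambda>h. h *\<^sub>R ?a)) (at u within {u..})"
      by (auto intro!: derivative_eq_intros)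
    then have "(A has_derivative (\<lambda>h. h *\<^sub>R ?a)) (at u within {u..})"
    proof (rule has_derivative_transform_within)
      show "0 < min d1 d2" "u \<in> {u..}" using d1 d2 by auto
      fix v assume "v \<in> {u..}" "dist v u < min d1 d2"
      then show "A u + (v - u) *\<^sub>R ?a = A v"
        using d1(2)[of "v - u"] d2(2)[of "v - u"] by (simp add: A_def dist_real_def scaleR_diff_right)
    qed
    from has_derivative_inner[OF this this]
    show "(\<phi> has_real_derivative 2 * (A u \<bullet> ?a)) (at u within {u..})"
      unfolding \<phi>_def has_field_derivative_def
      by (rule has_derivative_eq_rhs) (auto simp: inner_commute)
    define E where "E = H1 (\<tau>_inv u) - H2 (\<tau>_inv u)"
    define X1 where "X1 = x0 - H1 (\<tau>_inv u) - \<Omega>1 u"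
    define X2 where "X2 = x0 - H2 (\<tau>_inv u) - \<Omega>2 u"
    have nE: "norm E \<le> e" using e(1)[OF u(2)] by (simp add: E_def dist_norm)
    define R where "R = 2 * \<kappa> * (norm (E + A u))\<^sup>2 + 18 * \<kappa> * s\<^sup>2 + 3 * s"
    have Y: "X2 - X1 = E + A u" "X1 - X2 = - (E + A u)" by (simp_all add: X1_def X2_def E_def A_def)
    have p1: "\<omega>1 u \<bullet> (E + A u) \<le> R"
      using approximate_solution_prox[OF A1 A2 \<epsilon>(1-3) u(1) X1_def X2_def] unfolding Y R_def s_def .
    have p2: "\<omega>2 u \<bullet> (- (E + A u)) \<le> R"
      using approximate_solution_prox[OF A2 A1 \<epsilon>(2,1) _ u(1) X2_def X1_def] \<epsilon>(3) unfolding Y R_def s_def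
      by (simp add: add.commute norm_minus_commute)
    have "?a \<bullet> (E + A u) \<le> 2 * R" using p1 p2 unfolding inner_diff_left inner_minus_right by linarith
    moreover have "- (?a \<bullet> E) \<le> 2 * e"
    proof -
      have "norm ?a \<le> 2" using norm_triangle_ineq4[of "\<omega>1 u" "\<omega>2 u"] prim(3)[of u] prim(4)[of u] by linarith
      then have "norm ?a * norm E \<le> 2 * e" using nE by (intro mult_mono) auto
      then show ?thesis using Cauchy_Schwarz_ineq2[of ?a E] by linarith
    qed
    ultimately have a1: "A u \<bullet> ?a \<le> 2 * R + 2 * e" by (simp add: inner_add_right inner_commute[of "A u"])
    have "(norm (E + A u))\<^sup>2 \<le> 2 * e + 2 * \<phi> u"
    proof -
      have "(norm (E + A u))\<^sup>2 + (norm (E - A u))\<^sup>2 = 2 * (norm E)\<^sup>2 + 2 * \<phi> u"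
        by (simp add: \<phi>_def power2_norm_eq_inner algebra_simps inner_commute)
      moreover have "(norm (E - A u))\<^sup>2 \<ge> 0" by simp
      moreover have "(norm E)\<^sup>2 \<le> e"
      proof -
        have "(norm E)\<^sup>2 \<le> e * e" unfolding power2_eq_square using nE e by (intro mult_mono) auto
        also have "\<dots> \<le> e * 1" using e by (intro mult_left_mono) auto
        finally show ?thesis by simp
      qed
      ultimately show ?thesis by argo
    qed
    then have "2 * \<kappa> * (norm (E + A u))\<^sup>2 \<le> 2 * \<kappa> * (2 * e + 2 * \<phi> u)" using pos by (intro mult_left_mono) auto
    moreover have "18 * \<kappa> * s\<^sup>2 \<le> 18 * \<kappa> * s"
      using s pos by (intro mult_left_mono) (auto simp: power2_eq_square mult_left_le)
    ultimately have "R \<le> 2 * \<kappa> * (2 * e + 2 * \<phi> u) + 18 * \<kappa> * s + 3 * s" by (simp add: R_def)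
    with a1 have "2 * (A u \<bullet> ?a) \<le> 4 * (2 * \<kappa> * (2 * e + 2 * \<phi> u) + 18 * \<kappa> * s + 3 * s) + 4 * e" by argo
    also have "\<dots> = 16 * \<kappa> * \<phi> u + (16 * \<kappa> * e + 4 * e + (72 * \<kappa> + 12) * s)" by (simp add: algebra_simps)
    also have "\<dots> \<le> k * \<phi> u + c"
    proof -
      have "(16 * \<kappa> + 4) * e \<le> (72 * \<kappa> + 12) * e" using pos e by (intro mult_right_mono) auto
      moreover have "\<phi> u \<ge> 0" by (simp add: \<phi>_def)
      ultimately show ?thesis by (simp add: k_def c_def algebra_simps)
    qed
    finally show "2 * (A u \<bullet> ?a) \<le> k * \<phi> u + c" .
  qed
  moreover have "\<phi> 0 = 0" using prim by (simp add: \<phi>_def A_def)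
  moreover have "c / k \<ge> 0" using c k by simp
  ultimately have "\<phi> \<sigma> \<le> c / k * exp (k * \<sigma>)" by simp
  also have "\<dots> \<le> c * exp (k * S)"
  proof (rule mult_mono)
    show "c / k \<le> c" using c k by (simp add: divide_le_eq mult_le_cancel_left1)
    show "exp (k * \<sigma>) \<le> exp (k * S)" using \<sigma> k by simp
  qed (use c in auto)
  finally show ?thesis by (simp add: \<phi>_def A_def c_def k_def s_def dist_norm power2_norm_eq_inner)
qed

text \<open>The integral of a function with values in \<open>\<beta> s M K\<close> lies in \<open>M (\<integral>\<beta>)\<close> times the closed convex
  hull of \<open>K \<union> {0}\<close>.\<close>
lemma frozen_primitives_compact:
  "\<exists>Q. compact Q \<and> (\<forall>xb H. simple_function borel xb \<longrightarrow> (\<forall>t. 1 + norm (xb t) \<le> M) \<longrightarrow> H 0 = 0 \<longrightarrow>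
     weak_primitive T (\<lambda>t. g t (xb t)) H \<longrightarrow> (\<forall>t\<in>{0..T}. H t \<in> Q))"
proof -
  \<comment> \<open>The summand \<open>1\<close> avoids a division by zero when \<open>\<beta>\<close> vanishes.\<close>
  define b where "b = B T + 1"
  have b: "b > 0" using B_nonneg[of T] pos by (simp add: b_def)
  define Q where "Q = (\<lambda>z. (M * b) *\<^sub>R z) ` closure (convex hull (insert 0 K))"
  have "compact (insert 0 K)" using K(1) by simp
  then have cQ: "compact Q" unfolding Q_def
    by (intro compact_scaling compact_closure_convex_hull)
  have "convex (closure (convex hull (insert 0 K)))" by (intro convex_closure convex_convex_hull)
  then have vQ: "convex Q" unfolding Q_def by (rule convex_scaling)
  have inQ: "(M * b) *\<^sub>R z \<in> Q" if "z \<in> insert 0 K" for z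
    unfolding Q_def using that by (intro imageI subsetD[OF closure_subset] hull_inc)
  have "H t \<in> Q" if xb: "simple_function borel xb" "\<And>t. 1 + norm (xb t) \<le> M" and H: "H 0 = 0"
     "weak_primitive T (\<lambda>t. g t (xb t)) H" and t: "t \<in> {0..T}" for xb H t
  proof (rule closed_convex_membership[OF vQ cQ])
    show "Q \<noteq> {}" using inQ[of 0] by auto
    fix \<zeta> c assume le: "\<And>y. y \<in> Q \<Longrightarrow> y \<bullet> \<zeta> \<le> c"
    have Kc: "(M * b) * (z \<bullet> \<zeta>) \<le> c" if "z \<in> insert 0 K" for z using le[OF inQ[OF that]] by simp
    have c: "c \<ge> 0" using Kc[of 0] by simp
    have hi: "((\<lambda>s. b * (g s (xb s) \<bullet> \<zeta>)) has_integral b * (H t \<bullet> \<zeta>)) {0..t}"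
      using weak_primitiveD[OF H(2), of 0 t \<zeta>] H(1) t by (intro has_integral_mult_right) auto
    moreover have "((\<lambda>s. \<beta> s * c) has_integral B t * c) {0..t}"
      unfolding B_def using t by (intro has_integral_mult_left integrable_integral \<beta>_integrable_sub) auto
    ultimately have "b * (H t \<bullet> \<zeta>) \<le> B t * c"
    proof (rule has_integral_le)
      fix s assume "s \<in> {0..t}"
      then have s: "s \<in> {0..T}" using t by auto
      obtain z where z: "z \<in> K" "g s (xb s) = (\<beta> s * (1 + norm (xb s))) *\<^sub>R z" using g_growth[OF s] by auto
      have "M * (b * (g s (xb s) \<bullet> \<zeta>)) = (\<beta> s * (1 + norm (xb s))) * ((M * b) * (z \<bullet> \<zeta>))" using z by simp
      also have "\<dots> \<le> (\<beta> s * (1 + norm (xb s))) * c" using Kc[of z] z \<beta>(1)[OF s] by (intro mult_left_mono) auto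
      also have "\<dots> \<le> (\<beta> s * M) * c" using xb(2)[of s] \<beta>(1)[OF s] c by (intro mult_right_mono mult_left_mono) auto
      finally have "M * (b * (g s (xb s) \<bullet> \<zeta>)) \<le> M * (\<beta> s * c)" by (simp add: mult_ac)
      then show "b * (g s (xb s) \<bullet> \<zeta>) \<le> \<beta> s * c" by (rule mult_left_le_imp_le) (use M_ge in simp)
    qed
    also have "\<dots> \<le> b * c" using B_mono[of t T] t c by (intro mult_right_mono) (auto simp: b_def)
    finally show "H t \<bullet> \<zeta> \<le> c" by (rule mult_left_le_imp_le) (rule b)
  qed
  with cQ show ?thesis by (intro exI[of _ Q]) blast
qed

lemma approximating_sequence:
  "\<exists>\<epsilon> xb \<omega> H \<Omega> G. (\<forall>n::nat. approximate_solution (\<epsilon> n) S (xb n) (\<omega> n) (H n) (\<Omega> n) \<and>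
      0 < \<epsilon> n \<and> \<epsilon> n \<le> \<delta>0 / 2 \<and> \<epsilon> n \<le> 1 / 2) \<and> \<epsilon> \<longlonglongrightarrow> 0 \<and>
    (\<forall>e>0. \<exists>N. \<forall>n\<ge>N. \<forall>\<sigma>\<in>{0..S}. dist (H n (\<tau>_inv \<sigma>)) (G \<sigma>) < e)"
proof -
  define e0 where "e0 = Min {\<eta> / 2, \<delta>0 / 2, 1/2}"
  have e0: "0 < e0" "e0 < \<eta>" "e0 \<le> \<delta>0 / 2" "e0 \<le> 1 / 2" using pos by (auto simp: e0_def min_def)
  obtain k where k: "S / e0 < real k" using reals_Archimedean2 by blast
  have "0 < S / e0" using S_pos e0 by simp
  then have k0: "real k > 0" using k by linarith
  define \<epsilon> where "\<epsilon> n = S / real (n + k)" for n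
  have \<epsilon>: "0 < \<epsilon> n" "\<epsilon> n \<le> e0" for n
  proof -
    show "0 < \<epsilon> n" using S_pos k0 by (simp add: \<epsilon>_def)
    have "S < real k * e0" using k e0 by (simp add: pos_divide_less_eq)
    also have "\<dots> \<le> real (n + k) * e0" using e0 by (intro mult_right_mono) auto
    finally show "\<epsilon> n \<le> e0" using k0 by (simp add: \<epsilon>_def divide_le_eq mult.commute)
  qed
  have "\<exists>xb \<omega> H \<Omega>. approximate_solution (\<epsilon> n) S xb \<omega> H \<Omega>" for n
    unfolding \<epsilon>_def
    by (rule approximate_solution_exists) (use k0 \<epsilon>(2)[of n] e0 pos in \<open>auto simp: \<epsilon>_def\<close>)
  then obtain xb \<omega> H \<Omega> where A: "\<And>n. approximate_solution (\<epsilon> n) S (xb n) (\<omega> n) (H n) (\<Omega> n)" by metis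
  have A': "simple_function borel (xb n)" "\<And>t. 1 + norm (xb n t) \<le> M" "H n 0 = 0"
    "weak_primitive T (\<lambda>t. g t (xb n t)) (H n)" for n
    using A[of n] unfolding approximate_solution_def \<tau>_inv_S by auto
  obtain Q where Q: "compact Q" "\<And>n t. t \<in> {0..T} \<Longrightarrow> H n t \<in> Q"
    using frozen_primitives_compact A' by metis
  have lip1: "dist (H n (\<tau>_inv a)) (H n (\<tau>_inv b)) \<le> \<bar>a - b\<bar>" if "a \<in> {0..S}" "b \<in> {0..S}" "a \<le> b" for n a b
  proof -
    have r: "0 \<le> \<tau>_inv a" "\<tau>_inv a \<le> \<tau>_inv b" "\<tau>_inv b \<le> T" "\<tau> (\<tau>_inv a) = a" "\<tau> (\<tau>_inv b) = b"
      using \<tau>_inv[OF that(1)] \<tau>_inv[OF that(2)] \<tau>_inv_mono[of a b] that by auto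
    have "norm (H n (\<tau>_inv b) - H n (\<tau>_inv a)) \<le> M * (B (\<tau>_inv b) - B (\<tau>_inv a))"
      by (rule frozen_primitive_increment[OF A'(4) order_refl A'(2) r(1-3)])
    also have "\<dots> \<le> b - a" using \<tau>_diff_ge(4)[OF r(1-3)] r by simp
    finally show ?thesis using that by (simp add: dist_norm norm_minus_commute)
  qed
  have "dist (H n (\<tau>_inv a)) (H n (\<tau>_inv b)) \<le> \<bar>a - b\<bar>" if "a \<in> {0..S}" "b \<in> {0..S}" for n a b
    using lip1[of a b n] lip1[of b a n] that by (cases "a \<le> b") (auto simp: dist_commute)
  then obtain r G where r: "strict_mono (r :: nat \<Rightarrow> nat)"
    "\<And>e. e > 0 \<Longrightarrow> \<exists>N. \<forall>n\<ge>N. \<forall>\<sigma>\<in>{0..S}. dist (H (r n) (\<tau>_inv \<sigma>)) (G \<sigma>) < e"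
    using equilipschitz_compact_subsequence[OF Q(1), of S "\<lambda>n \<sigma>. H n (\<tau>_inv \<sigma>)"] Q(2) \<tau>_inv(1) S_pos by auto
  have "\<epsilon> \<longlonglongrightarrow> 0" unfolding \<epsilon>_def
    by (rule LIMSEQ_ignore_initial_segment[of "\<lambda>n. S / real n" 0 k]) (rule lim_const_over_n)
  then have "(\<epsilon> \<circ> r) \<longlonglongrightarrow> 0" using r(1) by (rule LIMSEQ_subseq_LIMSEQ)
  moreover have "0 < \<epsilon> n \<and> \<epsilon> n \<le> \<delta>0 / 2 \<and> \<epsilon> n \<le> 1 / 2" for n using \<epsilon>[of n] e0 by auto
  ultimately show ?thesis using A r(2)
    by (intro exI[of _ "\<epsilon> \<circ> r"] exI[of _ "\<lambda>n. xb (r n)"] exI[of _ "\<lambda>n. \<omega> (r n)"] exI[of _ "\<lambda>n. H (r n)"]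
        exI[of _ "\<lambda>n. \<Omega> (r n)"] exI[of _ G]) (simp add: o_def)
qed

end

lemma uniform_imp_pointwise_limit:
  fixes F :: "nat \<Rightarrow> 'b \<Rightarrow> 'a::metric_space"
  assumes "\<And>e. e > 0 \<Longrightarrow> \<exists>N. \<forall>n\<ge>N. \<forall>s\<in>A. dist (F n s) (G s) < e" "s \<in> A"
  shows "(\<lambda>n. F n s) \<longlonglongrightarrow> G s"
  using assms by (intro metric_LIMSEQ_I) blast

context sweeping_process
begin

lemma approximating_sequence_limit:
  "\<exists>\<epsilon> xb \<omega> H \<Omega> G \<Omega>l. (\<forall>n::nat. approximate_solution (\<epsilon> n) S (xb n) (\<omega> n) (H n) (\<Omega> n) \<and>
      0 < \<epsilon> n \<and> \<epsilon> n \<le> \<delta>0) \<and> \<epsilon> \<longlonglongrightarrow> 0 \<and>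
    (\<forall>e>0. \<exists>N. \<forall>n\<ge>N. \<forall>\<sigma>\<in>{0..S}. dist (H n (\<tau>_inv \<sigma>)) (G \<sigma>) < e) \<and>
    (\<forall>e>0. \<exists>N. \<forall>n\<ge>N. \<forall>\<sigma>\<in>{0..S}. dist (\<Omega> n \<sigma>) (\<Omega>l \<sigma>) < e)"
proof -
  obtain \<epsilon> xb \<omega> H \<Omega> G where A: "\<And>n. approximate_solution (\<epsilon> n) S (xb n) (\<omega> n) (H n) (\<Omega> n)"
    and \<epsilon>: "\<And>n::nat. 0 < \<epsilon> n" "\<And>n. \<epsilon> n \<le> \<delta>0 / 2" "\<And>n. \<epsilon> n \<le> 1 / 2" "\<epsilon> \<longlonglongrightarrow> 0"
    and G: "\<And>e. e > 0 \<Longrightarrow> \<exists>N. \<forall>n\<ge>N. \<forall>\<sigma>\<in>{0..S}. dist (H n (\<tau>_inv \<sigma>)) (G \<sigma>) < e"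
    using approximating_sequence by metis
  define c where "c = (72 * \<kappa> + 12) * exp ((16 * \<kappa> + 1) * S)"
  have c: "c > 0" using pos by (simp add: c_def add_nonneg_pos)
  have "\<exists>N. \<forall>m n s. N \<le> m \<and> N \<le> n \<and> s \<in> {0..S} \<longrightarrow> dist (\<Omega> m s) (\<Omega> n s) < e" if e: "e > 0" for e
  proof -
    define q where "q = min 1 (e\<^sup>2 / (4 * c))"
    have q: "q > 0" "q \<le> 1" "q \<le> e\<^sup>2 / (4 * c)" using e c by (auto simp: q_def)
    obtain N1 where N1: "\<And>n \<sigma>. n \<ge> N1 \<Longrightarrow> \<sigma> \<in> {0..S} \<Longrightarrow> dist (H n (\<tau>_inv \<sigma>)) (G \<sigma>) < q / 2"
      using G[OF half_gt_zero[OF q(1)]] by blast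
    obtain N2 where N2: "\<And>n. n \<ge> N2 \<Longrightarrow> \<epsilon> n < q / 2"
      using order_tendstoD(2)[OF \<epsilon>(4), of "q / 2"] q by (auto simp: eventually_sequentially)
    have "dist (\<Omega> m s) (\<Omega> n s) < e" if mn: "max N1 N2 \<le> m" "max N1 N2 \<le> n" and s: "s \<in> {0..S}" for m n s
    proof -
      have HH: "dist (H m (\<tau>_inv \<sigma>)) (H n (\<tau>_inv \<sigma>)) \<le> q" if "\<sigma> \<in> {0..S}" for \<sigma>
        using dist_triangle2[of "H m (\<tau>_inv \<sigma>)" "H n (\<tau>_inv \<sigma>)" "G \<sigma>"] N1[of m \<sigma>] N1[of n \<sigma>] mn that by auto
      have "(dist (\<Omega> m s) (\<Omega> n s))\<^sup>2 \<le> (72 * \<kappa> + 12) * (q + (\<epsilon> m + \<epsilon> n)) * exp ((16 * \<kappa> + 1) * S)"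
        using \<epsilon>(1)[of m] \<epsilon>(1)[of n] \<epsilon>(2)[of m] \<epsilon>(2)[of n] \<epsilon>(3)[of m] \<epsilon>(3)[of n] q
        by (intro approximate_solution_compare[OF A A _ _ _ _ HH _ _ s]) auto
      also have "\<dots> = c * (q + (\<epsilon> m + \<epsilon> n))" by (simp add: c_def mult_ac)
      also have "\<dots> \<le> c * (2 * q)" using N2[of m] N2[of n] mn c by (intro mult_left_mono) auto
      also have "\<dots> \<le> c * (2 * (e\<^sup>2 / (4 * c)))" using q c by (intro mult_left_mono) auto
      also have "\<dots> < e\<^sup>2" using c e by simp
      finally show ?thesis using e by (simp add: power2_less_imp_less)
    qed
    then show ?thesis by blast
  qed
  then have "\<forall>e>0. \<exists>N. \<forall>m n s. N \<le> m \<and> N \<le> n \<and> s \<in> {0..S} \<longrightarrow> dist (\<Omega> m s) (\<Omega> n s) < e" by simp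
  from iffD2[OF uniformly_convergent_eq_cauchy this]
  obtain \<Omega>l where \<Omega>l: "\<forall>e>0. \<exists>N. \<forall>n s. N \<le> n \<and> s \<in> {0..S} \<longrightarrow> dist (\<Omega> n s) (\<Omega>l s) < e" ..
  have "\<exists>N. \<forall>n\<ge>N. \<forall>\<sigma>\<in>{0..S}. dist (\<Omega> n \<sigma>) (\<Omega>l \<sigma>) < e" if "e > 0" for e
  proof -
    from mp[OF spec[OF \<Omega>l, of e] that]
    obtain N where "\<forall>n s. N \<le> n \<and> s \<in> {0..S} \<longrightarrow> dist (\<Omega> n s) (\<Omega>l s) < e" ..
    then show ?thesis by (intro exI[of _ N]) simp
  qed
  moreover have "\<epsilon> n \<le> \<delta>0" for n using \<epsilon>(2)[of n] pos by simp
  ultimately show ?thesis using A \<epsilon>(1,4) G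
    by (intro exI[of _ \<epsilon>] exI[of _ xb] exI[of _ \<omega>] exI[of _ H] exI[of _ \<Omega>] exI[of _ G] exI[of _ \<Omega>l]) simp
qed

text \<open>The limit of the approximate solutions, in integrated form: \<open>w\<close> is the almost everywhere
  limit of iterated midpoints of the velocities, and the prox inequality passes to it because it is
  linear in the velocity, with errors vanishing at each fixed time.\<close>
lemma weak_solution_exists:
  obtains x H \<Omega> w N D where "\<And>t. t \<in> {0..T} \<Longrightarrow> x t = x0 - H t - \<Omega> (\<tau> t)" "x 0 = x0"
    and "\<And>s t. 0 \<le> s \<Longrightarrow> s \<le> t \<Longrightarrow> t \<le> T \<Longrightarrow> norm (x t - x s) \<le> 2 * (\<tau> t - \<tau> s)"
    and "weak_primitive T (\<lambda>t. g t (x t)) H" "\<And>p. (\<lambda>t. norm (g t (x t) - p)) integrable_on {0..T}"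
    and "weak_primitive S w \<Omega>" "\<And>p. (\<lambda>\<sigma>. norm (w \<sigma> - p)) integrable_on {0..S}"
    and "countable D" "\<And>\<sigma>. \<sigma> \<in> {0..S} \<Longrightarrow> w \<sigma> \<in> closure D" and "negligible N"
    and "\<And>t. t \<in> {0..<T} \<Longrightarrow> x t \<in> C t"
      "\<And>t y. t \<in> {0..<T} \<Longrightarrow> \<tau> t \<notin> N \<Longrightarrow> y \<in> C t \<Longrightarrow> w (\<tau> t) \<bullet> (y - x t) \<le> \<kappa> * (dist y (x t))\<^sup>2"
proof -
  obtain \<epsilon> xb \<omega> H \<Omega> G \<Omega>l where A: "\<And>n. approximate_solution (\<epsilon> n) S (xb n) (\<omega> n) (H n) (\<Omega> n)"
    and \<epsilon>: "\<And>n::nat. 0 < \<epsilon> n" "\<And>n. \<epsilon> n \<le> \<delta>0" "\<epsilon> \<longlonglongrightarrow> 0"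
    and G: "\<And>e. e > 0 \<Longrightarrow> \<exists>N. \<forall>n\<ge>N. \<forall>\<sigma>\<in>{0..S}. dist (H n (\<tau>_inv \<sigma>)) (G \<sigma>) < e"
    and \<Omega>l: "\<And>e. e > 0 \<Longrightarrow> \<exists>N. \<forall>n\<ge>N. \<forall>\<sigma>\<in>{0..S}. dist (\<Omega> n \<sigma>) (\<Omega>l \<sigma>) < e"
    using approximating_sequence_limit by metis
  have A': "simple_function borel (xb n)" "simple_function borel (\<omega> n)" "\<And>\<sigma>. norm (\<omega> n \<sigma>) \<le> 1"
    "\<And>t. 1 + norm (xb n t) \<le> M" "H n 0 = 0" "\<Omega> n 0 = 0"
    "weak_primitive T (\<lambda>t. g t (xb n t)) (H n)" "weak_primitive S (\<omega> n) (\<Omega> n)" for n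
    using A[of n] unfolding approximate_solution_def \<tau>_inv_S by auto
  define Xn where "Xn n \<sigma> = x0 - H n (\<tau>_inv \<sigma>) - \<Omega> n \<sigma>" for n \<sigma>
  define x where "x t = x0 - G (\<tau> t) - \<Omega>l (\<tau> t)" for t
  have G_lim: "(\<lambda>n. H n (\<tau>_inv \<sigma>)) \<longlonglongrightarrow> G \<sigma>" if "\<sigma> \<in> {0..S}" for \<sigma>
    using uniform_imp_pointwise_limit[of "{0..S}" "\<lambda>n \<sigma>. H n (\<tau>_inv \<sigma>)" G, OF G that] .
  have H_lim: "(\<lambda>n. H n t) \<longlonglongrightarrow> G (\<tau> t)" if "t \<in> {0..T}" for t
    using G_lim[OF \<tau>_range[OF that]] by (simp add: \<tau>_inv_\<tau>[OF that])
  have \<Omega>_lim: "(\<lambda>n. \<Omega> n \<sigma>) \<longlonglongrightarrow> \<Omega>l \<sigma>" if "\<sigma> \<in> {0..S}" for \<sigma>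
    using uniform_imp_pointwise_limit[of "{0..S}" \<Omega> \<Omega>l, OF \<Omega>l that] .
  have X_lim: "(\<lambda>n. Xn n (\<tau> t)) \<longlonglongrightarrow> x t" if "t \<in> {0..T}" for t
    unfolding Xn_def x_def using G_lim[OF \<tau>_range[OF that]] \<Omega>_lim[OF \<tau>_range[OF that]]
    by (intro tendsto_diff tendsto_const)
  have \<tau>_lt: "\<tau> t \<in> {0..<S}" "\<tau> t \<in> {0..S}" "t \<in> {0..T}" "\<tau>_inv (\<tau> t) = t" if "t \<in> {0..<T}" for t
    using that \<tau>_range[of t] \<tau>_strict_mono[of t T] \<tau>_inv_\<tau>[of t] by (auto simp: S_def)
  have near_lim: "y \<longlonglongrightarrow> x t" if "\<And>n. dist (y n) (Xn n (\<tau> t)) \<le> c * \<epsilon> n" "t \<in> {0..T}" for y c t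
  proof -
    have "(\<lambda>n. c * \<epsilon> n) \<longlonglongrightarrow> 0" using tendsto_mult_left[OF \<epsilon>(3), of c] by simp
    then have "(\<lambda>n. y n - Xn n (\<tau> t)) \<longlonglongrightarrow> 0"
      by (rule Lim_null_comparison[rotated]) (use that(1) in \<open>auto simp: dist_norm\<close>)
    from tendsto_add[OF this X_lim[OF that(2)]] show ?thesis by simp
  qed
  have xb_lim: "(\<lambda>n. xb n t) \<longlonglongrightarrow> x t" if t: "t \<in> {0..<T}" for t
  proof (rule near_lim[where c = 2])
    show "dist (xb n t) (Xn n (\<tau> t)) \<le> 2 * \<epsilon> n" for n
      using A[of n] \<tau>_lt(1)[OF t] \<tau>_lt(4)[OF t] unfolding approximate_solution_def Xn_def by metis
  qed (use \<tau>_lt[OF t] in auto)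
  have g_lim: "(\<lambda>n. g t (xb n t)) \<longlonglongrightarrow> g t (x t)" if t: "t \<in> {0..<T}" for t
    by (rule isCont_tendsto_compose[OF g_cont[OF \<tau>_lt(3)[OF t]] xb_lim[OF t]])
  have "\<forall>n. \<forall>\<sigma>\<in>{0..<S}. \<exists>\<theta> p. \<theta> \<in> {0..S} \<and> \<bar>\<theta> - \<sigma>\<bar> \<le> \<epsilon> n \<and> p \<in> C (\<tau>_inv \<theta>) \<and> dist p (Xn n \<sigma>) \<le> 2 * \<epsilon> n \<and>
      (\<forall>y\<in>C (\<tau>_inv \<theta>). \<omega> n \<sigma> \<bullet> (y - p) \<le> \<kappa> * (dist y p)\<^sup>2)"
    using A unfolding approximate_solution_def Xn_def by meson
  then obtain \<theta> p where \<theta>p: "\<And>n \<sigma>. \<sigma> \<in> {0..<S} \<Longrightarrow> \<theta> n \<sigma> \<in> {0..S}"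
    "\<And>n \<sigma>. \<sigma> \<in> {0..<S} \<Longrightarrow> \<bar>\<theta> n \<sigma> - \<sigma>\<bar> \<le> \<epsilon> n" "\<And>n \<sigma>. \<sigma> \<in> {0..<S} \<Longrightarrow> p n \<sigma> \<in> C (\<tau>_inv (\<theta> n \<sigma>))"
    "\<And>n \<sigma>. \<sigma> \<in> {0..<S} \<Longrightarrow> dist (p n \<sigma>) (Xn n \<sigma>) \<le> 2 * \<epsilon> n"
    "\<And>n \<sigma> y. \<sigma> \<in> {0..<S} \<Longrightarrow> y \<in> C (\<tau>_inv (\<theta> n \<sigma>)) \<Longrightarrow> \<omega> n \<sigma> \<bullet> (y - p n \<sigma>) \<le> \<kappa> * (dist y (p n \<sigma>))\<^sup>2"
    by metis
  have xC: "x t \<in> C t" if t: "t \<in> {0..<T}" for t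
  proof -
    note s = \<tau>_lt[OF t]
    have "\<exists>y\<in>C t. dist (p n (\<tau> t)) y \<le> \<epsilon> n" for n
    proof -
      have "\<exists>y\<in>C (\<tau>_inv (\<tau> t)). dist (p n (\<tau> t)) y \<le> \<bar>\<tau> t - \<theta> n (\<tau> t)\<bar>"
        using \<theta>p(1-3)[OF s(1), of n] s(2) \<epsilon>(2)[of n] by (intro move_\<sigma>) auto
      then show ?thesis using \<theta>p(2)[OF s(1), of n] s(4) by (metis abs_minus_commute order_trans)
    qed
    then obtain y where y: "\<And>n. y n \<in> C t" "\<And>n. dist (p n (\<tau> t)) (y n) \<le> \<epsilon> n" by metis
    have "y \<longlonglongrightarrow> x t"
    proof (rule near_lim[where c = 3])
      show "dist (y n) (Xn n (\<tau> t)) \<le> 3 * \<epsilon> n" for n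
        using dist_triangle[of "y n" "Xn n (\<tau> t)" "p n (\<tau> t)"] y(2)[of n] \<theta>p(4)[OF s(1), of n]
        by (simp add: dist_commute)
    qed (rule s(3))
    then show ?thesis using closed_C[OF s(3)] y(1) by (metis closed_sequentially)
  qed
  have primH: "weak_primitive T (\<lambda>t. g t (x t)) (\<lambda>t. G (\<tau> t))"
    unfolding weak_primitive_def
  proof (intro allI impI)
    fix \<zeta> a b assume ab: "0 \<le> a" "a \<le> b" "b \<le> T"
    \<comment> \<open>The frozen states need not converge at the final time, so that point is removed from the integrals.\<close>
    have "((\<lambda>s. if s = T then 0 else g s (x s) \<bullet> \<zeta>) has_integral (G (\<tau> b) - G (\<tau> a)) \<bullet> \<zeta>) {a..b}"
    proof (rule has_integral_dominated_convergence[where f = "\<lambda>k s. if s = T then 0 else g s (xb k s) \<bullet> \<zeta>"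
          and y = "\<lambda>k. (H k b - H k a) \<bullet> \<zeta>" and h = "\<lambda>s. M * \<beta> s * norm \<zeta>"])
      show "((\<lambda>s. if s = T then 0 else g s (xb k s) \<bullet> \<zeta>) has_integral (H k b - H k a) \<bullet> \<zeta>) {a..b}" for k
        by (rule has_integral_spike_finite[of "{T}", OF _ _ weak_primitiveD[OF A'(7) ab]]) auto
      show "(\<lambda>s. M * \<beta> s * norm \<zeta>) integrable_on {a..b}"
        using ab by (intro integrable_on_mult_left integrable_on_mult_right \<beta>_integrable_sub) auto
      show "\<forall>s\<in>{a..b}. norm (if s = T then 0 else g s (xb k s) \<bullet> \<zeta>) \<le> M * \<beta> s * norm \<zeta>" for k
      proof
        fix s assume "s \<in> {a..b}"
        then have s: "s \<in> {0..T}" using ab by auto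
        have "\<bar>g s (xb k s) \<bullet> \<zeta>\<bar> \<le> norm (g s (xb k s)) * norm \<zeta>" by (rule Cauchy_Schwarz_ineq2)
        also have "\<dots> \<le> M * \<beta> s * norm \<zeta>" using frozen_dominated[OF A'(4) s] by (intro mult_right_mono) auto
        finally show "norm (if s = T then 0 else g s (xb k s) \<bullet> \<zeta>) \<le> M * \<beta> s * norm \<zeta>"
          using M_ge \<beta>(1)[OF s] by auto
      qed
      show "\<forall>s\<in>{a..b}. (\<lambda>k. if s = T then 0 else g s (xb k s) \<bullet> \<zeta>) \<longlonglongrightarrow> (if s = T then 0 else g s (x s) \<bullet> \<zeta>)"
        using ab g_lim by (auto intro!: tendsto_inner)
      show "(\<lambda>k. (H k b - H k a) \<bullet> \<zeta>) \<longlonglongrightarrow> (G (\<tau> b) - G (\<tau> a)) \<bullet> \<zeta>"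
        using ab by (intro tendsto_inner tendsto_diff H_lim tendsto_const) auto
    qed
    then show "((\<lambda>s. g s (x s) \<bullet> \<zeta>) has_integral (G (\<tau> b) - G (\<tau> a)) \<bullet> \<zeta>) {a..b}"
      by (rule has_integral_spike_finite[of "{T}", rotated 2]) auto
  qed
  have intH: "(\<lambda>t. norm (g t (x t) - q)) integrable_on {0..T}" for q
  proof -
    have i1: "(\<lambda>s. norm (g s (xb k s) - q)) integrable_on {0..T}" for k
    proof (rule measurable_bounded_by_integrable_imp_integrable)
      show "(\<lambda>s. norm (g s (xb k s) - q)) \<in> borel_measurable (lebesgue_on {0..T})"
        by (rule frozen_measurable[OF A'(1), of "\<lambda>y. norm (y - q)"]) (intro continuous_intros)
      show "(\<lambda>s. M * \<beta> s + norm q) integrable_on {0..T}"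
        by (intro integrable_add integrable_on_mult_right \<beta>(2) integrable_const_ivl)
      show "norm (norm (g s (xb k s) - q)) \<le> M * \<beta> s + norm q" if "s \<in> {0..T}" for s
        using frozen_dominated[OF A'(4)[of k s] that] norm_triangle_ineq4[of "g s (xb k s)" q] by simp
    qed auto
    have "(\<lambda>s. if s = T then 0 else norm (g s (x s) - q)) integrable_on {0..T}"
    proof (rule dominated_convergence(1)[where f = "\<lambda>k s. if s = T then 0 else norm (g s (xb k s) - q)"
          and h = "\<lambda>s. M * \<beta> s + norm q"])
      show "(\<lambda>s. if s = T then 0 else norm (g s (xb k s) - q)) integrable_on {0..T}" for k
        by (rule integrable_spike_finite[of "{T}", OF _ _ i1[of k]]) auto
      show "(\<lambda>s. M * \<beta> s + norm q) integrable_on {0..T}"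
        by (intro integrable_add integrable_on_mult_right \<beta>(2) integrable_const_ivl)
      show "norm (if s = T then 0 else norm (g s (xb k s) - q)) \<le> M * \<beta> s + norm q" if s: "s \<in> {0..T}" for s k
        using frozen_dominated[OF A'(4)[of k s] s] norm_triangle_ineq4[of "g s (xb k s)" q] M_ge \<beta>(1)[OF s]
        by (auto simp: add_nonneg_nonneg)
      show "(\<lambda>k. if s = T then 0 else norm (g s (xb k s) - q)) \<longlonglongrightarrow> (if s = T then 0 else norm (g s (x s) - q))"
        if "s \<in> {0..T}" for s
        using that g_lim[of s] by (auto intro!: tendsto_norm tendsto_diff)
    qed
    then show ?thesis by (rule integrable_spike_finite[of "{T}", rotated 2]) auto
  qed
  obtain v N where v: "\<And>k. v k \<in> midpoint_hull (\<omega> ` {k..})" and N: "negligible N"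
    and conv: "\<And>s. s \<in> {0..S} - N \<Longrightarrow> convergent (\<lambda>k. v k s)"
    using midpoint_hull_ae_convergent[of \<omega> S, OF A'(2,3)] S_pos by (metis less_imp_le)
  define w where "w \<sigma> = (if \<sigma> \<in> {0..S} - N then lim (\<lambda>k. v k \<sigma>) else 0)" for \<sigma>
  have w_lim: "(\<lambda>k. v k \<sigma>) \<longlonglongrightarrow> w \<sigma>" if "\<sigma> \<in> {0..S} - N" for \<sigma>
    using conv[OF that] that by (simp add: w_def convergent_LIMSEQ_iff)
  have v_simple: "simple_function borel (v k)" for k
    by (rule midpoint_hull_simple[OF _ v]) (use A'(2) in auto)
  have v_bd: "norm (v k s) \<le> 1" for k s
    by (rule midpoint_hull_norm_le[OF _ v]) (use A'(3) in auto)
  have w_bd: "norm (w \<sigma>) \<le> 1" for \<sigma>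
  proof (cases "\<sigma> \<in> {0..S} - N")
    case True
    show ?thesis by (rule LIMSEQ_le_const2[OF tendsto_norm[OF w_lim[OF True]]]) (use v_bd in auto)
  qed (auto simp: w_def)
  have primW: "weak_primitive S w \<Omega>l"
    unfolding weak_primitive_def
  proof (intro allI impI)
    fix \<zeta> a b assume ab: "0 \<le> a" "a \<le> b" "b \<le> S"
    define I where "I k = integral {a..b} (\<lambda>s. v k s \<bullet> \<zeta>)" for k
    have hi: "((\<lambda>s. v k s \<bullet> \<zeta>) has_integral I k) {a..b}" for k
      unfolding I_def
      by (rule integrable_integral, rule simple_function_integrable_on,
          rule simple_function_compose1[OF v_simple, of "\<lambda>y. y \<bullet> \<zeta>"])
    have I_lim: "I \<longlonglongrightarrow> (\<Omega>l b - \<Omega>l a) \<bullet> \<zeta>"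
    proof (rule metric_LIMSEQ_I)
      fix e :: real assume "e > 0"
      define e' where "e' = e / (2 * norm \<zeta> + 1)"
      have nz: "2 * norm \<zeta> + 1 > 0" by (simp add: add_nonneg_pos)
      then have e': "e' > 0" using \<open>e > 0\<close> by (simp add: e'_def)
      obtain n0 where n0: "\<And>n \<sigma>. n \<ge> n0 \<Longrightarrow> \<sigma> \<in> {0..S} \<Longrightarrow> dist (\<Omega> n \<sigma>) (\<Omega>l \<sigma>) < e'"
        using \<Omega>l[OF e'] by blast
      have "dist (I k) ((\<Omega>l b - \<Omega>l a) \<bullet> \<zeta>) < e" if k: "k \<ge> n0" for k
      proof -
        have "\<exists>U. weak_primitive S u U \<and> (\<forall>s\<in>{0..S}. dist (U s) (\<Omega>l s) \<le> e')" if "u \<in> \<omega> ` {k..}" for u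
        proof -
          obtain n where "n \<ge> k" "u = \<omega> n" using \<open>u \<in> \<omega> ` {k..}\<close> by auto
          then show ?thesis using A'(8)[of n] n0[of n] k by (intro exI[of _ "\<Omega> n"]) (auto intro: less_imp_le)
        qed
        from midpoint_hull_primitive[OF this v] obtain U where U: "weak_primitive S (v k) U"
          "\<And>s. s \<in> {0..S} \<Longrightarrow> dist (U s) (\<Omega>l s) \<le> e'" by blast
        have "I k = (U b - U a) \<bullet> \<zeta>"
          using hi[of k] weak_primitiveD[OF U(1) ab, of \<zeta>] by (rule has_integral_unique)
        then have "dist (I k) ((\<Omega>l b - \<Omega>l a) \<bullet> \<zeta>) = \<bar>((U b - \<Omega>l b) - (U a - \<Omega>l a)) \<bullet> \<zeta>\<bar>"
          by (simp add: dist_real_def inner_diff_left algebra_simps)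
        also have "\<dots> \<le> norm ((U b - \<Omega>l b) - (U a - \<Omega>l a)) * norm \<zeta>" by (rule Cauchy_Schwarz_ineq2)
        also have "\<dots> \<le> (e' + e') * norm \<zeta>"
          using U(2)[of a] U(2)[of b] ab norm_triangle_ineq4[of "U b - \<Omega>l b" "U a - \<Omega>l a"]
          by (intro mult_right_mono) (auto simp: dist_norm)
        also have "\<dots> < e' * (2 * norm \<zeta> + 1)" using e' by (simp add: algebra_simps)
        also have "\<dots> = e" using nz by (simp add: e'_def)
        finally show ?thesis .
      qed
      then show "\<exists>no. \<forall>k\<ge>no. dist (I k) ((\<Omega>l b - \<Omega>l a) \<bullet> \<zeta>) < e" by blast
    qed
    have "((\<lambda>s. if s \<in> N then 0 else w s \<bullet> \<zeta>) has_integral (\<Omega>l b - \<Omega>l a) \<bullet> \<zeta>) {a..b}"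
    proof (rule has_integral_dominated_convergence[where f = "\<lambda>k s. if s \<in> N then 0 else v k s \<bullet> \<zeta>"
          and y = I and h = "\<lambda>s. norm \<zeta>"])
      show "((\<lambda>s. if s \<in> N then 0 else v k s \<bullet> \<zeta>) has_integral I k) {a..b}" for k
        by (rule has_integral_spike[OF N _ hi]) auto
      show "(\<lambda>s. norm \<zeta>) integrable_on {a..b}" by (rule integrable_const_ivl)
      show "\<forall>s\<in>{a..b}. norm (if s \<in> N then 0 else v k s \<bullet> \<zeta>) \<le> norm \<zeta>" for k
      proof
        fix s
        have "\<bar>v k s \<bullet> \<zeta>\<bar> \<le> norm (v k s) * norm \<zeta>" by (rule Cauchy_Schwarz_ineq2)
        also have "\<dots> \<le> 1 * norm \<zeta>" using v_bd by (intro mult_right_mono) auto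
        finally show "norm (if s \<in> N then 0 else v k s \<bullet> \<zeta>) \<le> norm \<zeta>" by simp
      qed
      show "\<forall>s\<in>{a..b}. (\<lambda>k. if s \<in> N then 0 else v k s \<bullet> \<zeta>) \<longlonglongrightarrow> (if s \<in> N then 0 else w s \<bullet> \<zeta>)"
        using ab w_lim by (auto intro!: tendsto_inner)
    qed (rule I_lim)
    then show "((\<lambda>s. w s \<bullet> \<zeta>) has_integral (\<Omega>l b - \<Omega>l a) \<bullet> \<zeta>) {a..b}"
      by (rule has_integral_spike[OF N, rotated]) auto
  qed
  have intW: "(\<lambda>s. norm (w s - q)) integrable_on {0..S}" for q
  proof -
    have i1: "(\<lambda>s. norm (v k s - q)) integrable_on {0..S}" for k
      by (rule simple_function_integrable_on, rule simple_function_compose1[OF v_simple, of "\<lambda>y. norm (y - q)"])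
    have "(\<lambda>s. if s \<in> N then 0 else norm (w s - q)) integrable_on {0..S}"
    proof (rule dominated_convergence(1)[where f = "\<lambda>k s. if s \<in> N then 0 else norm (v k s - q)"
          and h = "\<lambda>s. 1 + norm q"])
      show "(\<lambda>s. if s \<in> N then 0 else norm (v k s - q)) integrable_on {0..S}" for k
        by (rule integrable_spike[OF i1[of k] N]) auto
      show "norm (if s \<in> N then 0 else norm (v k s - q)) \<le> 1 + norm q" for s k
        using v_bd[of k s] norm_triangle_ineq4[of "v k s" q] by auto
      show "(\<lambda>k. if s \<in> N then 0 else norm (v k s - q)) \<longlonglongrightarrow> (if s \<in> N then 0 else norm (w s - q))"
        if "s \<in> {0..S}" for s
        using that w_lim[of s] by (auto intro!: tendsto_norm tendsto_diff)
    qed (rule integrable_const_ivl)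
    then show ?thesis by (rule integrable_spike[OF _ N]) auto
  qed
  define D where "D = insert 0 (\<Union>k. range (v k))"
  have D: "countable D"
  proof -
    have "countable (range (v k))" for k using simple_functionD(1)[OF v_simple[of k]] by (simp add: countable_finite)
    then show ?thesis unfolding D_def by (intro countable_insert countable_UN) auto
  qed
  have wD: "w \<sigma> \<in> closure D" for \<sigma>
  proof (cases "\<sigma> \<in> {0..S} - N")
    case True
    have "v k \<sigma> \<in> closure D" for k using closure_subset[of D] by (auto simp: D_def)
    then show ?thesis using w_lim[OF True] by (metis closed_closure closed_sequentially)
  next
    case False
    then show ?thesis using closure_subset[of D] by (auto simp: w_def D_def)
  qed
  have normal: "w (\<tau> t) \<bullet> (y - x t) \<le> \<kappa> * (dist y (x t))\<^sup>2"
    if t: "t \<in> {0..<T}" and \<tau>N: "\<tau> t \<notin> N" and y: "y \<in> C t" for t y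
  proof -
    note s = \<tau>_lt[OF t]
    define \<sigma> where "\<sigma> = \<tau> t"
    define z where "z = y - x t"
    define \<eta>n where "\<eta>n n = 3 * \<epsilon> n + dist (Xn n \<sigma>) (x t)" for n
    have \<eta>n: "\<eta>n \<longlonglongrightarrow> 0"
    proof -
      have "\<eta>n \<longlonglongrightarrow> 3 * 0 + dist (x t) (x t)" unfolding \<eta>n_def \<sigma>_def
        by (intro tendsto_intros \<epsilon>(3) X_lim[OF s(3)])
      then show ?thesis by simp
    qed
    have bound: "\<omega> n \<sigma> \<bullet> z \<le> \<kappa> * (norm z + \<eta>n n)\<^sup>2 + \<eta>n n" for n
    proof -
      have "\<exists>y'\<in>C (\<tau>_inv (\<theta> n \<sigma>)). dist y y' \<le> \<bar>\<theta> n \<sigma> - \<sigma>\<bar>"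
        using \<theta>p(1,2)[OF s(1), of n] s(2,4) y \<epsilon>(2)[of n] unfolding \<sigma>_def by (intro move_\<sigma>) auto
      then obtain y' where y': "y' \<in> C (\<tau>_inv (\<theta> n \<sigma>))" "dist y y' \<le> \<epsilon> n"
        using \<theta>p(2)[OF s(1), of n] unfolding \<sigma>_def by (meson order_trans)
      define z' where "z' = y' - p n \<sigma>"
      have pX: "dist (p n \<sigma>) (Xn n \<sigma>) \<le> 2 * \<epsilon> n" using \<theta>p(4)[OF s(1)] unfolding \<sigma>_def .
      have "z' - z = (y' - y) - (p n \<sigma> - Xn n \<sigma>) - (Xn n \<sigma> - x t)" by (simp add: z_def z'_def)
      then have "norm (z' - z) \<le> norm ((y' - y) - (p n \<sigma> - Xn n \<sigma>)) + norm (Xn n \<sigma> - x t)"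
        by (metis norm_triangle_ineq4)
      also have "\<dots> \<le> norm (y' - y) + norm (p n \<sigma> - Xn n \<sigma>) + norm (Xn n \<sigma> - x t)"
        using norm_triangle_ineq4[of "y' - y" "p n \<sigma> - Xn n \<sigma>"] by simp
      finally have zz: "norm (z' - z) \<le> \<eta>n n"
        using y'(2) pX by (simp add: \<eta>n_def dist_norm norm_minus_commute)
      have "norm z' \<le> norm z + \<eta>n n" using zz norm_triangle_sub[of z' z] by simp
      then have "\<kappa> * (norm z')\<^sup>2 \<le> \<kappa> * (norm z + \<eta>n n)\<^sup>2" using pos by (intro mult_left_mono power_mono) auto
      moreover have "\<omega> n \<sigma> \<bullet> z' \<le> \<kappa> * (norm z')\<^sup>2"
        using \<theta>p(5)[OF s(1), of y' n] y'(1) unfolding \<sigma>_def z'_def dist_norm by simp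
      moreover have "\<omega> n \<sigma> \<bullet> (z - z') \<le> \<eta>n n"
      proof -
        have "\<omega> n \<sigma> \<bullet> (z - z') \<le> norm (\<omega> n \<sigma>) * norm (z - z')" by (rule norm_cauchy_schwarz)
        also have "\<dots> \<le> 1 * norm (z - z')" using A'(3) by (intro mult_right_mono) auto
        finally show ?thesis using zz by (simp add: norm_minus_commute)
      qed
      ultimately show ?thesis by (simp add: inner_diff_right)
    qed
    have "(\<lambda>n. \<kappa> * (norm z + \<eta>n n)\<^sup>2 + \<eta>n n) \<longlonglongrightarrow> \<kappa> * (norm z + 0)\<^sup>2 + 0"
      by (intro tendsto_intros \<eta>n)
    then have lim: "(\<lambda>n. \<kappa> * (norm z + \<eta>n n)\<^sup>2 + \<eta>n n) \<longlonglongrightarrow> \<kappa> * (norm z)\<^sup>2" by simp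
    have wlim: "(\<lambda>k. v k \<sigma> \<bullet> z) \<longlonglongrightarrow> w \<sigma> \<bullet> z"
      using w_lim[of \<sigma>] s(2) \<tau>N by (intro tendsto_inner tendsto_const) (auto simp: \<sigma>_def)
    have "w \<sigma> \<bullet> z \<le> \<kappa> * (norm z)\<^sup>2"
    proof (rule field_le_epsilon)
      fix e :: real assume "e > 0"
      then obtain n0 where n0: "\<And>n. n \<ge> n0 \<Longrightarrow> \<kappa> * (norm z + \<eta>n n)\<^sup>2 + \<eta>n n < \<kappa> * (norm z)\<^sup>2 + e"
        using order_tendstoD(2)[OF lim, of "\<kappa> * (norm z)\<^sup>2 + e"] by (auto simp: eventually_sequentially)
      have "v k \<sigma> \<bullet> z \<le> \<kappa> * (norm z)\<^sup>2 + e" if k: "k \<ge> n0" for k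
      proof (rule midpoint_hull_inner_le[OF _ v])
        fix u assume "u \<in> \<omega> ` {k..}"
        then obtain n where "n \<ge> k" "u = \<omega> n" by auto
        then show "u \<sigma> \<bullet> z \<le> \<kappa> * (norm z)\<^sup>2 + e" using bound[of n] n0[of n] k by simp
      qed
      then show "w \<sigma> \<bullet> z \<le> \<kappa> * (norm z)\<^sup>2 + e" by (intro LIMSEQ_le_const2[OF wlim]) blast
    qed
    then show ?thesis by (simp add: \<sigma>_def z_def dist_norm)
  qed
  have G0: "G (\<tau> 0) = 0" using LIMSEQ_unique[OF H_lim[of 0]] A'(5) pos by auto
  have \<Omega>0: "\<Omega>l (\<tau> 0) = 0" using LIMSEQ_unique[OF \<Omega>_lim[of 0]] A'(6) S_pos by (auto simp: \<tau>_0)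
  have lip: "norm (x t - x s) \<le> 2 * (\<tau> t - \<tau> s)" if st: "0 \<le> s" "s \<le> t" "t \<le> T" for s t
  proof -
    have "norm (H n t - H n s) \<le> \<tau> t - \<tau> s" for n
      using frozen_primitive_increment[OF A'(7) order_refl A'(4) st, of n] \<tau>_diff_ge(4)[OF st] by linarith
    moreover have "(\<lambda>n. norm (H n t - H n s)) \<longlonglongrightarrow> norm (G (\<tau> t) - G (\<tau> s))"
      using st by (intro tendsto_norm tendsto_diff H_lim) auto
    ultimately have 1: "norm (G (\<tau> t) - G (\<tau> s)) \<le> \<tau> t - \<tau> s" by (intro LIMSEQ_le_const2) auto
    have 2: "norm (\<Omega>l (\<tau> t) - \<Omega>l (\<tau> s)) \<le> \<tau> t - \<tau> s"
      using weak_primitive_lipschitz[OF primW w_bd, of "\<tau> s" "\<tau> t"] \<tau>_mono[OF st] \<tau>_range[of s] \<tau>_range[of t] st by auto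
    have "x t - x s = - (G (\<tau> t) - G (\<tau> s)) - (\<Omega>l (\<tau> t) - \<Omega>l (\<tau> s))" by (simp add: x_def)
    then have "norm (x t - x s) \<le> norm (G (\<tau> t) - G (\<tau> s)) + norm (\<Omega>l (\<tau> t) - \<Omega>l (\<tau> s))"
      by (metis norm_minus_cancel norm_triangle_ineq4)
    with 1 2 show ?thesis by argo
  qed
  show thesis
  proof (rule that)
    show "x t = x0 - G (\<tau> t) - \<Omega>l (\<tau> t)" if "t \<in> {0..T}" for t by (rule x_def)
    show "x 0 = x0" using G0 \<Omega>0 by (simp add: x_def)
    show "norm (x t - x s) \<le> 2 * (\<tau> t - \<tau> s)" if "0 \<le> s" "s \<le> t" "t \<le> T" for s t by (rule lip[OF that])
    show "weak_primitive T (\<lambda>t. g t (x t)) (\<lambda>t. G (\<tau> t))" by (rule primH)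
    show "(\<lambda>t. norm (g t (x t) - q)) integrable_on {0..T}" for q by (rule intH)
    show "weak_primitive S w \<Omega>l" by (rule primW)
    show "(\<lambda>\<sigma>. norm (w \<sigma> - q)) integrable_on {0..S}" for q by (rule intW)
    show "countable D" by (rule D)
    show "w \<sigma> \<in> closure D" for \<sigma> by (rule wD)
    show "negligible N" by (rule N)
    show "x t \<in> C t" if "t \<in> {0..<T}" for t by (rule xC[OF that])
    show "w (\<tau> t) \<bullet> (y - x t) \<le> \<kappa> * (dist y (x t))\<^sup>2" if "t \<in> {0..<T}" "\<tau> t \<notin> N" "y \<in> C t" for t y
      by (rule normal[OF that])
  qed
qed

end

section \<open>Absolute continuity, differentiation and normal cones\<close>

text \<open>At each point at most one of the functions restricted to the open intervals is nonzero.\<close>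
lemma sum_integral_disjoint_le:
  fixes f :: "real \<Rightarrow> real"
  assumes f: "f integrable_on {0..T}" "\<And>s. s \<in> {0..T} \<Longrightarrow> f s \<ge> 0"
    and ab: "\<And>k. k < n \<Longrightarrow> {a k..b k} \<subseteq> {0..T}"
    and disj: "disjoint_family_on (\<lambda>k. {a k<..<b k}) {..<n::nat}"
  shows "(\<Sum>k<n. integral {a k..b k} f) \<le> integral {0..T} f"
proof -
  define F where "F k s = (if s \<in> {a k<..<b k} then f s else 0)" for k s
  have sub: "{a k<..<b k} \<subseteq> {0..T}" if "k < n" for k
    using ab[OF that] by (auto simp: subset_eq)
  have F: "F k integrable_on {0..T}" "integral {0..T} (F k) = integral {a k..b k} f" if "k < n" for k
  proof -
    have "f integrable_on {a k..b k}" using f(1) ab[OF that] by (rule integrable_on_subinterval)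
    then have "f integrable_on {a k<..<b k}" by (simp add: integrable_on_open_interval_real)
    then show "F k integrable_on {0..T}" unfolding F_def using sub[OF that] by (simp only: integrable_restrict_Int Int_absorb2)
    show "integral {0..T} (F k) = integral {a k..b k} f"
      unfolding F_def using sub[OF that] by (simp only: integral_restrict_Int Int_absorb2 integral_open_interval_real)
  qed
  have "(\<Sum>k<n. integral {a k..b k} f) = (\<Sum>k<n. integral {0..T} (F k))" using F by simp
  also have "\<dots> = integral {0..T} (\<lambda>s. \<Sum>k<n. F k s)" using F by (intro integral_sum[symmetric]) auto
  also have "\<dots> \<le> integral {0..T} f"
  proof (rule integral_le[OF _ f(1)])
    show "(\<lambda>s. \<Sum>k<n. F k s) integrable_on {0..T}" using F by (intro integrable_sum) auto
    fix s assume s: "s \<in> {0..T}"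
    show "(\<Sum>k<n. F k s) \<le> f s"
    proof (cases "\<exists>j<n. s \<in> {a j<..<b j}")
      case True
      then obtain j where j: "j < n" "s \<in> {a j<..<b j}" by blast
      have "F k s = 0" if "k < n" "k \<noteq> j" for k
      proof -
        have "{a k<..<b k} \<inter> {a j<..<b j} = {}"
          using disj that j(1) unfolding disjoint_family_on_def by (metis lessThan_iff)
        then have "s \<notin> {a k<..<b k}" using j(2) by blast
        then show ?thesis unfolding F_def by (rule if_not_P)
      qed
      then have "(\<Sum>k<n. F k s) = (\<Sum>k\<in>{j}. F k s)" using j(1) by (intro sum.mono_neutral_right) auto
      then show ?thesis using j by (simp add: F_def)
    next
      case False
      then have "(\<Sum>k<n. F k s) = 0" by (intro sum.neutral) (auto simp: F_def)
      then show ?thesis using f(2)[OF s] by simp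
    qed
  qed
  finally show ?thesis .
qed

text \<open>Split \<open>\<beta>\<close> into a part bounded by \<open>N\<close> and a remainder \<open>f N\<close> with small integral.\<close>
lemma abs_continuous_on_of_integral_bound:
  fixes x :: "real \<Rightarrow> 'a::real_normed_vector"
  assumes \<beta>: "\<beta> integrable_on {0..T}" "\<And>s. s \<in> {0..T} \<Longrightarrow> \<beta> s \<ge> (0::real)"
    and x: "\<And>s t. 0 \<le> s \<Longrightarrow> s \<le> t \<Longrightarrow> t \<le> T \<Longrightarrow> norm (x t - x s) \<le> k * (t - s) + l * integral {s..t} \<beta>"
    and kl: "k \<ge> 0" "l \<ge> 0"
  shows "abs_continuous_on {0..T} x"
  unfolding abs_continuous_on_def
proof (intro allI impI)
  fix e :: real assume e: "e > 0"
  define f where "f N s = \<beta> s - min (\<beta> s) (real N)" for N s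
  have abs\<beta>: "\<beta> absolutely_integrable_on {0..T}" using \<beta> by (intro nonnegative_absolutely_integrable_1) auto
  have f_int: "f N integrable_on {0..T}" for N
  proof -
    have "(\<lambda>s. min (\<beta> s) (real N)) absolutely_integrable_on {0..T}"
      by (intro absolutely_integrable_min_1 abs\<beta>) (simp add: absolutely_integrable_on_iff_nonneg)
    then have "(\<lambda>s. min (\<beta> s) (real N)) integrable_on {0..T}" by (rule set_lebesgue_integral_eq_integral(1))
    then show ?thesis unfolding f_def using \<beta>(1) by (intro integrable_diff)
  qed
  have f_pos: "f N s \<ge> 0" for N s by (simp add: f_def)
  have "(\<lambda>N. integral {0..T} (f N)) \<longlonglongrightarrow> integral {0..T} (\<lambda>_. 0::real)"
  proof (rule dominated_convergence(2)[OF f_int \<beta>(1)])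
    show "norm (f N s) \<le> \<beta> s" if "s \<in> {0..T}" for N s using \<beta>(2)[OF that] by (auto simp: f_def min_def)
    show "(\<lambda>N. f N s) \<longlonglongrightarrow> 0" for s
    proof (rule tendsto_eventually)
      obtain N where "\<beta> s \<le> real N" using real_arch_simple by blast
      then show "\<forall>\<^sub>F N in sequentially. f N s = 0"
        by (auto simp: eventually_sequentially f_def min_def intro!: exI[of _ N])
    qed
  qed
  then have "(\<lambda>N. integral {0..T} (f N)) \<longlonglongrightarrow> 0" by simp
  moreover have "e / (2 * (l + 1)) > 0" using e kl by simp
  ultimately obtain N where N: "integral {0..T} (f N) < e / (2 * (l + 1))"
    using order_tendstoD(2)[of _ 0 sequentially] by (metis (no_types, lifting) eventually_sequentially order_refl)
  define c where "c = k + l * real N"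
  have c: "c \<ge> 0" using kl by (simp add: c_def)
  show "\<exists>\<delta>>0. \<forall>(n::nat) a b. (\<forall>k<n. a k \<le> b k \<and> {a k..b k} \<subseteq> {0..T}) \<and>
        disjoint_family_on (\<lambda>k. {a k<..<b k}) {..<n} \<and> (\<Sum>k<n. b k - a k) < \<delta>
        \<longrightarrow> (\<Sum>k<n. norm (x (b k) - x (a k))) < e"
  proof (rule exI[of _ "e / (2 * (c + 1))"], intro conjI allI impI)
    show "e / (2 * (c + 1)) > 0" using e c by simp
    fix n :: nat and a b :: "nat \<Rightarrow> real"
    assume *: "(\<forall>k<n. a k \<le> b k \<and> {a k..b k} \<subseteq> {0..T}) \<and>
      disjoint_family_on (\<lambda>k. {a k<..<b k}) {..<n} \<and> (\<Sum>k<n. b k - a k) < e / (2 * (c + 1))"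
    then have ab: "\<forall>k<n. a k \<le> b k \<and> {a k..b k} \<subseteq> {0..T}"
      and disj: "disjoint_family_on (\<lambda>k. {a k<..<b k}) {..<n}"
      and small: "(\<Sum>k<n. b k - a k) < e / (2 * (c + 1))" by blast+
    have step: "norm (x (b j) - x (a j)) \<le> c * (b j - a j) + l * integral {a j..b j} (f N)" if j: "j < n" for j
    proof -
      have ab': "a j \<le> b j" "{a j..b j} \<subseteq> {0..T}" "0 \<le> a j" "b j \<le> T" using ab j by auto
      have i: "\<beta> integrable_on {a j..b j}" "f N integrable_on {a j..b j}"
        by (rule integrable_on_subinterval[OF \<beta>(1) ab'(2)], rule integrable_on_subinterval[OF f_int ab'(2)])
      have "integral {a j..b j} \<beta> \<le> integral {a j..b j} (\<lambda>s. real N + f N s)"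
        by (rule integral_le[OF i(1) integrable_add[OF integrable_const_ivl i(2)]]) (simp add: f_def)
      also have "\<dots> = real N * (b j - a j) + integral {a j..b j} (f N)"
        using integral_add[OF integrable_const_ivl[of "real N"] i(2)] ab' by (simp add: mult.commute)
      finally have "l * integral {a j..b j} \<beta> \<le> l * (real N * (b j - a j) + integral {a j..b j} (f N))"
        using kl by (intro mult_left_mono) auto
      then show ?thesis using x[OF ab'(3,1,4)] by (simp add: c_def algebra_simps)
    qed
    have "(\<Sum>j<n. norm (x (b j) - x (a j))) \<le> (\<Sum>j<n. c * (b j - a j) + l * integral {a j..b j} (f N))"
      using step by (intro sum_mono) auto
    also have "\<dots> = c * (\<Sum>j<n. b j - a j) + l * (\<Sum>j<n. integral {a j..b j} (f N))"
      by (simp add: sum.distrib sum_distrib_left)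
    also have "\<dots> \<le> c * (e / (2 * (c + 1))) + l * (e / (2 * (l + 1)))"
    proof (rule add_mono)
      show "c * (\<Sum>j<n. b j - a j) \<le> c * (e / (2 * (c + 1)))" using small c by (intro mult_left_mono) auto
      have "(\<Sum>j<n. integral {a j..b j} (f N)) \<le> integral {0..T} (f N)"
        using ab by (intro sum_integral_disjoint_le[OF f_int f_pos _ disj]) auto
      then show "l * (\<Sum>j<n. integral {a j..b j} (f N)) \<le> l * (e / (2 * (l + 1)))"
        using N kl by (intro mult_left_mono) auto
    qed
    also have "\<dots> < e"
    proof -
      have "c * (e / (2 * (c + 1))) < e / 2" using c e by (simp add: field_simps)
      moreover have "l * (e / (2 * (l + 1))) < e / 2" using kl e by (simp add: field_simps)
      ultimately show ?thesis by linarith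
    qed
    finally show "(\<Sum>k<n. norm (x (b k) - x (a k))) < e" .
  qed
qed

lemma compact_countable_dense:
  fixes K :: "'a::metric_space set"
  assumes "compact K"
  shows "\<exists>D. countable D \<and> K \<subseteq> closure D"
proof -
  have "\<forall>n. \<exists>k. finite k \<and> K \<subseteq> (\<Union>x\<in>k. ball x (inverse (real (Suc n))))"
    using assms unfolding compact_eq_totally_bounded by simp
  then obtain k where k: "\<And>n. finite (k n)" "\<And>n. K \<subseteq> (\<Union>x\<in>k n. ball x (inverse (real (Suc n))))" by metis
  have "K \<subseteq> closure (\<Union>n. k n)"
  proof
    fix z assume z: "z \<in> K"
    show "z \<in> closure (\<Union>n. k n)" unfolding closure_approachable
    proof (intro allI impI)
      fix e :: real assume "e > 0"
      then obtain n where n: "inverse (real (Suc n)) < e" using reals_Archimedean by blast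
      obtain c where "c \<in> k n" "dist c z < inverse (real (Suc n))" using k(2)[of n] z by auto
      with n show "\<exists>y\<in>\<Union>n. k n. dist y z < e" by (intro bexI[of _ c]) auto
    qed
  qed
  moreover have "countable (k n)" for n using k(1) by (rule countable_finite)
  then have "countable (\<Union>n. k n)" by (intro countable_UN) auto
  ultimately show ?thesis by blast
qed

text \<open>The cone over a compact set is a countable union of compact sets.\<close>
lemma cone_countable_dense:
  fixes K :: "'a::real_normed_vector set"
  assumes "compact K"
  shows "\<exists>D. countable D \<and> (\<forall>c\<ge>0. \<forall>z\<in>K. c *\<^sub>R z \<in> closure D)"
proof -
  define Kn where "Kn n = (\<lambda>(c, z). c *\<^sub>R z) ` ({0..real n} \<times> K)" for n :: nat
  have Kn: "compact (Kn n)" for n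
    unfolding Kn_def using assms
    by (intro compact_continuous_image compact_Times) (auto simp: case_prod_unfold intro!: continuous_intros)
  have "\<exists>D. countable D \<and> Kn n \<subseteq> closure D" for n
    by (rule compact_countable_dense[OF Kn])
  then obtain D where D: "\<And>n. countable (D n)" "\<And>n. Kn n \<subseteq> closure (D n)" by metis
  have "c *\<^sub>R z \<in> closure (\<Union>n. D n)" if "c \<ge> 0" "z \<in> K" for c z
  proof -
    obtain n where "c \<le> real n" using real_arch_simple by blast
    then have "c *\<^sub>R z \<in> Kn n"
      unfolding Kn_def using that by (intro image_eqI[of _ _ "(c, z)"]) auto
    then have "c *\<^sub>R z \<in> closure (D n)" using D(2) by blast
    then show ?thesis using closure_mono[of "D n" "\<Union>n. D n"] by blast
  qed
  then show ?thesis using D(1) by (intro exI[of _ "\<Union>n. D n"]) auto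
qed

text \<open>A Clarke tangent vector \<open>v\<close> is in particular tangent at the base point: there are points of \<open>C\<close> at
  distance \<open>o(t)\<close> from \<open>x + t v\<close>. Insert them into the quadratic inequality and divide by \<open>t\<close>.\<close>
lemma proximal_imp_clarke_normal:
  fixes \<zeta> :: "'a::real_inner"
  assumes x: "x \<in> C" and prox: "\<And>y. y \<in> C \<Longrightarrow> \<zeta> \<bullet> (y - x) \<le> \<kappa> * (dist y x)\<^sup>2" and \<kappa>: "\<kappa> \<ge> 0"
  shows "\<zeta> \<in> clarke_normal_cone C x"
proof -
  have "\<zeta> \<bullet> v \<le> 0" if v: "v \<in> clarke_tangent_cone C x" for v
  proof -
    define r where "r t = infdist (x + t *\<^sub>R v) C / t" for t
    have "filterlim (\<lambda>t. (t, x)) (at_right 0 \<times>\<^sub>F inf (nhds x) (principal C)) (at_right (0::real))"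
    proof (rule filterlim_Pair)
      show "filterlim (\<lambda>t. t) (at_right 0) (at_right (0::real))" by (rule filterlim_ident)
      show "filterlim (\<lambda>t. x) (inf (nhds x) (principal C)) (at_right (0::real))"
        using x by (auto simp: filterlim_inf filterlim_principal)
    qed
    from filterlim_compose[OF _ this, of "\<lambda>(t, y). infdist (y + t *\<^sub>R v) C / t" "nhds 0"] v
    have r0: "(r \<longlongrightarrow> 0) (at_right 0)" by (simp add: clarke_tangent_cone_def r_def[abs_def])
    have "\<forall>\<^sub>F t in at_right 0. \<zeta> \<bullet> v \<le> \<kappa> * t * (norm v + r t + t)\<^sup>2 + norm \<zeta> * (r t + t)"
      unfolding eventually_at_right_field
    proof (intro exI conjI allI impI)
      fix t :: real assume t: "0 < t" "t < 1"
      have rt: "r t \<ge> 0" using t by (simp add: r_def infdist_nonneg)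
      have "\<exists>y\<in>C. dist z y < e" if "infdist z C < e" for z e
      proof -
        have "C \<noteq> {}" using x by auto
        then show ?thesis using that unfolding infdist_def by (simp add: cInf_less_iff)
      qed
      from this[of "x + t *\<^sub>R v" "infdist (x + t *\<^sub>R v) C + t * t"]
      have "\<exists>y\<in>C. dist (x + t *\<^sub>R v) y < infdist (x + t *\<^sub>R v) C + t * t" using t by simp
      then obtain y where y: "y \<in> C" "dist (x + t *\<^sub>R v) y < infdist (x + t *\<^sub>R v) C + t * t" by blast
      define d where "d = y - x - t *\<^sub>R v"
      have "infdist (x + t *\<^sub>R v) C = t * r t" using t by (simp add: r_def)
      then have d: "norm d \<le> t * (r t + t)"
        using y(2) by (simp add: d_def dist_norm norm_minus_commute algebra_simps)
      have "y - x = t *\<^sub>R v + d" by (simp add: d_def)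
      then have "norm (y - x) \<le> t * norm v + norm d" using norm_triangle_ineq[of "t *\<^sub>R v" d] t by simp
      then have "norm (y - x) \<le> t * (norm v + r t + t)" using d by (simp add: distrib_left)
      then have "(norm (y - x))\<^sup>2 \<le> (t * (norm v + r t + t))\<^sup>2" by (intro power_mono) auto
      then have "\<kappa> * (norm (y - x))\<^sup>2 \<le> \<kappa> * (t * (norm v + r t + t))\<^sup>2" using \<kappa> by (intro mult_left_mono)
      moreover have "\<zeta> \<bullet> (y - x) \<le> \<kappa> * (norm (y - x))\<^sup>2" using prox[OF y(1)] by (simp add: dist_norm)
      moreover have "\<zeta> \<bullet> (y - x) = t * (\<zeta> \<bullet> v) + \<zeta> \<bullet> d"
        using \<open>y - x = t *\<^sub>R v + d\<close> by (simp add: inner_add_right)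
      moreover have "- (\<zeta> \<bullet> d) \<le> norm \<zeta> * (t * (r t + t))"
        using Cauchy_Schwarz_ineq2[of \<zeta> d] mult_left_mono[OF d, of "norm \<zeta>"] by simp
      ultimately have "t * (\<zeta> \<bullet> v) \<le> \<kappa> * (t * (norm v + r t + t))\<^sup>2 + norm \<zeta> * (t * (r t + t))" by linarith
      also have "\<dots> = t * (\<kappa> * t * (norm v + r t + t)\<^sup>2 + norm \<zeta> * (r t + t))"
      proof -
        have sq: "(t * q)\<^sup>2 = t * (t * q\<^sup>2)" for q by (simp add: power2_eq_square mult_ac)
        show ?thesis unfolding sq by (simp add: distrib_left mult_ac)
      qed
      finally show "\<zeta> \<bullet> v \<le> \<kappa> * t * (norm v + r t + t)\<^sup>2 + norm \<zeta> * (r t + t)"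
        using t(1) by (rule mult_left_le_imp_le)
    qed simp
    moreover have "((\<lambda>t. \<kappa> * t * (norm v + r t + t)\<^sup>2 + norm \<zeta> * (r t + t)) \<longlongrightarrow>
        \<kappa> * 0 * (norm v + 0 + 0)\<^sup>2 + norm \<zeta> * (0 + 0)) (at_right 0)"
      by (intro tendsto_intros r0)
    ultimately show ?thesis using tendsto_lowerbound[of _ _ "at_right (0::real)" "\<zeta> \<bullet> v"] by simp
  qed
  then show ?thesis using x by (simp add: clarke_normal_cone_def)
qed

lemma clarke_normal_cone_scale: "c \<ge> 0 \<Longrightarrow> \<zeta> \<in> clarke_normal_cone C x \<Longrightarrow> c *\<^sub>R \<zeta> \<in> clarke_normal_cone C x"
  by (auto simp: clarke_normal_cone_def mult_nonneg_nonpos split: if_splits)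

context sweeping_process
begin

lemma \<tau>_differentiable_ae:
  "\<exists>N. negligible N \<and> (\<forall>t\<in>{0..T} - N. (\<tau> has_vector_derivative (1 + L + M * \<beta> t)) (at t within {0..T}))"
proof -
  have "weak_primitive T \<beta> B"
    unfolding weak_primitive_def
  proof (intro allI impI)
    fix \<zeta> a b :: real assume ab: "0 \<le> a" "a \<le> b" "b \<le> T"
    have "(\<beta> has_integral (B b - B a)) {a..b}"
      using integrable_integral[OF \<beta>_integrable_sub[of a b]] B_diff[of a b] ab by simp
    then show "((\<lambda>s. \<beta> s \<bullet> \<zeta>) has_integral (B b - B a) \<bullet> \<zeta>) {a..b}"
      by (simp add: has_integral_mult_left)
  qed
  moreover have "countable \<rat>" by (rule countable_rat)
  moreover have "\<beta> s \<in> closure \<rat>" for s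
    unfolding closure_approachable
  proof (intro allI impI)
    fix e :: real assume "e > 0"
    then obtain q where "q \<in> \<rat>" "\<beta> s < q" "q < \<beta> s + e" using Rats_dense_in_real[of "\<beta> s" "\<beta> s + e"] by auto
    then show "\<exists>q\<in>\<rat>. dist q (\<beta> s) < e" by (intro bexI[of _ q]) (auto simp: dist_real_def)
  qed
  moreover have "(\<lambda>s. norm (\<beta> s - p)) integrable_on {0..T}" for p
  proof (rule measurable_bounded_by_integrable_imp_integrable)
    have "\<beta> \<in> borel_measurable (lebesgue_on {0..T})" using \<beta>(2) by (rule integrable_imp_measurable)
    then show "(\<lambda>s. norm (\<beta> s - p)) \<in> borel_measurable (lebesgue_on {0..T})" by measurable
    show "(\<lambda>s. \<beta> s + norm p) integrable_on {0..T}" by (intro integrable_add \<beta>(2) integrable_const_ivl)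
    show "norm (norm (\<beta> s - p)) \<le> \<beta> s + norm p" if "s \<in> {0..T}" for s using \<beta>(1)[OF that] by auto
  qed auto
  ultimately obtain N where N: "negligible N" "\<And>t. t \<in> {0..T} - N \<Longrightarrow> (B has_vector_derivative \<beta> t) (at t within {0..T})"
    using weak_primitive_differentiable_ae[of T \<beta> B \<rat>] by blast
  have "(\<tau> has_vector_derivative (1 + L + M * \<beta> t)) (at t within {0..T})" if "t \<in> {0..T} - N" for t
  proof -
    have "(B has_real_derivative \<beta> t) (at t within {0..T})"
      using N(2)[OF that] by (simp only: has_real_derivative_iff_has_vector_derivative)
    from DERIV_add[OF DERIV_cmult_Id[of "1 + L"] DERIV_cmult[OF this, of M]]
    have vd: "((\<lambda>t. (1 + L) * t + M * B t) has_vector_derivative (1 + L + M * \<beta> t)) (at t within {0..T})"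
      by (rule has_real_derivative_iff_has_vector_derivative[THEN iffD1])
    show ?thesis
      by (rule has_vector_derivative_transform[OF _ \<tau>_def vd]) (use that in blast)
  qed
  with N(1) show ?thesis by blast
qed

text \<open>The solution is differentiated through \<open>x t = x0 - H t - \<Omega> (\<tau> t)\<close>. The exceptional set of
  \<open>\<Omega>\<close> lives in the time \<open>\<sigma> = \<tau> t\<close>; its preimage is negligible because the inverse of \<open>\<tau>\<close> is
  Lipschitz. The factor \<open>\<tau>'\<close> from the chain rule is harmless since normals form a cone.\<close>
theorem sweeping_solution_exists: "\<exists>x. sweeping_solution T C g x0 x"
proof -
  obtain x H \<Omega> w N D where x: "\<And>t. t \<in> {0..T} \<Longrightarrow> x t = x0 - H t - \<Omega> (\<tau> t)" "x 0 = x0"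
     and lip: "\<And>s t. 0 \<le> s \<Longrightarrow> s \<le> t \<Longrightarrow> t \<le> T \<Longrightarrow> norm (x t - x s) \<le> 2 * (\<tau> t - \<tau> s)"
     and H: "weak_primitive T (\<lambda>t. g t (x t)) H" "\<And>p. (\<lambda>t. norm (g t (x t) - p)) integrable_on {0..T}"
     and W: "weak_primitive S w \<Omega>" "\<And>p. (\<lambda>\<sigma>. norm (w \<sigma> - p)) integrable_on {0..S}"
     and D: "countable D" "\<And>\<sigma>. \<sigma> \<in> {0..S} \<Longrightarrow> w \<sigma> \<in> closure D" and N: "negligible N"
     and normal: "\<And>t. t \<in> {0..<T} \<Longrightarrow> x t \<in> C t"
       "\<And>t y. t \<in> {0..<T} \<Longrightarrow> \<tau> t \<notin> N \<Longrightarrow> y \<in> C t \<Longrightarrow> w (\<tau> t) \<bullet> (y - x t) \<le> \<kappa> * (dist y (x t))\<^sup>2"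
    by (rule weak_solution_exists) blast
  obtain N1 where N1: "negligible N1" "\<And>s. s \<in> {0..S} - N1 \<Longrightarrow> (\<Omega> has_vector_derivative w s) (at s within {0..S})"
    using weak_primitive_differentiable_ae[OF W(1) D W(2)] by blast
  obtain D2 where D2: "countable D2" "\<And>c z. c \<ge> 0 \<Longrightarrow> z \<in> K \<Longrightarrow> c *\<^sub>R z \<in> closure D2"
    using cone_countable_dense[OF K(1)] by blast
  have gD: "g t (x t) \<in> closure D2" if t: "t \<in> {0..T}" for t
    using g_growth[OF t, of "x t"] D2(2) \<beta>(1)[OF t] by auto
  obtain N2 where N2: "negligible N2" "\<And>t. t \<in> {0..T} - N2 \<Longrightarrow> (H has_vector_derivative g t (x t)) (at t within {0..T})"
    using weak_primitive_differentiable_ae[OF H(1) D2(1) gD H(2)] by blast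
  obtain N3 where N3: "negligible N3" "\<And>t. t \<in> {0..T} - N3 \<Longrightarrow> (\<tau> has_vector_derivative (1 + L + M * \<beta> t)) (at t within {0..T})"
    using \<tau>_differentiable_ae by blast
  define P where "P = \<tau>_inv ` ({0..S} \<inter> (N \<union> N1))"
  have P: "negligible P" unfolding P_def
  proof (rule negligible_locally_Lipschitz_image)
    show "negligible ({0..S} \<inter> (N \<union> N1))" using N N1(1) by (intro negligible_Int negligible_Un) auto
    fix u assume u: "u \<in> {0..S} \<inter> (N \<union> N1)"
    show "\<exists>A B. open A \<and> u \<in> A \<and> (\<forall>y\<in>{0..S} \<inter> (N \<union> N1) \<inter> A. norm (\<tau>_inv y - \<tau>_inv u) \<le> B * norm (y - u))"
      using \<tau>_inv_lipschitz(1)[of u] u by (intro exI[of _ UNIV] exI[of _ 1]) auto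
  qed simp
  \<comment> \<open>The final time is exceptional because the normals are controlled only before \<open>T\<close>.\<close>
  define Z where "Z = P \<union> N2 \<union> N3 \<union> {T}"
  have Z: "negligible Z" unfolding Z_def using P N2(1) N3(1) by (intro negligible_Un) auto
  have main: "\<exists>x'. (x has_vector_derivative x') (at t within {0..T}) \<and>
        - x' \<in> {\<zeta> + g t (x t) | \<zeta>. \<zeta> \<in> clarke_normal_cone (C t) (x t)}" if t: "t \<in> {0..T} - Z" for t
  proof -
    have t': "t \<in> {0..<T}" "t \<in> {0..T}" "t \<in> {0..T} - N2" "t \<in> {0..T} - N3" using t by (auto simp: Z_def)
    have "\<tau> t \<notin> N \<union> N1"
    proof
      assume "\<tau> t \<in> N \<union> N1"
      then have "\<tau>_inv (\<tau> t) \<in> P" unfolding P_def using \<tau>_range[OF t'(2)] by blast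
      then show False using t \<tau>_inv_\<tau>[OF t'(2)] by (simp add: Z_def)
    qed
    then have \<tau>N: "\<tau> t \<notin> N" "\<tau> t \<in> {0..S} - N1" using \<tau>_range[OF t'(2)] by auto
    define c where "c = 1 + L + M * \<beta> t"
    have c: "c \<ge> 0" using pos M_ge \<beta>(1)[OF t'(2)] by (simp add: c_def)
    have "(\<Omega> has_vector_derivative w (\<tau> t)) (at (\<tau> t) within \<tau> ` {0..T})"
      by (rule has_vector_derivative_within_subset[OF N1(2)[OF \<tau>N(2)]]) (use \<tau>_range in auto)
    from vector_diff_chain_within[OF N3(2)[OF t'(4)] this]
    have "((\<lambda>t. \<Omega> (\<tau> t)) has_vector_derivative c *\<^sub>R w (\<tau> t)) (at t within {0..T})"
      by (simp add: o_def c_def)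
    then have "((\<lambda>t. x0 - H t - \<Omega> (\<tau> t)) has_vector_derivative (0 - g t (x t) - c *\<^sub>R w (\<tau> t))) (at t within {0..T})"
      by (intro has_vector_derivative_diff has_vector_derivative_const N2(2)[OF t'(3)])
    then have der: "(x has_vector_derivative (0 - g t (x t) - c *\<^sub>R w (\<tau> t))) (at t within {0..T})"
      by (rule has_vector_derivative_transform[OF t'(2), rotated]) (rule x(1))
    have "c *\<^sub>R w (\<tau> t) \<in> clarke_normal_cone (C t) (x t)"
      by (intro clarke_normal_cone_scale c proximal_imp_clarke_normal[OF normal(1)[OF t'(1)] normal(2)[OF t'(1) \<tau>N(1)] pos(3)])
    then have "- (0 - g t (x t) - c *\<^sub>R w (\<tau> t)) \<in> {\<zeta> + g t (x t) | \<zeta>. \<zeta> \<in> clarke_normal_cone (C t) (x t)}"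
      by (intro CollectI exI[of _ "c *\<^sub>R w (\<tau> t)"]) simp
    with der show ?thesis by blast
  qed
  have "AE t in lebesgue_on {0..T}. \<exists>x'. (x has_vector_derivative x') (at t within {0..T}) \<and>
        - x' \<in> {\<zeta> + g t (x t) | \<zeta>. \<zeta> \<in> clarke_normal_cone (C t) (x t)}"
  proof -
    have "Z \<in> null_sets lebesgue" using Z by (simp add: negligible_iff_null_sets)
    then have "AE t in lebesgue. t \<in> {0..T} \<longrightarrow> (\<exists>x'. (x has_vector_derivative x') (at t within {0..T}) \<and>
        - x' \<in> {\<zeta> + g t (x t) | \<zeta>. \<zeta> \<in> clarke_normal_cone (C t) (x t)})"
      by (rule AE_I') (use main in blast)
    then show ?thesis by (subst AE_restrict_space_iff) auto
  qed
  moreover have "abs_continuous_on {0..T} x"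
  proof (rule abs_continuous_on_of_integral_bound[OF \<beta>(2,1)])
    show "norm (x t - x s) \<le> 2 * (1 + L) * (t - s) + 2 * M * integral {s..t} \<beta>" if "0 \<le> s" "s \<le> t" "t \<le> T" for s t
      using lip[OF that] unfolding \<tau>_diff_ge(1)[OF that, symmetric] B_diff[OF that] by (simp add: algebra_simps)
  qed (use pos M_ge in auto)
  ultimately show ?thesis using x(2) unfolding sweeping_solution_def by blast
qed

end

section \<open>Moving sublevel sets\<close>

text \<open>By compactness a sequence violating continuity has a subsequence along which \<open>h\<close> converges to some \<open>l\<close>.
  Upper semicontinuity in the direction \<open>l - h x\<close> forces \<open>l = h x\<close>.\<close>
lemma isCont_of_scalarly_usc_compact:
  fixes h :: "'a::real_inner \<Rightarrow> 'b::real_inner"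
  assumes usc: "\<And>\<zeta> e. e > 0 \<Longrightarrow> \<exists>d>0. \<forall>y. dist y x < d \<longrightarrow> \<zeta> \<bullet> h y < \<zeta> \<bullet> h x + e"
    and Q: "compact Q" "\<And>y. dist y x < 1 \<Longrightarrow> h y \<in> Q"
  shows "isCont h x"
proof (rule ccontr)
  assume "\<not> isCont h x"
  then obtain e where e: "e > 0" "\<And>d. d > 0 \<Longrightarrow> \<exists>y. dist y x < d \<and> \<not> dist (h y) (h x) < e"
    unfolding continuous_at_eps_delta by blast
  have "\<exists>y. dist y x < inverse (real (Suc n)) \<and> \<not> dist (h y) (h x) < e" for n
    by (rule e(2)) simp
  then obtain X where X: "\<And>n. dist (X n) x < inverse (real (Suc n))" "\<And>n. \<not> dist (h (X n)) (h x) < e" by metis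
  have "dist (X n) x < 1" for n
  proof -
    have "inverse (real (Suc n)) \<le> 1" by (simp add: inverse_le_1_iff)
    then show ?thesis using X(1)[of n] by linarith
  qed
  then have "\<forall>n. (h \<circ> X) n \<in> Q" using Q(2) by simp
  then obtain l r where r: "strict_mono (r :: nat \<Rightarrow> nat)" and l: "((h \<circ> X) \<circ> r) \<longlonglongrightarrow> l"
    using Q(1) unfolding compact_eq_seq_compact_metric seq_compact_def by metis
  have hl: "(\<lambda>n. h (X (r n))) \<longlonglongrightarrow> l" using l by (simp add: o_def)
  define \<zeta> where "\<zeta> = l - h x"
  have "\<zeta> \<bullet> l \<le> \<zeta> \<bullet> h x"
  proof (rule field_le_epsilon)
    fix e' :: real assume "e' > 0"
    then obtain d where d: "d > 0" "\<And>y. dist y x < d \<Longrightarrow> \<zeta> \<bullet> h y < \<zeta> \<bullet> h x + e'" using usc by blast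
    obtain n0 where n0: "inverse (real (Suc n0)) < d" using d(1) reals_Archimedean by blast
    have "\<zeta> \<bullet> h (X (r n)) \<le> \<zeta> \<bullet> h x + e'" if "n \<ge> n0" for n
    proof -
      have "n0 \<le> r n" using seq_suble[OF r, of n] that by simp
      then have "inverse (real (Suc (r n))) \<le> inverse (real (Suc n0))" by simp
      then have "dist (X (r n)) x < d" using X(1)[of "r n"] n0 by (meson less_le_trans less_trans order_less_le_trans)
      then show ?thesis using d(2) by (simp add: less_imp_le)
    qed
    then show "\<zeta> \<bullet> l \<le> \<zeta> \<bullet> h x + e'"
      by (intro LIMSEQ_le_const2[OF tendsto_inner[OF tendsto_const hl]]) blast
  qed
  then have "\<zeta> \<bullet> \<zeta> \<le> 0" by (simp add: \<zeta>_def inner_diff_right inner_diff_left inner_commute)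
  then have "l = h x" by (metis \<zeta>_def eq_iff_diff_eq_0 inner_eq_zero_iff inner_ge_zero order_antisym)
  then have "\<forall>\<^sub>F n in sequentially. dist (h (X (r n))) (h x) < e"
    using hl e(1) by (simp add: tendsto_iff)
  then show False using X(2) by simp
qed

lemma open_enlargement: "open (enlargement \<rho> A)"
proof -
  have "continuous_on UNIV (\<lambda>x. ereal (infdist x A))"
    by (intro continuous_on_ereal continuous_on_infdist continuous_on_id)
  then show ?thesis unfolding enlargement_def by (intro open_Collect_less continuous_on_const)
qed

theorem theorem3p1:
  fixes T :: real and m :: nat
    and f :: "nat \<Rightarrow> real \<Rightarrow> 'a::{real_inner, complete_space} \<Rightarrow> real"
    and g :: "real \<Rightarrow> 'a \<Rightarrow> 'a"
    and \<rho> :: ereal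
    and K :: "'a set" and \<beta> :: "real \<Rightarrow> real"
    and x0 :: 'a
  assumes T: "T > 0" and m: "m \<ge> 1"
    and nonempty: "\<forall>t\<in>{0..T}. constraint_set m f t \<noteq> {}"
    and rho: "\<rho> > 0"
    and A1: "\<exists>L1>0. \<forall>x. \<forall>i\<in>{1..m}. L1-lipschitz_on {0..T} (\<lambda>t. f i t x)"
    and A2: "\<forall>t\<in>{0..T}. \<forall>i\<in>{1..m}.
               local_lipschitz {t} (enlargement \<rho> (constraint_set m f t)) (f i)"
    and A3: "\<exists>\<gamma>>0. \<forall>t\<in>{0..T}. \<forall>i\<in>{1..m}.
               \<forall>x1\<in>enlargement \<rho> (constraint_set m f t).
               \<forall>x2\<in>enlargement \<rho> (constraint_set m f t).
               \<forall>\<xi>1\<in>clarke_subdiff (f i t) x1. \<forall>\<xi>2\<in>clarke_subdiff (f i t) x2.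
                 (\<xi>1 - \<xi>2) \<bullet> (x1 - x2) \<ge> - \<gamma> * (norm (x1 - x2))\<^sup>2"
    and A4: "\<exists>\<mu>>0. \<forall>t\<in>{0..T}. \<forall>x\<in>constraint_set m f t.
               \<exists>v. norm v = 1 \<and>
                 (\<forall>i\<in>{1..m}. \<forall>\<xi>\<in>clarke_subdiff (f i t) x. \<xi> \<bullet> v \<le> - \<mu>)"
    and g_meas: "\<forall>x. (\<lambda>t. g t x) \<in> borel_measurable (lebesgue_on {0..T})"
    and g_usc: "\<forall>t\<in>{0..T}. scalarly_usc (\<lambda>x. {g t x})"
    and K: "compact K" "K \<subseteq> cball 0 1"
    and beta: "\<forall>t\<in>{0..T}. \<beta> t \<ge> 0" "integrable (lebesgue_on {0..T}) \<beta>"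
    and g_growth: "\<forall>t\<in>{0..T}. \<forall>x. g t x \<in> (\<lambda>z. (\<beta> t * (1 + norm x)) *\<^sub>R z) ` K"
    and x0: "x0 \<in> constraint_set m f 0"
  shows "\<exists>x. sweeping_solution T (constraint_set m f) g x0 x"
proof -
  let ?C = "constraint_set m f"
  obtain L1 where L1: "L1 > 0" "\<And>x i. i \<in> {1..m} \<Longrightarrow> L1-lipschitz_on {0..T} (\<lambda>t. f i t x)" using A1 by blast
  obtain \<gamma> where \<gamma>: "\<gamma> > 0" "\<And>t i x1 x2 \<xi>1 \<xi>2. \<lbrakk>t \<in> {0..T}; i \<in> {1..m}; x1 \<in> enlargement \<rho> (?C t);
      x2 \<in> enlargement \<rho> (?C t); \<xi>1 \<in> clarke_subdiff (f i t) x1; \<xi>2 \<in> clarke_subdiff (f i t) x2\<rbrakk>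
      \<Longrightarrow> (\<xi>1 - \<xi>2) \<bullet> (x1 - x2) \<ge> - \<gamma> * (norm (x1 - x2))\<^sup>2" using A3 by metis
  obtain \<mu> where \<mu>: "\<mu> > 0" "\<And>t x. \<lbrakk>t \<in> {0..T}; x \<in> ?C t\<rbrakk> \<Longrightarrow> \<exists>v. norm v = 1 \<and>
      (\<forall>i\<in>{1..m}. \<forall>\<xi>\<in>clarke_subdiff (f i t) x. \<xi> \<bullet> v \<le> - \<mu>)" using A4 by metis
  obtain r where r: "r > 0" "ereal r \<le> \<rho>"
  proof (cases \<rho>)
    case (real s)
    then show thesis using that[of s] rho by simp
  next
    case PInf
    then show thesis using that[of 1] by simp
  next
    case MInf
    then show thesis using rho by simp
  qed
  have system: "hypomonotone_sublevel_system {1..m} (\<lambda>i. f i t) (enlargement \<rho> (?C t)) (?C t) r \<gamma> \<mu>"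
    if t: "t \<in> {0..T}" for t
  proof
    show "finite {1..m}" "{1..m} \<noteq> {}" using m by auto
    show "?C t = {x. \<forall>i\<in>{1..m}. f i t x \<le> 0}" by (simp add: constraint_set_def)
    show "r > 0" "\<gamma> > 0" "\<mu> > 0" by fact+
    show "ball x r \<subseteq> enlargement \<rho> (?C t)" if x: "x \<in> ?C t" for x
    proof
      fix y assume "y \<in> ball x r"
      then have "infdist y (?C t) < r" using infdist_le[OF x, of y] by (simp add: dist_commute)
      then have "ereal (infdist y (?C t)) < ereal r" by simp
      also note r(2)
      finally show "y \<in> enlargement \<rho> (?C t)" unfolding enlargement_def by (rule CollectI)
    qed
    show "\<exists>d>0. \<exists>L. L-lipschitz_on (ball x d) (f i t)" if i: "i \<in> {1..m}" and x: "x \<in> enlargement \<rho> (?C t)" for i x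
    proof -
      have "local_lipschitz {t} (enlargement \<rho> (?C t)) (f i)" using A2 t i by blast
      then obtain u L where u: "u > 0" "\<forall>s\<in>cball t u \<inter> {t}. L-lipschitz_on (cball x u \<inter> enlargement \<rho> (?C t)) (f i s)"
        unfolding local_lipschitz_def using x by blast
      then have lip: "L-lipschitz_on (cball x u \<inter> enlargement \<rho> (?C t)) (f i t)" by simp
      obtain d where d: "d > 0" "ball x d \<subseteq> enlargement \<rho> (?C t)"
        using open_enlargement x by (metis open_contains_ball)
      have "L-lipschitz_on (ball x (min d u)) (f i t)" by (rule lipschitz_on_subset[OF lip]) (use d in auto)
      then show ?thesis using d(1) u(1) by (intro exI[of _ "min d u"]) auto
    qed
    show "\<exists>v. norm v = 1 \<and> (\<forall>i\<in>{1..m}. \<forall>\<xi>\<in>clarke_subdiff (f i t) x. \<xi> \<bullet> v \<le> - \<mu>)" if "x \<in> ?C t" for x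
      using \<mu>(2)[OF t that] .
  qed (rule \<gamma>(2)[OF t])
  \<comment> \<open>A change of time by \<open>h\<close> raises the constraints by at most \<open>L1 h\<close>, which the descent over a distance \<open>L h\<close> compensates.\<close>
  define L where "L = 2 * L1 / \<mu>"
  define \<eta> where "\<eta> = min (r / 8) (\<mu> / (32 * \<gamma>))"
  \<comment> \<open>For time differences up to \<open>\<delta>0\<close> the displacement \<open>L * \<delta>0\<close> is in the range of lemma \<open>descent\<close>.\<close>
  define \<delta>0 where "\<delta>0 = min r (\<mu> / \<gamma>) / (2 * L)"
  have L: "L > 0" using L1 \<mu> by (simp add: L_def)
  have "sweeping_process T L (\<gamma> / \<mu> + 1 / r) \<eta> \<delta>0 ?C g K \<beta> x0"
  proof
    show "T > 0" "L > 0" by fact+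
    show "\<gamma> / \<mu> + 1 / r \<ge> 0" "\<eta> > 0" "\<delta>0 > 0" using \<gamma>(1) \<mu>(1) r(1) L by (auto simp: \<eta>_def \<delta>0_def)
    show "closed (?C t)" if "t \<in> {0..T}" for t
      by (rule hypomonotone_sublevel_system.closed_C[OF system[OF that]])
    show "\<exists>y\<in>?C t. dist x y \<le> L * \<bar>t - s\<bar>"
      if s: "s \<in> {0..T}" and t: "t \<in> {0..T}" and x: "x \<in> ?C s" and ts: "\<bar>t - s\<bar> \<le> \<delta>0" for s t x
    proof (cases "t = s")
      case True
      then show ?thesis using x by auto
    next
      case False
      define d where "d = L * \<bar>t - s\<bar>"
      have d0: "d > 0" using False L by (simp add: d_def)
      have "d \<le> L * \<delta>0" unfolding d_def using ts L by (intro mult_left_mono) auto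
      also have "\<dots> = min r (\<mu> / \<gamma>) / 2" using L by (simp add: \<delta>0_def)
      also have "\<dots> < min r (\<mu> / \<gamma>)"
      proof -
        have half: "a / 2 < a" if "a > 0" for a :: real using that by simp
        show ?thesis by (rule half) (use r(1) \<mu>(1) \<gamma>(1) in simp)
      qed
      finally have d: "d < r" "d < \<mu> / \<gamma>" by auto
      obtain y where y: "dist x y \<le> d" "\<And>i. i \<in> {1..m} \<Longrightarrow> f i s y \<le> - \<mu> * d / 2"
        using hypomonotone_sublevel_system.descent[OF system[OF s] x d0 d] by blast
      have "f i t y \<le> 0" if i: "i \<in> {1..m}" for i
      proof -
        have "\<bar>f i t y - f i s y\<bar> \<le> L1 * \<bar>t - s\<bar>"
          using lipschitz_onD[OF L1(2)[OF i] t s] by (simp add: dist_real_def)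
        moreover have "- \<mu> * d / 2 = - (L1 * \<bar>t - s\<bar>)" using \<mu>(1) by (simp add: d_def L_def)
        ultimately show ?thesis using y(2)[OF i] by linarith
      qed
      then show ?thesis using y(1) by (intro bexI[of _ y]) (auto simp: constraint_set_def d_def)
    qed
    show "\<exists>p\<in>?C t. (\<forall>y\<in>?C t. dist z p \<le> dist z y) \<and>
         (\<forall>y\<in>?C t. (z - p) \<bullet> (y - p) \<le> (\<gamma> / \<mu> + 1 / r) * norm (z - p) * (dist y p)\<^sup>2)"
      if t: "t \<in> {0..T}" and z: "infdist z (?C t) < \<eta>" for t z
    proof -
      obtain p where p: "p \<in> ?C t" "\<And>y. y \<in> ?C t \<Longrightarrow> dist z p \<le> dist z y"
      proof -
        have "?C t \<noteq> {}" "\<eta> \<le> r / 8" "\<eta> \<le> \<mu> / (32 * \<gamma>)" unfolding \<eta>_def using nonempty t by auto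
        from hypomonotone_sublevel_system.projection_exists[OF system[OF t] this z] that show thesis by blast
      qed
      then show ?thesis
        using hypomonotone_sublevel_system.proximal_normal_inequality[OF system[OF t] p] by blast
    qed
    show "(\<lambda>t. g t x) \<in> borel_measurable (lebesgue_on {0..T})" for x using g_meas by blast
    show "isCont (g t) x" if t: "t \<in> {0..T}" for t x
    proof (rule isCont_of_scalarly_usc_compact)
      fix \<zeta> :: 'a and e :: real assume e: "e > 0"
      have "Limsup (at x) (\<lambda>y. ereal (\<zeta> \<bullet> g t y)) \<le> ereal (\<zeta> \<bullet> g t x)"
        using g_usc t by (simp add: scalarly_usc_def upper_semicontinuous_def)
      also have "\<dots> < ereal (\<zeta> \<bullet> g t x + e)" using e by simp
      finally have "\<forall>\<^sub>F y in at x. ereal (\<zeta> \<bullet> g t y) < ereal (\<zeta> \<bullet> g t x + e)" by (rule Limsup_lessD)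
      then obtain d where d: "d > 0" "\<And>y. y \<noteq> x \<Longrightarrow> dist y x < d \<Longrightarrow> \<zeta> \<bullet> g t y < \<zeta> \<bullet> g t x + e"
        unfolding eventually_at by auto
      then have "\<zeta> \<bullet> g t y < \<zeta> \<bullet> g t x + e" if "dist y x < d" for y
        using that e by (cases "y = x") auto
      with d(1) show "\<exists>d>0. \<forall>y. dist y x < d \<longrightarrow> \<zeta> \<bullet> g t y < \<zeta> \<bullet> g t x + e" by blast
    next
      show "compact ((\<lambda>(c, z). c *\<^sub>R z) ` ({0..\<beta> t * (2 + norm x)} \<times> K))"
        using K(1) by (intro compact_continuous_image compact_Times)
          (auto simp: case_prod_unfold intro!: continuous_intros)
      fix y assume "dist y x < 1"
      then have "1 + norm y \<le> 2 + norm x" using norm_triangle_ineq2[of y x] by (simp add: dist_norm)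
      then have "\<beta> t * (1 + norm y) \<in> {0..\<beta> t * (2 + norm x)}"
        using beta(1) t by (auto intro!: mult_left_mono mult_nonneg_nonneg)
      moreover obtain z where "z \<in> K" "g t y = (\<beta> t * (1 + norm y)) *\<^sub>R z" using g_growth t by blast
      ultimately show "g t y \<in> (\<lambda>(c, z). c *\<^sub>R z) ` ({0..\<beta> t * (2 + norm x)} \<times> K)"
        by (intro image_eqI[of _ _ "(\<beta> t * (1 + norm y), z)"]) auto
    qed
    show "compact K" "K \<subseteq> cball 0 1" by fact+
    show "\<beta> t \<ge> 0" if "t \<in> {0..T}" for t using beta(1) that by blast
    show "\<beta> integrable_on {0..T}" using beta(2) by (intro integrable_on_lebesgue_on) auto
    show "g t x \<in> (\<lambda>z. (\<beta> t * (1 + norm x)) *\<^sub>R z) ` K" if "t \<in> {0..T}" for t x using g_growth that by blast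
    show "x0 \<in> ?C 0" by (rule x0)
  qed
  then show ?thesis by (rule sweeping_process.sweeping_solution_exists)
qed

end
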